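(* Let $\mathfrak g$ be a simple complex Lie algebra, $q\in\mathbb C^\times$ with $q^{2d_i}\ne1$ for all $i$, and let $\pi:U_q(\mathfrak g)\to B$ be a cocentral morphism of Hopf algebras. Then $\pi(x)=\varepsilon(x)1$ for all $x\in U_q(\mathfrak g)$. In particular, the Hopf cocenter of $U_q(\mathfrak g)$ is trivial: $\mathcal{HC}(U_q(\mathfrak g))=\mathbb C$.
   Context: A Hopf algebra morphism $\pi:A\to B$ is cocentral if $(\mathrm{id}\otimes\pi)\circ\Delta=(\mathrm{id}\otimes\pi)\circ\Delta^{\mathrm{op}}$, where $\Delta^{\mathrm{op}}(x)=x_{(2)}\otimes x_{(1)}$. The Hopf cocenter $A\to\mathcal{HC}(A)$ is the quotient Hopf algebra of $A$ universal among cocentral quotients: the quotient map is cocentral and every cocentral morphism from $A$ factors uniquely through it. Let $\mathfrak g$ have rank $\ell$, simple roots $\alpha_1,\dots,\alpha_\ell$, Cartan matrix $(a_{ij})$, and let $d_i=(\alpha_i,\alpha_i)/2$ for the invariant symmetric bilinear form normalized so that short roots have $(\alpha,\alpha)=2$; put $q_i=q^{d_i}$. $U_q(\mathfrak g)$ is the complex algebra generated by $E_i,F_i,K_i^{\pm1}$, $1\le i\le\ell$, with relations: the $K_i$ are invertible and commute; $K_iE_jK_i^{-1}=q_i^{a_{ij}}E_j$; $K_iF_jK_i^{-1}=q_i^{-a_{ij}}F_j$; $[E_i,F_j]=\delta_{ij}\frac{K_i-K_i^{-1}}{q_i-q_i^{-1}}$; and the quantum Serre relations, for $i\ne j$, $$\sum_{r=0}^{1-a_{ij}}(-1)^r\begin{bmatrix}1-a_{ij}\\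 r\end{bmatrix}_{q_i}E_i^{1-a_{ij}-r}E_jE_i^{r}=0,$$ and the same with $F$ in place of $E$ (symmetric Gaussian binomial coefficients). Its Hopf algebra structure has $K_i$ grouplike, $\Delta(E_i)=E_i\otimes K_i+1\otimes E_i$, $\Delta(F_i)=F_i\otimes1+K_i^{-1}\otimes F_i$. *)

theory Defs
  imports
    Complex_Main
    "HOL-Library.FuncSet"
    "HOL-Library.Poly_Mapping"
    "HOL-Algebra.Module"
    "HOL-Algebra.QuotRing"
begin

section \<open>Simple complex Lie algebras, simple roots and Cartan matrices\<close>

locale lie_algebra = vector_space scale
  for scale :: "complex \<Rightarrow> 'g::ab_group_add \<Rightarrow> 'g" +
  fixes br :: "'g \<Rightarrow> 'g \<Rightarrow> 'g"
  assumes br_linear_right: "Vector_Spaces.linear scale scale (\<lambda>y. br x y)"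
    and br_linear_left: "Vector_Spaces.linear scale scale (\<lambda>x. br x y)"
    and br_self: "br x x = 0"
    and jacobi: "br x (br y z) + br y (br z x) + br z (br x y) = 0"

locale simple_lie_algebra = lie_algebra +
  assumes finite_dimensional: "\<exists>S. finite S \<and> span S = UNIV"
    and nonabelian: "\<exists>x y. br x y \<noteq> 0"
    and no_proper_ideals:
      "subspace I \<Longrightarrow> (\<And>x y. y \<in> I \<Longrightarrow> br x y \<in> I) \<Longrightarrow> I = {0} \<or> I = UNIV"

context lie_algebra
begin

text \<open>A Cartan subalgebra is taken to be a self-centralizing abelian subalgebra whose adjoint
  action is diagonalizable.\<close>

definition cartan_subalgebra :: "'g set \<Rightarrow> bool" where
  "cartan_subalgebra H \<longleftrightarrow>
     subspace H \<and>
     (\<forall>x\<in>H. \<forall>y\<in>H. br x y = 0) \<and>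
     (\<forall>x. (\<forall>h\<in>H. br h x = 0) \<longrightarrow> x \<in> H) \<and>
     span {x. \<exists>\<mu>. \<forall>h\<in>H. br h x = scale (\<mu> h) x} = UNIV"

text \<open>Elements of the dual of \<open>H\<close> are represented by functions that are \<^const>\<open>undefined\<close>
  outside \<open>H\<close>; a function occurring as the weight of a nonzero vector is automatically linear
  on \<open>H\<close>.\<close>

definition roots :: "'g set \<Rightarrow> ('g \<Rightarrow> complex) set" where
  "roots H = {\<beta> \<in> extensional H. (\<exists>h\<in>H. \<beta> h \<noteq> 0) \<and>
     (\<exists>x. x \<noteq> 0 \<and> (\<forall>h\<in>H. br h x = scale (\<beta> h) x))}"

definition simple_roots :: "'g set \<Rightarrow> ('i::finite \<Rightarrow> 'g \<Rightarrow> complex) \<Rightarrow> bool" where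
  "simple_roots H \<alpha> \<longleftrightarrow>
     (\<forall>i. \<alpha> i \<in> roots H) \<and>
     (\<forall>c. (\<forall>h\<in>H. (\<Sum>i\<in>UNIV. c i * \<alpha> i h) = 0) \<longrightarrow> (\<forall>i. c i = 0)) \<and>
     (\<forall>\<beta>\<in>roots H. \<exists>n :: 'i \<Rightarrow> nat.
        (\<forall>h\<in>H. \<beta> h = (\<Sum>i\<in>UNIV. of_nat (n i) * \<alpha> i h)) \<or>
        (\<forall>h\<in>H. \<beta> h = - (\<Sum>i\<in>UNIV. of_nat (n i) * \<alpha> i h)))"

definition invariant_form :: "('g \<Rightarrow> 'g \<Rightarrow> complex) \<Rightarrow> bool" where
  "invariant_form \<kappa> \<longleftrightarrow>
     (\<forall>x. Vector_Spaces.linear scale (*) (\<kappa> x)) \<and>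
     (\<forall>x y. \<kappa> x y = \<kappa> y x) \<and>
     (\<forall>x y z. \<kappa> (br x y) z = \<kappa> x (br y z)) \<and>
     (\<forall>x. (\<forall>y. \<kappa> x y = 0) \<longrightarrow> x = 0)"

end

text \<open>The form induced on the dual of \<open>H\<close> by the restriction of \<open>\<kappa>\<close> to \<open>H\<close>.\<close>

definition dual_vector :: "'g set \<Rightarrow> ('g \<Rightarrow> 'g \<Rightarrow> complex) \<Rightarrow> ('g \<Rightarrow> complex) \<Rightarrow> 'g" where
  "dual_vector H \<kappa> \<beta> = (THE t. t \<in> H \<and> (\<forall>h\<in>H. \<kappa> t h = \<beta> h))"

definition dual_form ::
    "'g set \<Rightarrow> ('g \<Rightarrow> 'g \<Rightarrow> complex) \<Rightarrow> ('g \<Rightarrow> complex) \<Rightarrow> ('g \<Rightarrow> complex) \<Rightarrow> complex" where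
  "dual_form H \<kappa> \<beta> \<gamma> = \<kappa> (dual_vector H \<kappa> \<beta>) (dual_vector H \<kappa> \<gamma>)"

text \<open>The rank is \<open>CARD('i)\<close>. The assumptions \<open>cartan_matrix\<close> and \<open>half_length\<close> only give names to
  the integers \<open>2(\<alpha>\<^sub>i,\<alpha>\<^sub>j)/(\<alpha>\<^sub>i,\<alpha>\<^sub>i)\<close> and \<open>(\<alpha>\<^sub>i,\<alpha>\<^sub>i)/2\<close>.\<close>

locale simple_lie_datum = simple_lie_algebra scale br
  for scale :: "complex \<Rightarrow> 'g::ab_group_add \<Rightarrow> 'g" and br :: "'g \<Rightarrow> 'g \<Rightarrow> 'g" +
  fixes H :: "'g set"
    and \<alpha> :: "'i::finite \<Rightarrow> 'g \<Rightarrow> complex"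
    and \<kappa> :: "'g \<Rightarrow> 'g \<Rightarrow> complex"
    and a :: "'i \<Rightarrow> 'i \<Rightarrow> int"
    and d :: "'i \<Rightarrow> nat"
  assumes cartan: "cartan_subalgebra H"
    and simple: "simple_roots H \<alpha>"
    and form: "invariant_form \<kappa>"
    and roots_length_ge: "\<beta> \<in> roots H \<Longrightarrow> \<exists>r\<ge>2. dual_form H \<kappa> \<beta> \<beta> = complex_of_real r"
    and short_roots_length: "\<exists>\<beta>\<in>roots H. dual_form H \<kappa> \<beta> \<beta> = 2"
    and cartan_matrix:
      "of_int (a i j) = 2 * dual_form H \<kappa> (\<alpha> i) (\<alpha> j) / dual_form H \<kappa> (\<alpha> i) (\<alpha> i)"
    and half_length: "of_nat (d i) = dual_form H \<kappa> (\<alpha> i) (\<alpha> i) / 2"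


section \<open>Complex algebras\<close>

definition algebra_of_type :: "(complex \<Rightarrow> 'a::ring_1 \<Rightarrow> 'a) \<Rightarrow> (complex, 'a) module" where
  "algebra_of_type s =
     \<lparr>carrier = UNIV, mult = (*), one = 1, zero = 0, add = (+), smult = s\<rparr>"

abbreviation complex_field :: "(complex, complex) module" where
  "complex_field \<equiv> algebra_of_type (*)"

text \<open>The library's \<^locale>\<open>algebra\<close> is restricted to commutative algebras.\<close>

locale complex_algebra = Module.module complex_field A + ring A
  for A :: "(complex, 'a, 'm) module_scheme" (structure) +
  assumes smult_mult_left:
      "x \<in> carrier A \<Longrightarrow> y \<in> carrier A \<Longrightarrow> (c \<odot> x) \<otimes> y = c \<odot> (x \<otimes> y)"
    and smult_mult_right:
      "x \<in> carrier A \<Longrightarrow> y \<in> carrier A \<Longrightarrow> x \<otimes> (c \<odot> y) = c \<odot> (x \<otimes> y)"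

definition linear_maps ::
    "(complex, 'a, 'm) module_scheme \<Rightarrow> (complex, 'b, 'n) module_scheme \<Rightarrow> ('a \<Rightarrow> 'b) set" where
  "linear_maps A B = {f \<in> carrier A \<rightarrow> carrier B.
     (\<forall>x\<in>carrier A. \<forall>y\<in>carrier A. f (x \<oplus>\<^bsub>A\<^esub> y) = f x \<oplus>\<^bsub>B\<^esub> f y) \<and>
     (\<forall>c. \<forall>x\<in>carrier A. f (c \<odot>\<^bsub>A\<^esub> x) = c \<odot>\<^bsub>B\<^esub> f x)}"

definition algebra_homs ::
    "(complex, 'a, 'm) module_scheme \<Rightarrow> (complex, 'b, 'n) module_scheme \<Rightarrow> ('a \<Rightarrow> 'b) set" where
  "algebra_homs A B = ring_hom A B \<inter> linear_maps A B"

definition quotient_algebra ::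
    "(complex, 'a, 'm) module_scheme \<Rightarrow> 'a set \<Rightarrow> (complex, 'a set) module" where
  "quotient_algebra A I =
     ring.extend (A Quot I) (module.fields (\<lambda>c X. \<Union>x\<in>X. I +>\<^bsub>A\<^esub> (c \<odot>\<^bsub>A\<^esub> x)))"

definition opposite_algebra ::
    "(complex, 'a, 'm) module_scheme \<Rightarrow> (complex, 'a, 'm) module_scheme" where
  "opposite_algebra A = A\<lparr>mult := (\<lambda>x y. y \<otimes>\<^bsub>A\<^esub> x)\<rparr>"

abbreviation pm_scale :: "complex \<Rightarrow> ('k \<Rightarrow>\<^sub>0 complex) \<Rightarrow> 'k \<Rightarrow>\<^sub>0 complex" where
  "pm_scale c \<equiv> Poly_Mapping.map ((*) c)"


section \<open>Tensor products\<close>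

text \<open>\<open>A \<otimes> B\<close> is the space of formal linear combinations of pairs modulo the span of the
  bilinearity relations. The formal combinations are multiplied as in the monoid algebra of
  \<open>carrier A \<times> carrier B\<close>, which makes that span an ideal and the quotient the tensor product
  algebra.\<close>

definition formal_tensors ::
    "(complex, 'a, 'm) module_scheme \<Rightarrow> (complex, 'b, 'n) module_scheme
      \<Rightarrow> (complex, ('a \<times> 'b) \<Rightarrow>\<^sub>0 complex) module" where
  "formal_tensors A B =
     \<lparr>carrier = {x. Poly_Mapping.keys x \<subseteq> carrier A \<times> carrier B},
      mult = (\<lambda>x y. \<Sum>(a, b)\<in>Poly_Mapping.keys x. \<Sum>(a', b')\<in>Poly_Mapping.keys y.
        Poly_Mapping.single (a \<otimes>\<^bsub>A\<^esub> a', b \<otimes>\<^bsub>B\<^esub> b')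
          (Poly_Mapping.lookup x (a, b) * Poly_Mapping.lookup y (a', b'))),
      one = Poly_Mapping.single (\<one>\<^bsub>A\<^esub>, \<one>\<^bsub>B\<^esub>) 1,
      zero = 0, add = (+), smult = pm_scale\<rparr>"

definition bilinearity_relations ::
    "(complex, 'a, 'm) module_scheme \<Rightarrow> (complex, 'b, 'n) module_scheme
      \<Rightarrow> (('a \<times> 'b) \<Rightarrow>\<^sub>0 complex) set" where
  "bilinearity_relations A B =
     {Poly_Mapping.single (x \<oplus>\<^bsub>A\<^esub> x', y) 1 - Poly_Mapping.single (x, y) 1
        - Poly_Mapping.single (x', y) 1 | x x' y.
        x \<in> carrier A \<and> x' \<in> carrier A \<and> y \<in> carrier B} \<union>
     {Poly_Mapping.single (x, y \<oplus>\<^bsub>B\<^esub> y') 1 - Poly_Mapping.single (x, y) 1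
        - Poly_Mapping.single (x, y') 1 | x y y'.
        x \<in> carrier A \<and> y \<in> carrier B \<and> y' \<in> carrier B} \<union>
     {Poly_Mapping.single (c \<odot>\<^bsub>A\<^esub> x, y) 1 - Poly_Mapping.single (x, y) c | c x y.
        x \<in> carrier A \<and> y \<in> carrier B} \<union>
     {Poly_Mapping.single (x, c \<odot>\<^bsub>B\<^esub> y) 1 - Poly_Mapping.single (x, y) c | c x y.
        x \<in> carrier A \<and> y \<in> carrier B}"

definition null_tensors ::
    "(complex, 'a, 'm) module_scheme \<Rightarrow> (complex, 'b, 'n) module_scheme
      \<Rightarrow> (('a \<times> 'b) \<Rightarrow>\<^sub>0 complex) set" where
  "null_tensors A B = Modules.module.span pm_scale (bilinearity_relations A B)"

definition tensor ::
    "(complex, 'a, 'm) module_scheme \<Rightarrow> (complex, 'b, 'n) module_scheme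
      \<Rightarrow> (complex, (('a \<times> 'b) \<Rightarrow>\<^sub>0 complex) set) module" where
  "tensor A B = quotient_algebra (formal_tensors A B) (null_tensors A B)"

definition pure_tensor ::
    "(complex, 'a, 'm) module_scheme \<Rightarrow> (complex, 'b, 'n) module_scheme
      \<Rightarrow> 'a \<Rightarrow> 'b \<Rightarrow> (('a \<times> 'b) \<Rightarrow>\<^sub>0 complex) set" where
  "pure_tensor A B x y =
     null_tensors A B +>\<^bsub>formal_tensors A B\<^esub> Poly_Mapping.single (x, y) 1"

text \<open>The linear map \<open>A \<otimes> B \<rightarrow> M\<close> induced by a bilinear map \<open>\<phi>\<close>.\<close>

definition tensor_lift ::
    "(complex, 'c, 'l) module_scheme \<Rightarrow> ('a \<Rightarrow> 'b \<Rightarrow> 'c) \<Rightarrow> (('a \<times> 'b) \<Rightarrow>\<^sub>0 complex) set \<Rightarrow> 'c"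
  where
  "tensor_lift M \<phi> T = the_elem ((\<lambda>t. \<Oplus>\<^bsub>M\<^esub>k\<in>Poly_Mapping.keys t.
     Poly_Mapping.lookup t k \<odot>\<^bsub>M\<^esub> \<phi> (fst k) (snd k)) ` T)"

text \<open>\<open>f \<otimes> g\<close>, with values in \<open>C \<otimes> D\<close>.\<close>

definition tensor_map ::
    "(complex, 'c, 'm) module_scheme \<Rightarrow> (complex, 'd, 'n) module_scheme
      \<Rightarrow> ('a \<Rightarrow> 'c) \<Rightarrow> ('b \<Rightarrow> 'd) \<Rightarrow> (('a \<times> 'b) \<Rightarrow>\<^sub>0 complex) set
      \<Rightarrow> (('c \<times> 'd) \<Rightarrow>\<^sub>0 complex) set" where
  "tensor_map C D f g = tensor_lift (tensor C D) (\<lambda>x y. pure_tensor C D (f x) (g y))"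

definition tensor_flip ::
    "(complex, 'a, 'm) module_scheme \<Rightarrow> (complex, 'b, 'n) module_scheme
      \<Rightarrow> (('a \<times> 'b) \<Rightarrow>\<^sub>0 complex) set \<Rightarrow> (('b \<times> 'a) \<Rightarrow>\<^sub>0 complex) set" where
  "tensor_flip A B = tensor_lift (tensor B A) (\<lambda>x y. pure_tensor B A y x)"

text \<open>The associator \<open>(A \<otimes> B) \<otimes> C \<rightarrow> A \<otimes> (B \<otimes> C)\<close>.\<close>

definition tensor_assoc ::
    "(complex, 'a, 'm) module_scheme \<Rightarrow> (complex, 'b, 'n) module_scheme
      \<Rightarrow> (complex, 'c, 'l) module_scheme
      \<Rightarrow> (((('a \<times> 'b) \<Rightarrow>\<^sub>0 complex) set \<times> 'c) \<Rightarrow>\<^sub>0 complex) set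
      \<Rightarrow> (('a \<times> (('b \<times> 'c) \<Rightarrow>\<^sub>0 complex) set) \<Rightarrow>\<^sub>0 complex) set" where
  "tensor_assoc A B C =
     (let M = tensor A (tensor B C) in
      tensor_lift M (\<lambda>t z. tensor_lift M
        (\<lambda>x y. pure_tensor A (tensor B C) x (pure_tensor B C y z)) t))"


section \<open>Hopf algebras, cocentral morphisms and the Hopf cocenter\<close>

record 'a hopf_data = "(complex, 'a) module" +
  comult :: "'a \<Rightarrow> (('a \<times> 'a) \<Rightarrow>\<^sub>0 complex) set"
  counit :: "'a \<Rightarrow> complex"
  antipode :: "'a \<Rightarrow> 'a"

locale hopf_algebra = complex_algebra A
  for A :: "('a, 'm) hopf_data_scheme" (structure) +
  assumes comult_hom: "comult A \<in> algebra_homs A (tensor A A)"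
    and counit_hom: "counit A \<in> algebra_homs A complex_field"
    and antipode_linear: "antipode A \<in> linear_maps A A"
    and coassociative: "x \<in> carrier A \<Longrightarrow>
      tensor_assoc A A A (tensor_map (tensor A A) A (comult A) id (comult A x)) =
      tensor_map A (tensor A A) id (comult A) (comult A x)"
    and counit_left: "x \<in> carrier A \<Longrightarrow>
      tensor_lift A (\<lambda>y z. counit A y \<odot> z) (comult A x) = x"
    and counit_right: "x \<in> carrier A \<Longrightarrow>
      tensor_lift A (\<lambda>y z. counit A z \<odot> y) (comult A x) = x"
    and antipode_left: "x \<in> carrier A \<Longrightarrow>
      tensor_lift A (\<lambda>y z. antipode A y \<otimes> z) (comult A x) = counit A x \<odot> \<one>"
    and antipode_right: "x \<in> carrier A \<Longrightarrow>
      tensor_lift A (\<lambda>y z. y \<otimes> antipode A z) (comult A x) = counit A x \<odot> \<one>"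

text \<open>Compatibility of a Hopf algebra morphism with the antipodes is automatic.\<close>

definition hopf_morphism ::
    "('a, 'm) hopf_data_scheme \<Rightarrow> ('b, 'n) hopf_data_scheme \<Rightarrow> ('a \<Rightarrow> 'b) \<Rightarrow> bool" where
  "hopf_morphism A B f \<longleftrightarrow>
     hopf_algebra A \<and> hopf_algebra B \<and> f \<in> algebra_homs A B \<and>
     (\<forall>x\<in>carrier A. comult B (f x) = tensor_map B B f f (comult A x)) \<and>
     (\<forall>x\<in>carrier A. counit B (f x) = counit A x)"

definition cocentral_morphism ::
    "('a, 'm) hopf_data_scheme \<Rightarrow> ('b, 'n) hopf_data_scheme \<Rightarrow> ('a \<Rightarrow> 'b) \<Rightarrow> bool" where
  "cocentral_morphism A B f \<longleftrightarrow>
     hopf_morphism A B f \<and>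
     (\<forall>x\<in>carrier A. tensor_map A B id f (comult A x) =
        tensor_map A B id f (tensor_flip A A (comult A x)))"

text \<open>\<open>p : A \<rightarrow> C\<close> is the Hopf cocenter of \<open>A\<close>. The Hopf algebras \<open>B\<close> against which the universal
  property is tested are those with underlying set in the type \<open>'b\<close>; this is to be used with
  \<open>'b\<close> a free type variable.\<close>

definition is_hopf_cocenter ::
    "'b itself \<Rightarrow> ('a, 'm) hopf_data_scheme \<Rightarrow> ('c, 'n) hopf_data_scheme \<Rightarrow> ('a \<Rightarrow> 'c) \<Rightarrow> bool"
  where
  "is_hopf_cocenter (_ :: 'b itself) A C p \<longleftrightarrow>
     cocentral_morphism A C p \<and> p ` carrier A = carrier C \<and>
     (\<forall>(B :: 'b hopf_data) f. cocentral_morphism A B f \<longrightarrow>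
        (\<exists>!g. g \<in> extensional (carrier C) \<and> hopf_morphism C B g \<and>
          (\<forall>x\<in>carrier A. g (p x) = f x)))"

definition trivial_hopf :: "complex hopf_data" where
  "trivial_hopf =
     module.extend complex_field
       (hopf_data.fields (\<lambda>z. pure_tensor complex_field complex_field z 1) id id)"


section \<open>Free algebras\<close>

text \<open>A wrapper around lists, so that the monoid algebra \<open>'x free_word \<Rightarrow>\<^sub>0 complex\<close> carries the
  convolution product of the library; the monoid of words is written additively there.\<close>

datatype 'x free_word = Word (letters: "'x list")

instantiation free_word :: (type) monoid_add
begin

definition zero_free_word :: "'a free_word" where "0 = Word []"

definition plus_free_word :: "'a free_word \<Rightarrow> 'a free_word \<Rightarrow> 'a free_word" where
  "u + v = Word (letters u @ letters v)"

instance
  by standard (simp_all add: zero_free_word_def plus_free_word_def)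

end

type_synonym 'x free_alg = "'x free_word \<Rightarrow>\<^sub>0 complex"

definition gen :: "'x \<Rightarrow> 'x free_alg" where
  "gen x = Poly_Mapping.single (Word [x]) 1"

definition scalar :: "complex \<Rightarrow> 'x free_alg" where
  "scalar c = Poly_Mapping.single 0 c"

definition free_algebra :: "(complex, 'x free_alg) module" where
  "free_algebra = algebra_of_type pm_scale"

definition free_eval ::
    "(complex, 'b, 'n) module_scheme \<Rightarrow> ('x \<Rightarrow> 'b) \<Rightarrow> 'x free_alg \<Rightarrow> 'b" where
  "free_eval B f p = (\<Oplus>\<^bsub>B\<^esub>w\<in>Poly_Mapping.keys p. Poly_Mapping.lookup p w \<odot>\<^bsub>B\<^esub>
     foldr (\<lambda>x y. f x \<otimes>\<^bsub>B\<^esub> y) (letters w) \<one>\<^bsub>B\<^esub>)"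

text \<open>The map induced by \<open>f\<close> on a quotient of the free algebra.\<close>

definition presented_lift ::
    "(complex, 'b, 'n) module_scheme \<Rightarrow> ('x \<Rightarrow> 'b) \<Rightarrow> 'x free_alg set \<Rightarrow> 'b" where
  "presented_lift B f X = the_elem (free_eval B f ` X)"


section \<open>Quantized enveloping algebras\<close>

text \<open>The symmetric Gaussian binomial coefficient is a Laurent polynomial in \<open>q\<close>. It is defined by
  its Pascal recursion, since at a root of unity the quotient of \<open>q\<close>-factorials may be \<open>0/0\<close>.\<close>

fun gauss_binomial :: "complex \<Rightarrow> nat \<Rightarrow> nat \<Rightarrow> complex" where
  "gauss_binomial q n 0 = 1"
| "gauss_binomial q 0 (Suc r) = 0"
| "gauss_binomial q (Suc n) (Suc r) =
     q ^ Suc r * gauss_binomial q n (Suc r) + q powi (int r - int n) * gauss_binomial q n r"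

lemma gauss_binomial_eq_0: "n < r \<Longrightarrow> gauss_binomial q n r = 0"
  by (induction q n r rule: gauss_binomial.induct) auto

definition q_int :: "complex \<Rightarrow> nat \<Rightarrow> complex" where
  "q_int q n = (q ^ n - inverse q ^ n) / (q - inverse q)"

lemma q_int_add:
  assumes "q \<noteq> 0"
  shows "q_int q (m + n) = q ^ m * q_int q n + inverse q ^ n * q_int q m"
  using assms
  by (simp add: q_int_def power_add ring_distribs add_divide_distrib diff_divide_distrib)

lemma gauss_binomial_q_fact:
  assumes "q \<noteq> 0" "r \<le> n"
  shows "gauss_binomial q n r * (\<Prod>k=1..r. q_int q k) * (\<Prod>k=1..n - r. q_int q k) =
    (\<Prod>k=1..n. q_int q k)"
  using assms
proof (induction q n r rule: gauss_binomial.induct)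
  case (3 q n r)
  let ?f = "\<lambda>n. \<Prod>k=1..n. q_int q k"
  have f_Suc: "?f (Suc k) = q_int q (Suc k) * ?f k" for k
    by simp
  have "int r - int n = - int (n - r)"
    using 3 by simp
  then have pw: "q powi (int r - int n) = inverse q ^ (n - r)"
    by (metis power_int_minus power_int_of_nat power_inverse)
  have n2: "gauss_binomial q n r * ?f r * ?f (n - r) = ?f n"
    using 3 by simp
  have n1: "gauss_binomial q n (Suc r) * ?f (Suc r) * ?f (n - r) = q_int q (n - r) * ?f n"
  proof (cases "r = n")
    case True
    then show ?thesis by (simp add: gauss_binomial_eq_0 q_int_def)
  next
    case False
    then have "n - r = Suc (n - Suc r)"
      using 3 by simp
    then have "?f (n - r) = q_int q (n - r) * ?f (n - Suc r)"
      by (metis f_Suc)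
    moreover have "gauss_binomial q n (Suc r) * ?f (Suc r) * ?f (n - Suc r) = ?f n"
      using 3 False by simp
    ultimately show ?thesis by (metis mult.assoc mult.left_commute)
  qed
  have "gauss_binomial q (Suc n) (Suc r) * ?f (Suc r) * ?f (Suc n - Suc r) =
    q ^ Suc r * (gauss_binomial q n (Suc r) * ?f (Suc r) * ?f (n - r)) +
    inverse q ^ (n - r) * (q_int q (Suc r) * (gauss_binomial q n r * ?f r * ?f (n - r)))"
    unfolding gauss_binomial.simps pw f_Suc by (simp add: algebra_simps)
  also have "\<dots> = (q ^ Suc r * q_int q (n - r) + inverse q ^ (n - r) * q_int q (Suc r)) * ?f n"
    unfolding n1 n2 by (simp only: ring_distribs mult.assoc)
  also have "\<dots> = q_int q (Suc n) * ?f n"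
    using q_int_add[of q "Suc r" "n - r"] 3 by simp
  finally show ?case unfolding f_Suc .
qed auto

datatype 'i uq_gen = GE 'i | GF 'i | GK 'i | GKinv 'i

definition uq_relators ::
    "('i \<Rightarrow> 'i \<Rightarrow> int) \<Rightarrow> ('i \<Rightarrow> nat) \<Rightarrow> complex \<Rightarrow> 'i uq_gen free_alg set" where
  "uq_relators a d q =
     (\<Union>i. {gen (GK i) * gen (GKinv i) - 1, gen (GKinv i) * gen (GK i) - 1}) \<union>
     (\<Union>i j. {gen (GK i) * gen (GK j) - gen (GK j) * gen (GK i),
       gen (GK i) * gen (GE j) * gen (GKinv i) - scalar ((q ^ d i) powi a i j) * gen (GE j),
       gen (GK i) * gen (GF j) * gen (GKinv i) - scalar ((q ^ d i) powi (- a i j)) * gen (GF j),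
       gen (GE i) * gen (GF j) - gen (GF j) * gen (GE i) -
         (if i = j then scalar (1 / (q ^ d i - inverse (q ^ d i))) * (gen (GK i) - gen (GKinv i))
          else 0)}) \<union>
     (\<Union>X\<in>{GE, GF}. {\<Sum>r\<le>nat (1 - a i j).
        scalar ((-1) ^ r * gauss_binomial (q ^ d i) (nat (1 - a i j)) r) *
        gen (X i) ^ (nat (1 - a i j) - r) * gen (X j) * gen (X i) ^ r | i j. i \<noteq> j})"

definition uq_ideal ::
    "('i \<Rightarrow> 'i \<Rightarrow> int) \<Rightarrow> ('i \<Rightarrow> nat) \<Rightarrow> complex \<Rightarrow> 'i uq_gen free_alg set" where
  "uq_ideal a d q = Idl\<^bsub>free_algebra\<^esub> (uq_relators a d q)"

definition uq_alg ::
    "('i \<Rightarrow> 'i \<Rightarrow> int) \<Rightarrow> ('i \<Rightarrow> nat) \<Rightarrow> complex \<Rightarrow> (complex, 'i uq_gen free_alg set) module" where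
  "uq_alg a d q = quotient_algebra free_algebra (uq_ideal a d q)"

definition uq_of ::
    "('i \<Rightarrow> 'i \<Rightarrow> int) \<Rightarrow> ('i \<Rightarrow> nat) \<Rightarrow> complex \<Rightarrow> 'i uq_gen free_alg \<Rightarrow> 'i uq_gen free_alg set"
  where
  "uq_of a d q x = uq_ideal a d q +>\<^bsub>free_algebra\<^esub> x"

fun uq_comult_gen ::
    "('i \<Rightarrow> 'i \<Rightarrow> int) \<Rightarrow> ('i \<Rightarrow> nat) \<Rightarrow> complex \<Rightarrow> 'i uq_gen
      \<Rightarrow> (('i uq_gen free_alg set \<times> 'i uq_gen free_alg set) \<Rightarrow>\<^sub>0 complex) set" where
  "uq_comult_gen a d q (GE i) =
     (let U = uq_alg a d q; \<iota> = uq_of a d q in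
      pure_tensor U U (\<iota> (gen (GE i))) (\<iota> (gen (GK i))) \<oplus>\<^bsub>tensor U U\<^esub>
      pure_tensor U U (\<iota> 1) (\<iota> (gen (GE i))))"
| "uq_comult_gen a d q (GF i) =
     (let U = uq_alg a d q; \<iota> = uq_of a d q in
      pure_tensor U U (\<iota> (gen (GF i))) (\<iota> 1) \<oplus>\<^bsub>tensor U U\<^esub>
      pure_tensor U U (\<iota> (gen (GKinv i))) (\<iota> (gen (GF i))))"
| "uq_comult_gen a d q (GK i) =
     (let U = uq_alg a d q; \<iota> = uq_of a d q in
      pure_tensor U U (\<iota> (gen (GK i))) (\<iota> (gen (GK i))))"
| "uq_comult_gen a d q (GKinv i) =
     (let U = uq_alg a d q; \<iota> = uq_of a d q in
      pure_tensor U U (\<iota> (gen (GKinv i))) (\<iota> (gen (GKinv i))))"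

fun uq_counit_gen :: "'i uq_gen \<Rightarrow> complex" where
  "uq_counit_gen (GE i) = 0"
| "uq_counit_gen (GF i) = 0"
| "uq_counit_gen (GK i) = 1"
| "uq_counit_gen (GKinv i) = 1"

fun uq_antipode_gen :: "'i uq_gen \<Rightarrow> 'i uq_gen free_alg" where
  "uq_antipode_gen (GE i) = - (gen (GE i) * gen (GKinv i))"
| "uq_antipode_gen (GF i) = - (gen (GK i) * gen (GF i))"
| "uq_antipode_gen (GK i) = gen (GKinv i)"
| "uq_antipode_gen (GKinv i) = gen (GK i)"

text \<open>The antipode is the anti-homomorphism with the given values on generators, hence the passage
  to the opposite algebra.\<close>

definition uq :: "('i \<Rightarrow> 'i \<Rightarrow> int) \<Rightarrow> ('i \<Rightarrow> nat) \<Rightarrow> complex \<Rightarrow> 'i uq_gen free_alg set hopf_data"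
  where
  "uq a d q = module.extend (uq_alg a d q) (hopf_data.fields
     (presented_lift (tensor (uq_alg a d q) (uq_alg a d q)) (uq_comult_gen a d q))
     (presented_lift complex_field uq_counit_gen)
     (presented_lift (opposite_algebra (uq_alg a d q))
        (\<lambda>x. uq_of a d q (uq_antipode_gen x))))"

end

theory Submission
  imports Defs
begin

text \<open>Cocentrality at \<open>E\<^sub>i\<close> reads
  \<open>E\<^sub>i \<otimes> \<pi>(K\<^sub>i) + 1 \<otimes> \<pi>(E\<^sub>i) = K\<^sub>i \<otimes> \<pi>(E\<^sub>i) + E\<^sub>i \<otimes> 1\<close>. Since \<open>E\<^sub>i\<close> does not lie in the span of \<open>1\<close> and
  \<open>K\<^sub>i\<close>, it follows that \<open>\<pi>(K\<^sub>i) = 1\<close>. Then \<open>\<pi>(E\<^sub>i) = 0 = \<pi>(F\<^sub>i)\<close>, because \<open>E\<^sub>i\<close> and \<open>F\<^sub>i\<close> are eigenvectors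
  for the conjugation by \<open>K\<^sub>i\<close> with eigenvalues \<open>q\<^sub>i\<^sup>2\<close> and \<open>q\<^sub>i\<^sup>-\<^sup>2\<close> different from \<open>1\<close>.

  The independence of \<open>E\<^sub>i\<close> is read off from a submodule of the dual of a Verma module, so that no
  PBW theorem is needed. That \<open>U\<^sub>q\<close> is a Hopf algebra, also at roots of unity, rests on writing the
  quantum Serre element as an iterated q-commutator, for which \<open>x \<otimes> k + 1 \<otimes> x\<close> splits into two
  q-commuting parts.\<close>

text \<open>The presentation makes \<open>uq a d q\<close> only a candidate: that the values of
  \<Delta>, \<epsilon> and S on generators respect the relations and that the Hopf axioms hold is
  part of calling the counit a cocentral morphism, so it has to be proved. The obstacle is that q
  may be a root of unity, where q-factorials vanish. Serre elements are therefore handled as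
  products of commuting factors L - uR, without dividing by q-integers.

  In the dual Verma module E_j reads off the first letter of a word. An operator commuting with all
  E_j is determined by its values at the empty word, which makes the Serre relations for the F_j
  automatic. Those for the E_j are imposed by passing to a subspace, which is F-stable because the
  Serre elements in the E_j commute with every F_k. The indicator function of the word [i] lies in
  it, since Serre elements have degree at least 2, and E_i sends it to a function with value 1 at
  the empty word.

  The Lie algebra enters through a_ii = 2, a_ij \<le> 0 for distinct i, j, and the symmetry of d_i
  a_ij.\<close>

section \<open>Complex algebras\<close>

lemma algebra_of_type_simps [simp]:
  "carrier (algebra_of_type s) = UNIV"
  "x \<otimes>\<^bsub>algebra_of_type s\<^esub> y = x * y"
  "\<one>\<^bsub>algebra_of_type s\<^esub> = 1"
  "\<zero>\<^bsub>algebra_of_type s\<^esub> = 0"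
  "x \<oplus>\<^bsub>algebra_of_type s\<^esub> y = x + y"
  "c \<odot>\<^bsub>algebra_of_type s\<^esub> x = s c x"
  by (simp_all add: algebra_of_type_def)

lemma ring_algebra_of_type: "ring (algebra_of_type s)"
proof -
  have "\<exists>y. y + x = 0" for x :: 'a
    by (rule exI[of _ "- x"]) simp
  then show ?thesis
    by (intro ringI abelian_groupI monoidI) (auto simp: algebra_simps)
qed

lemma cring_complex_field: "cring complex_field"
  by (intro cring.intro ring_algebra_of_type comm_monoid.intro comm_monoid_axioms.intro
      ring.axioms(2)[OF ring_algebra_of_type]) (simp add: mult.commute)

text \<open>The Hopf record of \<open>U_q\<close> extends the record of its underlying algebra, so
  the two have different types. Properties pass between such records by agreement of the
  fields.\<close>

lemma ring_cong:
  assumes "ring R" and eq: "carrier S = carrier R" "mult S = mult R" "one S = one R"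
    "zero S = zero R" "add S = add R"
  shows "ring S"
proof -
  interpret R: ring R by fact
  show ?thesis
  proof (intro ringI abelian_groupI monoidI)
    fix x assume "x \<in> carrier S"
    then show "\<exists>y\<in>carrier S. y \<oplus>\<^bsub>S\<^esub> x = \<zero>\<^bsub>S\<^esub>"
      by (intro bexI[of _ "\<ominus>\<^bsub>R\<^esub> x"]) (auto simp: eq R.l_neg)
  qed (auto simp: eq R.a_ac R.m_assoc R.l_distr R.r_distr)
qed

lemma complex_algebraI:
  fixes A (structure)
  assumes "ring A"
    and "\<And>c x. x \<in> carrier A \<Longrightarrow> c \<odot> x \<in> carrier A"
    and "\<And>c d x. x \<in> carrier A \<Longrightarrow> (c + d) \<odot> x = c \<odot> x \<oplus> d \<odot> x"
    and "\<And>c x y. x \<in> carrier A \<Longrightarrow> y \<in> carrier A \<Longrightarrow> c \<odot> (x \<oplus> y) = c \<odot> x \<oplus> c \<odot> y"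
    and "\<And>c d x. x \<in> carrier A \<Longrightarrow> (c * d) \<odot> x = c \<odot> (d \<odot> x)"
    and "\<And>x. x \<in> carrier A \<Longrightarrow> 1 \<odot> x = x"
    and "\<And>c x y. x \<in> carrier A \<Longrightarrow> y \<in> carrier A \<Longrightarrow> (c \<odot> x) \<otimes> y = c \<odot> (x \<otimes> y)"
    and "\<And>c x y. x \<in> carrier A \<Longrightarrow> y \<in> carrier A \<Longrightarrow> x \<otimes> (c \<odot> y) = c \<odot> (x \<otimes> y)"
  shows "complex_algebra A"
proof -
  interpret ring A by fact
  have "Module.module complex_field A"
    using assms by (intro moduleI cring_complex_field abelian_group_axioms) simp_all
  then show ?thesis
    using assms by (intro complex_algebra.intro complex_algebra_axioms.intro) auto
qed

lemma complex_algebra_complex_field: "complex_algebra complex_field"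
  by (intro complex_algebraI ring_algebra_of_type) (auto simp: algebra_simps)

lemma complex_algebra_cong:
  assumes "complex_algebra A" "carrier B = carrier A" "mult B = mult A" "one B = one A"
    "zero B = zero A" "add B = add A" "smult B = smult A"
  shows "complex_algebra B"
proof -
  interpret complex_algebra A by fact
  show ?thesis
    by (rule complex_algebraI[OF ring_cong[OF ring_axioms]])
      (use assms smult_l_distr smult_r_distr smult_closed smult_assoc1 smult_one smult_mult_left
        smult_mult_right in auto)
qed

context complex_algebra
begin

lemma smul_closed [simp, intro]: "x \<in> carrier A \<Longrightarrow> c \<odot> x \<in> carrier A"
  using smult_closed by simp

lemma smul_add_left: "x \<in> carrier A \<Longrightarrow> (c + d) \<odot> x = c \<odot> x \<oplus> d \<odot> x"
  using smult_l_distr[of c d x] by simp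

lemma smul_add_right:
  "x \<in> carrier A \<Longrightarrow> y \<in> carrier A \<Longrightarrow> c \<odot> (x \<oplus> y) = c \<odot> x \<oplus> c \<odot> y"
  using smult_r_distr by simp

lemma smul_smul [simp]: "x \<in> carrier A \<Longrightarrow> c \<odot> (d \<odot> x) = (c * d) \<odot> x"
  using smult_assoc1[of c d x] by simp

lemma smul_one [simp]: "x \<in> carrier A \<Longrightarrow> 1 \<odot> x = x"
  using smult_one by simp

lemma smul_zero_left [simp]: "x \<in> carrier A \<Longrightarrow> 0 \<odot> x = \<zero>"
  using smult_l_null by simp

lemma smul_zero_right [simp]: "c \<odot> \<zero> = \<zero>"
  using smult_r_null by simp

lemma smul_minus_one: "x \<in> carrier A \<Longrightarrow> (-1) \<odot> x = \<ominus> x"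
proof -
  assume x: "x \<in> carrier A"
  have "(-1) \<odot> x \<oplus> x = (-1 + 1) \<odot> x"
    using x by (subst smul_add_left) auto
  then show ?thesis using x
    by (metis add.inv_equality add.left_inverse smul_closed smul_zero_left)
qed

lemma smul_uminus_left: "x \<in> carrier A \<Longrightarrow> (- c) \<odot> x = \<ominus> (c \<odot> x)"
  using smul_minus_one[of "c \<odot> x"] by simp

lemma smul_uminus_right: "x \<in> carrier A \<Longrightarrow> c \<odot> (\<ominus> x) = \<ominus> (c \<odot> x)"
  using smult_r_minus by simp

lemma smul_diff_right:
  "x \<in> carrier A \<Longrightarrow> y \<in> carrier A \<Longrightarrow> c \<odot> (x \<ominus> y) = c \<odot> x \<ominus> c \<odot> y"
  by (simp add: minus_eq smul_add_right smul_uminus_right)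

lemma smul_one_mult: "x \<in> carrier A \<Longrightarrow> (c \<odot> \<one>) \<otimes> x = c \<odot> x"
  by (simp add: smult_mult_left)

text \<open>Scaling by c is multiplication by c 1, so a ring ideal is automatically a
  subspace.\<close>

lemma ideal_smul_closed:
  assumes "ideal I A" "x \<in> I" shows "c \<odot> x \<in> I"
proof -
  interpret I: ideal I A by fact
  show ?thesis
    using I.I_l_closed[OF \<open>x \<in> I\<close>, of "c \<odot> \<one>"] \<open>x \<in> I\<close> by (simp add: smul_one_mult)
qed

end

lemma linear_mapsI:
  assumes "\<And>x. x \<in> carrier A \<Longrightarrow> f x \<in> carrier B"
    and "\<And>x y. x \<in> carrier A \<Longrightarrow> y \<in> carrier A \<Longrightarrow> f (x \<oplus>\<^bsub>A\<^esub> y) = f x \<oplus>\<^bsub>B\<^esub> f y"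
    and "\<And>c x. x \<in> carrier A \<Longrightarrow> f (c \<odot>\<^bsub>A\<^esub> x) = c \<odot>\<^bsub>B\<^esub> f x"
  shows "f \<in> linear_maps A B"
  using assms by (auto simp: linear_maps_def)

lemma linear_maps_closed: "f \<in> linear_maps A B \<Longrightarrow> x \<in> carrier A \<Longrightarrow> f x \<in> carrier B"
  and linear_maps_add: "f \<in> linear_maps A B \<Longrightarrow> x \<in> carrier A \<Longrightarrow> y \<in> carrier A \<Longrightarrow>
    f (x \<oplus>\<^bsub>A\<^esub> y) = f x \<oplus>\<^bsub>B\<^esub> f y"
  and linear_maps_smult: "f \<in> linear_maps A B \<Longrightarrow> x \<in> carrier A \<Longrightarrow>
    f (c \<odot>\<^bsub>A\<^esub> x) = c \<odot>\<^bsub>B\<^esub> f x"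
  by (auto simp: linear_maps_def)

lemma linear_maps_zero:
  assumes "f \<in> linear_maps A B" "complex_algebra A" "complex_algebra B"
  shows "f \<zero>\<^bsub>A\<^esub> = \<zero>\<^bsub>B\<^esub>"
proof -
  interpret A: complex_algebra A by fact
  interpret B: complex_algebra B by fact
  have "f (0 \<odot>\<^bsub>A\<^esub> \<zero>\<^bsub>A\<^esub>) = 0 \<odot>\<^bsub>B\<^esub> f \<zero>\<^bsub>A\<^esub>"
    by (rule linear_maps_smult[OF assms(1)]) simp
  then show ?thesis using linear_maps_closed[OF assms(1), of "\<zero>\<^bsub>A\<^esub>"] by simp
qed

lemma linear_maps_minus:
  assumes "f \<in> linear_maps A B" "complex_algebra A" "complex_algebra B"
    and x: "x \<in> carrier A" and y: "y \<in> carrier A"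
  shows "f (x \<ominus>\<^bsub>A\<^esub> y) = f x \<ominus>\<^bsub>B\<^esub> f y"
proof -
  interpret A: complex_algebra A by fact
  interpret B: complex_algebra B by fact
  have "f (x \<oplus>\<^bsub>A\<^esub> (-1) \<odot>\<^bsub>A\<^esub> y) = f x \<oplus>\<^bsub>B\<^esub> (-1) \<odot>\<^bsub>B\<^esub> f y"
    using assms by (simp add: linear_maps_add linear_maps_smult)
  then show ?thesis using assms linear_maps_closed[OF assms(1)]
    by (simp add: A.smul_minus_one B.smul_minus_one A.minus_eq B.minus_eq)
qed

lemma linear_maps_comp:
  "f \<in> linear_maps A B \<Longrightarrow> g \<in> linear_maps B C \<Longrightarrow> (\<lambda>x. g (f x)) \<in> linear_maps A C"
  by (auto simp: linear_maps_def Pi_iff)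

lemma algebra_homsI:
  assumes "f \<in> linear_maps A B"
    and "\<And>x y. x \<in> carrier A \<Longrightarrow> y \<in> carrier A \<Longrightarrow> f (x \<otimes>\<^bsub>A\<^esub> y) = f x \<otimes>\<^bsub>B\<^esub> f y"
    and "f \<one>\<^bsub>A\<^esub> = \<one>\<^bsub>B\<^esub>"
  shows "f \<in> algebra_homs A B"
  using assms unfolding algebra_homs_def linear_maps_def ring_hom_def by auto

lemma algebra_homs_linear: "f \<in> algebra_homs A B \<Longrightarrow> f \<in> linear_maps A B"
  and algebra_homs_closed: "f \<in> algebra_homs A B \<Longrightarrow> x \<in> carrier A \<Longrightarrow> f x \<in> carrier B"
  and algebra_homs_mult: "f \<in> algebra_homs A B \<Longrightarrow> x \<in> carrier A \<Longrightarrow> y \<in> carrier A \<Longrightarrow>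
    f (x \<otimes>\<^bsub>A\<^esub> y) = f x \<otimes>\<^bsub>B\<^esub> f y"
  and algebra_homs_one: "f \<in> algebra_homs A B \<Longrightarrow> f \<one>\<^bsub>A\<^esub> = \<one>\<^bsub>B\<^esub>"
  and algebra_homs_add: "f \<in> algebra_homs A B \<Longrightarrow> x \<in> carrier A \<Longrightarrow> y \<in> carrier A \<Longrightarrow>
    f (x \<oplus>\<^bsub>A\<^esub> y) = f x \<oplus>\<^bsub>B\<^esub> f y"
  and algebra_homs_smult: "f \<in> algebra_homs A B \<Longrightarrow> x \<in> carrier A \<Longrightarrow>
    f (c \<odot>\<^bsub>A\<^esub> x) = c \<odot>\<^bsub>B\<^esub> f x"
  by (auto simp: algebra_homs_def linear_maps_def ring_hom_def)

lemmas algebra_homs_simps =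
  algebra_homs_closed algebra_homs_mult algebra_homs_add algebra_homs_smult algebra_homs_one

lemma algebra_homs_comp:
  "f \<in> algebra_homs A B \<Longrightarrow> g \<in> algebra_homs B C \<Longrightarrow> (\<lambda>x. g (f x)) \<in> algebra_homs A C"
  by (auto simp: algebra_homs_def linear_maps_def ring_hom_def Pi_iff)

lemma algebra_homs_id: "(\<lambda>x. x) \<in> algebra_homs A A"
  by (auto simp: algebra_homs_def linear_maps_def ring_hom_def)

lemma algebra_homs_eqI_scalars:
  assumes "f \<in> algebra_homs complex_field B"
  shows "f c = c \<odot>\<^bsub>B\<^esub> \<one>\<^bsub>B\<^esub>"
  using algebra_homs_smult[OF assms, of 1 c] algebra_homs_one[OF assms] by simp

context complex_algebra
begin

lemma scalar_algebra_hom: "(\<lambda>c. c \<odot> \<one>) \<in> algebra_homs complex_field A"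
  by (intro algebra_homsI linear_mapsI) (auto simp: smul_add_left smult_mult_left)

end

lemma (in abelian_group) right_minus_eq:
  "x \<in> carrier G \<Longrightarrow> y \<in> carrier G \<Longrightarrow> x \<ominus> y = \<zero> \<longleftrightarrow> x = y"
proof
  assume x: "x \<in> carrier G" and y: "y \<in> carrier G" and "x \<ominus> y = \<zero>"
  then have "x \<oplus> \<ominus> y = \<zero>" by (simp add: minus_eq)
  then have "x \<oplus> \<ominus> y \<oplus> y = y" using y by simp
  then show "x = y" using x y by (simp add: a_assoc l_neg)
qed (simp add: minus_eq r_neg)

section \<open>Quotient algebras\<close>

lemma quotient_algebra_sel:
  "carrier (quotient_algebra A I) = a_rcosets\<^bsub>A\<^esub> I"
  "mult (quotient_algebra A I) = rcoset_mult A I"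
  "\<one>\<^bsub>quotient_algebra A I\<^esub> = I +>\<^bsub>A\<^esub> \<one>\<^bsub>A\<^esub>"
  "\<zero>\<^bsub>quotient_algebra A I\<^esub> = I"
  "add (quotient_algebra A I) = set_add A"
  "c \<odot>\<^bsub>quotient_algebra A I\<^esub> X = (\<Union>x\<in>X. I +>\<^bsub>A\<^esub> (c \<odot>\<^bsub>A\<^esub> x))"
  by (simp_all add: quotient_algebra_def FactRing_def ring.defs module.defs)

lemma (in complex_algebra)
  assumes "ideal I A"
  shows quotient_carrier: "carrier (quotient_algebra A I) = (+>) I ` carrier A"
    and quotient_mult: "x \<in> carrier A \<Longrightarrow> y \<in> carrier A \<Longrightarrow>
      (I +> x) \<otimes>\<^bsub>quotient_algebra A I\<^esub> (I +> y) = I +> x \<otimes> y"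
    and quotient_add: "x \<in> carrier A \<Longrightarrow> y \<in> carrier A \<Longrightarrow>
      (I +> x) \<oplus>\<^bsub>quotient_algebra A I\<^esub> (I +> y) = I +> (x \<oplus> y)"
    and quotient_smult: "x \<in> carrier A \<Longrightarrow>
      c \<odot>\<^bsub>quotient_algebra A I\<^esub> (I +> x) = I +> (c \<odot> x)"
    and quotient_ring: "ring (quotient_algebra A I)"
    and coset_eq_iff: "x \<in> carrier A \<Longrightarrow> y \<in> carrier A \<Longrightarrow> I +> x = I +> y \<longleftrightarrow> x \<ominus> y \<in> I"
proof -
  interpret I: ideal I A by fact
  show eq: "I +> x = I +> y \<longleftrightarrow> x \<ominus> y \<in> I" if "x \<in> carrier A" "y \<in> carrier A" for x y
    using quotient_eq_iff_same_a_r_cos[OF assms that] by auto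
  show "carrier (quotient_algebra A I) = (+>) I ` carrier A"
    by (auto simp: quotient_algebra_sel A_RCOSETS_def' a_r_coset_def')
  show "(I +> x) \<otimes>\<^bsub>quotient_algebra A I\<^esub> (I +> y) = I +> x \<otimes> y"
    if "x \<in> carrier A" "y \<in> carrier A" for x y
    by (simp add: quotient_algebra_sel I.rcoset_mult_add that)
  show "(I +> x) \<oplus>\<^bsub>quotient_algebra A I\<^esub> (I +> y) = I +> (x \<oplus> y)"
    if "x \<in> carrier A" "y \<in> carrier A" for x y
    by (simp add: quotient_algebra_sel I.a_rcos_sum that)
  show "c \<odot>\<^bsub>quotient_algebra A I\<^esub> (I +> x) = I +> (c \<odot> x)" if x: "x \<in> carrier A"
  proof -
    \<comment> \<open>Scalar multiplication on the quotient is a union over all representatives. It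
      is a single coset because each representative contributes the same one.\<close>
    have "I +> (c \<odot> y) = I +> (c \<odot> x)" if "y \<in> I +> x" for y
    proof -
      have y: "y \<in> carrier A" using that x by (rule I.a_elemrcos_carrier[rotated])
      have "y \<ominus> x \<in> I" using that x y I.a_rcos_module_minus[OF ring_axioms] by blast
      then have "c \<odot> (y \<ominus> x) \<in> I" using assms by (intro ideal_smul_closed) auto
      then show ?thesis using x y by (simp add: eq smul_diff_right)
    qed
    moreover have "x \<in> I +> x" using x by (rule I.a_rcos_self)
    ultimately show ?thesis unfolding quotient_algebra_sel by blast
  qed
  show "ring (quotient_algebra A I)"
    by (rule ring_cong[OF I.quotient_is_ring]) (simp_all add: quotient_algebra_sel FactRing_def)
qed

lemma (in complex_algebra) quotient_complex_algebra:
  assumes "ideal I A" shows "complex_algebra (quotient_algebra A I)"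
proof (rule complex_algebraI[OF quotient_ring[OF assms]], unfold quotient_carrier[OF assms])
qed (auto simp: quotient_mult[OF assms] quotient_add[OF assms] quotient_smult[OF assms]
    smul_add_left smul_add_right smult_mult_left smult_mult_right)

lemma (in complex_algebra) coset_algebra_hom:
  assumes "ideal I A" shows "(+>) I \<in> algebra_homs A (quotient_algebra A I)"
  by (intro algebra_homsI linear_mapsI)
    (auto simp: quotient_carrier[OF assms] quotient_mult[OF assms] quotient_add[OF assms]
      quotient_smult[OF assms] quotient_algebra_sel(3))

text \<open>Lifts to quotients are defined with \<open>the_elem\<close> of the image of a coset,
  which is meaningful only because this image is a singleton.\<close>

lemma (in complex_algebra) coset_image_eq:
  assumes "ideal I A" and f: "f \<in> linear_maps A M" and M: "complex_algebra M"
    and ker: "\<And>x. x \<in> I \<Longrightarrow> f x = \<zero>\<^bsub>M\<^esub>" and x: "x \<in> carrier A"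
  shows "f ` (I +> x) = {f x}"
proof -
  interpret I: ideal I A by fact
  interpret M: complex_algebra M by fact
  have "f y = f x" if y: "y \<in> I +> x" for y
  proof -
    have "y \<in> carrier A" using y x by (rule I.a_elemrcos_carrier[rotated])
    moreover have "f (y \<ominus> x) = \<zero>\<^bsub>M\<^esub>"
      using ker y x \<open>y \<in> carrier A\<close> I.a_rcos_module_minus[OF ring_axioms] by blast
    ultimately show ?thesis
      using x linear_maps_closed[OF f] linear_maps_minus[OF f complex_algebra_axioms M, of y x]
      by (simp add: M.right_minus_eq)
  qed
  then show ?thesis using I.a_rcos_self[OF x] by blast
qed

lemma (in complex_algebra) quotient_lift_linear:
  assumes I: "ideal I A" and f: "f \<in> linear_maps A M" and M: "complex_algebra M"
    and ker: "\<And>x. x \<in> I \<Longrightarrow> f x = \<zero>\<^bsub>M\<^esub>"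
  shows "(\<lambda>X. the_elem (f ` X)) \<in> linear_maps (quotient_algebra A I) M"
proof -
  have [simp]: "the_elem (f ` (I +> x)) = f x" if "x \<in> carrier A" for x
    using coset_image_eq[OF I f M ker that] by simp
  show ?thesis
    by (rule linear_mapsI) (auto simp: quotient_carrier[OF I] quotient_add[OF I]
      quotient_smult[OF I] linear_maps_closed[OF f] linear_maps_add[OF f] linear_maps_smult[OF f])
qed

lemma (in complex_algebra) quotient_lift_hom:
  assumes I: "ideal I A" and f: "f \<in> algebra_homs A M" and M: "complex_algebra M"
    and ker: "\<And>x. x \<in> I \<Longrightarrow> f x = \<zero>\<^bsub>M\<^esub>"
  shows "(\<lambda>X. the_elem (f ` X)) \<in> algebra_homs (quotient_algebra A I) M"
proof -
  have [simp]: "the_elem (f ` (I +> x)) = f x" if "x \<in> carrier A" for x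
    using coset_image_eq[OF I algebra_homs_linear[OF f] M ker that] by simp
  show ?thesis
    by (intro algebra_homsI quotient_lift_linear[OF I algebra_homs_linear[OF f] M ker])
      (auto simp: quotient_carrier[OF I] quotient_mult[OF I] quotient_algebra_sel(3)
        algebra_homs_mult[OF f] algebra_homs_one[OF f])
qed

section \<open>Formal linear combinations\<close>

lemma lookup_pm_scale [simp]: "Poly_Mapping.lookup (pm_scale c x) k = c * Poly_Mapping.lookup x k"
  by (simp add: Poly_Mapping.map.rep_eq when_def)

lemma pm_scale_single [simp]: "pm_scale c (Poly_Mapping.single k b) = Poly_Mapping.single k (c * b)"
  by (rule poly_mapping_eqI) (simp add: lookup_single when_def)

lemma pm_scale_add_right: "pm_scale c (x + y) = pm_scale c x + pm_scale c y"
  by (rule poly_mapping_eqI) (simp add: lookup_add algebra_simps)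

lemma pm_scale_add_left: "pm_scale (c + d) x = pm_scale c x + pm_scale d x"
  by (rule poly_mapping_eqI) (simp add: lookup_add algebra_simps)

lemma pm_scale_mult [simp]: "pm_scale c (pm_scale d x) = pm_scale (c * d) x"
  by (rule poly_mapping_eqI) simp

lemma pm_scale_one [simp]: "pm_scale 1 x = x"
  by (rule poly_mapping_eqI) simp

lemma pm_scale_zero [simp]: "pm_scale c 0 = 0" "pm_scale 0 x = 0"
  by (rule poly_mapping_eqI, simp)+

lemma pm_scale_minus_one: "pm_scale (-1) x = - x"
  by (rule poly_mapping_eqI) simp

lemma pm_scale_sum: "pm_scale c (\<Sum>i\<in>I. f i) = (\<Sum>i\<in>I. pm_scale c (f i))"
  by (induction I rule: infinite_finite_induct) (simp_all add: pm_scale_add_right)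

lemma keys_pm_scale: "Poly_Mapping.keys (pm_scale c x) \<subseteq> Poly_Mapping.keys x"
  by (auto simp: in_keys_iff)

lemma sum_single_lookup:
  "(\<Sum>k\<in>Poly_Mapping.keys t. Poly_Mapping.single k (Poly_Mapping.lookup t k)) = t"
  by (rule poly_mapping_eqI) (auto simp: lookup_sum lookup_single when_def in_keys_iff)

text \<open>The bound on the supports of both summands is carried into the \<open>add\<close> case,
  because closure facts for operations on a carrier are needed there.\<close>

lemma formal_sum_induct [consumes 1, case_names zero single add]:
  fixes t :: "'k \<Rightarrow>\<^sub>0 complex"
  assumes "Poly_Mapping.keys t \<subseteq> S"
    and "P 0"
    and single: "\<And>k c. k \<in> S \<Longrightarrow> P (Poly_Mapping.single k c)"
    and add: "\<And>s t. Poly_Mapping.keys s \<subseteq> S \<Longrightarrow> Poly_Mapping.keys t \<subseteq> S \<Longrightarrow> P s \<Longrightarrow> P t \<Longrightarrow> P (s + t)"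
  shows "P t"
proof -
  let ?s = "\<lambda>F. \<Sum>k\<in>F. Poly_Mapping.single k (Poly_Mapping.lookup t k)"
  have "Poly_Mapping.keys (?s F) \<subseteq> S \<and> P (?s F)" if "finite F" "F \<subseteq> S" for F
    using that
  proof (induction F)
    case (insert k F)
    then have keys: "Poly_Mapping.keys (Poly_Mapping.single k (Poly_Mapping.lookup t k)) \<subseteq> S"
      by auto
    have "P (Poly_Mapping.single k (Poly_Mapping.lookup t k) + ?s F)"
      using insert keys by (intro add single) auto
    then show ?case
      using insert keys keys_add[of "Poly_Mapping.single k (Poly_Mapping.lookup t k)" "?s F"]
      by simp blast
  qed (use assms in auto)
  from this[of "Poly_Mapping.keys t"] assms(1) show ?thesis
    by (simp add: sum_single_lookup)
qed

text \<open>The linear extension of \<phi> from a basis. With words as basis it is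
  \<open>free_eval\<close>, with pairs it is the map behind \<open>tensor_lift\<close>.\<close>

definition formal_eval ::
    "(complex, 'b, 'n) module_scheme \<Rightarrow> ('k \<Rightarrow> 'b) \<Rightarrow> ('k \<Rightarrow>\<^sub>0 complex) \<Rightarrow> 'b" where
  "formal_eval M \<phi> t =
     (\<Oplus>\<^bsub>M\<^esub>k\<in>Poly_Mapping.keys t. Poly_Mapping.lookup t k \<odot>\<^bsub>M\<^esub> \<phi> k)"

context complex_algebra
begin

text \<open>Supports of sums may shrink by cancellation. Over a fixed finite superset the
  evaluations of s, t and s + t have a common index set.\<close>

lemma formal_eval_superset:
  assumes "finite K" "Poly_Mapping.keys t \<subseteq> K" "\<phi> \<in> K \<rightarrow> carrier A"
  shows "formal_eval A \<phi> t = (\<Oplus>k\<in>K. Poly_Mapping.lookup t k \<odot> \<phi> k)"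
  unfolding formal_eval_def using assms
  by (intro add.finprod_mono_neutral_cong_left) (auto simp: in_keys_iff Pi_iff)

lemma formal_eval_closed:
  assumes "Poly_Mapping.keys t \<subseteq> S" "\<phi> \<in> S \<rightarrow> carrier A"
  shows "formal_eval A \<phi> t \<in> carrier A"
  unfolding formal_eval_def using assms by (intro finsum_closed) auto

lemma formal_eval_zero [simp]: "formal_eval A \<phi> 0 = \<zero>"
  by (simp add: formal_eval_def)

lemma formal_eval_single [simp]:
  assumes "\<phi> k \<in> carrier A"
  shows "formal_eval A \<phi> (Poly_Mapping.single k c) = c \<odot> \<phi> k"
  using formal_eval_superset[of "{k}" "Poly_Mapping.single k c" \<phi>] assms by simp

lemma formal_eval_add:
  assumes "Poly_Mapping.keys s \<subseteq> S" "Poly_Mapping.keys t \<subseteq> S" "\<phi> \<in> S \<rightarrow> carrier A"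
  shows "formal_eval A \<phi> (s + t) = formal_eval A \<phi> s \<oplus> formal_eval A \<phi> t"
proof -
  let ?K = "Poly_Mapping.keys s \<union> Poly_Mapping.keys t"
  have \<phi>: "\<phi> \<in> ?K \<rightarrow> carrier A" using assms by auto
  then have "formal_eval A \<phi> s \<oplus> formal_eval A \<phi> t =
    (\<Oplus>k\<in>?K. Poly_Mapping.lookup s k \<odot> \<phi> k \<oplus> Poly_Mapping.lookup t k \<odot> \<phi> k)"
    by (subst (1 2) formal_eval_superset[of ?K]) (auto simp: Pi_iff intro!: finsum_addf[symmetric])
  also have "\<dots> = (\<Oplus>k\<in>?K. Poly_Mapping.lookup (s + t) k \<odot> \<phi> k)"
    using \<phi> by (intro finsum_cong') (auto simp: lookup_add smul_add_left Pi_iff)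
  also have "\<dots> = formal_eval A \<phi> (s + t)"
    using \<phi> keys_add[of s t] by (intro formal_eval_superset[symmetric]) auto
  finally show ?thesis by simp
qed

lemma formal_eval_scale:
  assumes "Poly_Mapping.keys t \<subseteq> S" "\<phi> \<in> S \<rightarrow> carrier A"
  shows "formal_eval A \<phi> (pm_scale c t) = c \<odot> formal_eval A \<phi> t"
  using assms(1)
proof (induction t rule: formal_sum_induct)
  case (single k d)
  then show ?case using assms(2) by (auto simp: Pi_iff)
next
  case (add s t)
  have "Poly_Mapping.keys (pm_scale c x) \<subseteq> S" if "Poly_Mapping.keys x \<subseteq> S" for x
    using that keys_pm_scale[of c x] by blast
  with add show ?case
    using assms(2)
    by (simp add: pm_scale_add_right formal_eval_add[of _ S] smul_add_right formal_eval_closed[of _ S])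
qed simp

end

section \<open>Free and presented algebras\<close>

lemma scalar_mult: "scalar c * p = pm_scale c p"
  by (simp add: scalar_def mult_map_scale_conv_mult)

lemma mult_scalar: "p * scalar c = pm_scale c p"
proof -
  have "Poly_Mapping.keys p \<subseteq> UNIV" by simp
  then show ?thesis
  proof (induction p rule: formal_sum_induct)
    case (single k b)
    show ?case by (simp add: scalar_def mult_single mult.commute)
  qed (simp_all add: scalar_def distrib_right pm_scale_add_right)
qed

lemma carrier_free_algebra [simp]: "carrier free_algebra = UNIV"
  by (simp add: free_algebra_def)

lemma complex_algebra_free_algebra: "complex_algebra free_algebra"
  unfolding free_algebra_def
proof (rule complex_algebraI[OF ring_algebra_of_type], unfold algebra_of_type_simps)
  fix c and x y :: "'a free_alg"
  show "pm_scale c x * y = pm_scale c (x * y)"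
    by (simp add: scalar_mult[symmetric] mult.assoc)
  show "x * pm_scale c y = pm_scale c (x * y)"
    by (simp add: mult_scalar[symmetric] mult.assoc)
qed (auto simp: pm_scale_add_left pm_scale_add_right)

definition word_eval :: "(complex, 'b, 'n) module_scheme \<Rightarrow> ('x \<Rightarrow> 'b) \<Rightarrow> 'x free_word \<Rightarrow> 'b" where
  "word_eval B f w = foldr (\<lambda>x y. f x \<otimes>\<^bsub>B\<^esub> y) (letters w) \<one>\<^bsub>B\<^esub>"

lemma free_eval_eq: "free_eval B f = formal_eval B (word_eval B f)"
  by (simp add: fun_eq_iff free_eval_def formal_eval_def word_eval_def)

context complex_algebra
begin

lemma foldr_closed:
  "range f \<subseteq> carrier A \<Longrightarrow> foldr (\<lambda>x y. f x \<otimes> y) xs \<one> \<in> carrier A"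
  by (induction xs) auto

lemma word_eval_closed: "range f \<subseteq> carrier A \<Longrightarrow> word_eval A f w \<in> carrier A"
  unfolding word_eval_def by (rule foldr_closed)

lemma word_eval_zero: "word_eval A f 0 = \<one>"
  by (simp add: word_eval_def zero_free_word_def)

lemma word_eval_add:
  assumes f: "range f \<subseteq> carrier A"
  shows "word_eval A f (u + v) = word_eval A f u \<otimes> word_eval A f v"
proof -
  have "foldr (\<lambda>x y. f x \<otimes> y) (xs @ ys) \<one> =
      foldr (\<lambda>x y. f x \<otimes> y) xs \<one> \<otimes> foldr (\<lambda>x y. f x \<otimes> y) ys \<one>" for xs ys
  proof (induction xs)
    case (Cons x xs)
    have "f x \<in> carrier A" using f by auto
    with Cons show ?case using foldr_closed[OF f] by (simp add: m_assoc del: foldr_append)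
  qed (use foldr_closed[OF f] in auto)
  then show ?thesis by (simp add: word_eval_def plus_free_word_def del: foldr_append)
qed

lemma free_eval_hom:
  assumes f: "range f \<subseteq> carrier A"
  shows "free_eval A f \<in> algebra_homs free_algebra A"
proof -
  let ?e = "formal_eval A (word_eval A f)"
  note closed = word_eval_closed[OF f]
  have cl: "?e p \<in> carrier A" for p
    using closed by (intro formal_eval_closed[of _ UNIV]) auto
  have add: "?e (p + r) = ?e p \<oplus> ?e r" for p r
    using closed by (intro formal_eval_add[of _ UNIV]) auto
  have scale: "?e (pm_scale c p) = c \<odot> ?e p" for c p
    using closed by (intro formal_eval_scale[of _ UNIV]) auto
  have mult_single: "?e (Poly_Mapping.single u c * r) = ?e (Poly_Mapping.single u c) \<otimes> ?e r"
    for u c r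
  proof -
    have "Poly_Mapping.keys r \<subseteq> UNIV" by simp
    then show ?thesis
    proof (induction r rule: formal_sum_induct)
      case (single v d)
      show ?case using closed
        by (simp add: mult_single word_eval_add[OF f] smult_mult_left smult_mult_right mult.commute)
    qed (simp_all add: distrib_left add r_distr cl closed)
  qed
  have mult: "?e (p * r) = ?e p \<otimes> ?e r" for p r
  proof -
    have "Poly_Mapping.keys p \<subseteq> UNIV" by simp
    then show ?thesis
      by (induction p rule: formal_sum_induct)
        (simp_all add: distrib_right add l_distr cl mult_single)
  qed
  have "?e 1 = \<one>"
    using formal_eval_single[of "word_eval A f" 0 1] closed
    by (simp add: word_eval_zero)
  then show ?thesis
    unfolding free_eval_eq free_algebra_def
    by (intro algebra_homsI linear_mapsI) (simp_all add: cl add scale mult)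
qed

lemma free_eval_gen:
  assumes f: "range f \<subseteq> carrier A" shows "free_eval A f (gen x) = f x"
proof -
  have "f x \<in> carrier A" using f by auto
  then show ?thesis
    using word_eval_closed[OF f, of "Word [x]"]
    by (simp add: free_eval_eq gen_def word_eval_def)
qed

end

lemma free_algebra_homs_eqI:
  assumes f: "f \<in> algebra_homs free_algebra B" and g: "g \<in> algebra_homs free_algebra B"
    and eq: "\<And>x. f (gen x) = g (gen x)" and B: "complex_algebra B"
  shows "f p = g p"
proof -
  have word: "f (Poly_Mapping.single (Word xs) 1) = g (Poly_Mapping.single (Word xs) 1)" for xs
  proof (induction xs)
    case Nil
    have "Poly_Mapping.single (Word []) 1 = (1 :: 'a free_alg)"
      by (simp flip: zero_free_word_def)
    then show ?case
      using algebra_homs_one[OF f] algebra_homs_one[OF g] by (simp add: free_algebra_def)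
  next
    case (Cons x xs)
    have "Poly_Mapping.single (Word (x # xs)) 1 = gen x * Poly_Mapping.single (Word xs) (1 :: complex)"
      by (simp add: gen_def mult_single plus_free_word_def)
    then show ?case
      using Cons eq algebra_homs_mult[OF f, of "gen x"] algebra_homs_mult[OF g, of "gen x"]
      by (simp add: free_algebra_def)
  qed
  have "Poly_Mapping.keys p \<subseteq> UNIV" by simp
  then show ?thesis
  proof (induction p rule: formal_sum_induct)
    case zero
    show ?case
      using linear_maps_zero[OF algebra_homs_linear[OF f] complex_algebra_free_algebra B]
        linear_maps_zero[OF algebra_homs_linear[OF g] complex_algebra_free_algebra B]
      by (simp add: free_algebra_def)
  next
    case (single w c)
    have "Poly_Mapping.single w c = pm_scale c (Poly_Mapping.single (Word (letters w)) 1)"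
      by simp
    then show ?case
      using word[of "letters w"]
        algebra_homs_smult[OF f, of "Poly_Mapping.single (Word (letters w)) 1" c]
        algebra_homs_smult[OF g, of "Poly_Mapping.single (Word (letters w)) 1" c]
      by (simp add: free_algebra_def del: pm_scale_single)
  next
    case (add s t)
    then show ?case
      using algebra_homs_add[OF f, of s t] algebra_homs_add[OF g, of s t]
      by (simp add: free_algebra_def)
  qed
qed

definition presented :: "'x free_alg set \<Rightarrow> (complex, 'x free_alg set) module" where
  "presented R = quotient_algebra free_algebra (Idl\<^bsub>free_algebra\<^esub> R)"

definition presented_of :: "'x free_alg set \<Rightarrow> 'x free_alg \<Rightarrow> 'x free_alg set" where
  "presented_of R x = Idl\<^bsub>free_algebra\<^esub> R +>\<^bsub>free_algebra\<^esub> x"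

lemma ideal_Idl_free: "ideal (Idl\<^bsub>free_algebra\<^esub> R) free_algebra"
proof -
  interpret complex_algebra "free_algebra :: (complex, 'a free_alg) module"
    by (rule complex_algebra_free_algebra)
  show ?thesis by (rule genideal_ideal) (simp add: free_algebra_def)
qed

lemma complex_algebra_presented: "complex_algebra (presented R)"
  unfolding presented_def
  by (rule complex_algebra.quotient_complex_algebra[OF complex_algebra_free_algebra ideal_Idl_free])

lemma presented_of_hom: "presented_of R \<in> algebra_homs free_algebra (presented R)"
  unfolding presented_def presented_of_def[abs_def]
  by (rule complex_algebra.coset_algebra_hom[OF complex_algebra_free_algebra ideal_Idl_free])

lemma presented_carrier: "carrier (presented R) = range (presented_of R)"
  unfolding presented_def presented_of_def[abs_def]
  by (subst complex_algebra.quotient_carrier[OF complex_algebra_free_algebra ideal_Idl_free])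
    (simp add: free_algebra_def)

lemma presented_of_closed [simp]: "presented_of R x \<in> carrier (presented R)"
  by (simp add: presented_carrier)

text \<open>Translates between the type class operations of the free algebra and the record
  operations of the target.\<close>

lemma free_hom_simps:
  assumes h: "h \<in> algebra_homs free_algebra B" and B: "complex_algebra B"
  shows "h x \<in> carrier B"
    and "h (x + y) = h x \<oplus>\<^bsub>B\<^esub> h y"
    and "h (x * y) = h x \<otimes>\<^bsub>B\<^esub> h y"
    and "h (pm_scale c x) = c \<odot>\<^bsub>B\<^esub> h x"
    and "h 1 = \<one>\<^bsub>B\<^esub>"
    and "h 0 = \<zero>\<^bsub>B\<^esub>"
    and "h (- x) = \<ominus>\<^bsub>B\<^esub> h x"
    and "h (x - y) = h x \<ominus>\<^bsub>B\<^esub> h y"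
proof -
  interpret complex_algebra B by fact
  show cl: "h x \<in> carrier B" for x
    using algebra_homs_closed[OF h, of x] by simp
  show add: "h (x + y) = h x \<oplus>\<^bsub>B\<^esub> h y" for x y
    using algebra_homs_add[OF h, of x y] by (simp add: free_algebra_def)
  show "h (x * y) = h x \<otimes>\<^bsub>B\<^esub> h y"
    using algebra_homs_mult[OF h, of x y] by (simp add: free_algebra_def)
  show scale: "h (pm_scale c x) = c \<odot>\<^bsub>B\<^esub> h x" for x c
    using algebra_homs_smult[OF h, of x c] by (simp add: free_algebra_def)
  show "h 1 = \<one>\<^bsub>B\<^esub>"
    using algebra_homs_one[OF h] by (simp add: free_algebra_def)
  show "h 0 = \<zero>\<^bsub>B\<^esub>"
    using scale[of 0 0] cl by simp
  show minus: "h (- x) = \<ominus>\<^bsub>B\<^esub> h x" for x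
    using scale[of "-1" x] cl by (simp add: pm_scale_minus_one smul_minus_one)
  show "h (x - y) = h x \<ominus>\<^bsub>B\<^esub> h y"
    using add[of x "- y"] minus[of y] by (simp add: minus_eq)
qed

lemmas presented_of_simps = free_hom_simps[OF presented_of_hom complex_algebra_presented]

lemma presented_of_eq_zero: "x \<in> R \<Longrightarrow> presented_of R x = \<zero>\<^bsub>presented R\<^esub>"
proof -
  interpret complex_algebra "free_algebra :: (complex, 'a free_alg) module"
    by (rule complex_algebra_free_algebra)
  assume "x \<in> R"
  then have x: "x \<in> Idl\<^bsub>free_algebra\<^esub> R"
    using genideal_self[of R] by (auto simp: free_algebra_def)
  have "x \<ominus>\<^bsub>free_algebra\<^esub> \<zero>\<^bsub>free_algebra\<^esub> = x"
    by (simp add: minus_eq)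
  then have "presented_of R x = presented_of R \<zero>\<^bsub>free_algebra\<^esub>"
    unfolding presented_of_def using x
    by (subst coset_eq_iff[OF ideal_Idl_free]) simp_all
  then show ?thesis by (simp add: free_algebra_def presented_of_simps)
qed

text \<open>The kernel is an ideal that contains the relators, and the generated ideal is the
  smallest such.\<close>

lemma algebra_hom_eq_zero_on_ideal:
  assumes f: "f \<in> algebra_homs free_algebra B" and B: "complex_algebra B"
    and ker: "\<And>x. x \<in> R \<Longrightarrow> f x = \<zero>\<^bsub>B\<^esub>" and x: "x \<in> Idl\<^bsub>free_algebra\<^esub> R"
  shows "f x = \<zero>\<^bsub>B\<^esub>"
proof -
  interpret F: complex_algebra "free_algebra :: (complex, 'a free_alg) module"
    by (rule complex_algebra_free_algebra)
  interpret B: complex_algebra B by fact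
  interpret ring_hom_ring free_algebra B f
    by (rule ring_hom_ringI2[OF F.ring_axioms B.ring_axioms]) (use f in \<open>simp add: algebra_homs_def\<close>)
  have "R \<subseteq> a_kernel free_algebra B f"
    using ker unfolding a_kernel_def' by simp blast
  then have "Idl\<^bsub>free_algebra\<^esub> R \<subseteq> a_kernel free_algebra B f"
    by (rule F.genideal_minimal[OF kernel_is_ideal])
  with x show ?thesis unfolding a_kernel_def' by blast
qed

lemma presented_lift_of:
  assumes f: "range f \<subseteq> carrier B" and B: "complex_algebra B"
    and ker: "\<And>x. x \<in> R \<Longrightarrow> free_eval B f x = \<zero>\<^bsub>B\<^esub>"
  shows "presented_lift B f (presented_of R p) = free_eval B f p"
proof -
  note h = complex_algebra.free_eval_hom[OF B f]
  show ?thesis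
    unfolding presented_lift_def presented_of_def
    by (subst complex_algebra.coset_image_eq[OF complex_algebra_free_algebra ideal_Idl_free
          algebra_homs_linear[OF h] B])
      (simp_all add: algebra_hom_eq_zero_on_ideal[OF h B ker])
qed

lemma presented_lift_hom:
  assumes f: "range f \<subseteq> carrier B" and B: "complex_algebra B"
    and ker: "\<And>x. x \<in> R \<Longrightarrow> free_eval B f x = \<zero>\<^bsub>B\<^esub>"
  shows "presented_lift B f \<in> algebra_homs (presented R) B"
proof -
  note h = complex_algebra.free_eval_hom[OF B f]
  show ?thesis
    unfolding presented_lift_def[abs_def] presented_def
    by (rule complex_algebra.quotient_lift_hom[OF complex_algebra_free_algebra ideal_Idl_free h B])
      (rule algebra_hom_eq_zero_on_ideal[OF h B ker])
qed

lemma presented_homs_eqI: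
  assumes f: "f \<in> algebra_homs (presented R) B" and g: "g \<in> algebra_homs (presented R) B"
    and eq: "\<And>x. f (presented_of R (gen x)) = g (presented_of R (gen x))"
    and B: "complex_algebra B" and X: "X \<in> carrier (presented R)"
  shows "f X = g X"
proof -
  obtain p where "X = presented_of R p" using X by (auto simp: presented_carrier)
  then show ?thesis
    using free_algebra_homs_eqI[OF algebra_homs_comp[OF presented_of_hom f]
        algebra_homs_comp[OF presented_of_hom g] eq B] by simp
qed

section \<open>Tensor products of algebras\<close>

abbreviation (input) pair_mult where
  "pair_mult A B k l \<equiv> (fst k \<otimes>\<^bsub>A\<^esub> fst l, snd k \<otimes>\<^bsub>B\<^esub> snd l)"

lemma formal_tensors_sel [simp]:
  "carrier (formal_tensors A B) = {x. Poly_Mapping.keys x \<subseteq> carrier A \<times> carrier B}"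
  "\<one>\<^bsub>formal_tensors A B\<^esub> = Poly_Mapping.single (\<one>\<^bsub>A\<^esub>, \<one>\<^bsub>B\<^esub>) 1"
  "\<zero>\<^bsub>formal_tensors A B\<^esub> = 0"
  "x \<oplus>\<^bsub>formal_tensors A B\<^esub> y = x + y"
  "c \<odot>\<^bsub>formal_tensors A B\<^esub> x = pm_scale c x"
  by (simp_all add: formal_tensors_def)

text \<open>As in \<open>formal_eval_superset\<close>, fixed index sets make both sides of the
  distributive laws sums over the same pairs, whatever cancels.\<close>

lemma formal_mult_superset:
  assumes "finite K" "Poly_Mapping.keys x \<subseteq> K" "finite L" "Poly_Mapping.keys y \<subseteq> L"
  shows "x \<otimes>\<^bsub>formal_tensors A B\<^esub> y = (\<Sum>k\<in>K. \<Sum>l\<in>L.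
    Poly_Mapping.single (pair_mult A B k l) (Poly_Mapping.lookup x k * Poly_Mapping.lookup y l))"
proof -
  have "x \<otimes>\<^bsub>formal_tensors A B\<^esub> y = (\<Sum>k\<in>Poly_Mapping.keys x. \<Sum>l\<in>Poly_Mapping.keys y.
    Poly_Mapping.single (pair_mult A B k l) (Poly_Mapping.lookup x k * Poly_Mapping.lookup y l))"
    by (simp add: formal_tensors_def case_prod_unfold)
  also have "\<dots> = (\<Sum>k\<in>K. \<Sum>l\<in>Poly_Mapping.keys y.
    Poly_Mapping.single (pair_mult A B k l) (Poly_Mapping.lookup x k * Poly_Mapping.lookup y l))"
    using assms by (intro sum.mono_neutral_left) (auto simp: in_keys_iff)
  also have "\<dots> = (\<Sum>k\<in>K. \<Sum>l\<in>L.
    Poly_Mapping.single (pair_mult A B k l) (Poly_Mapping.lookup x k * Poly_Mapping.lookup y l))"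
    using assms by (intro sum.cong sum.mono_neutral_left refl) (auto simp: in_keys_iff)
  finally show ?thesis .
qed

lemma formal_mult_add_left:
  "(x + x') \<otimes>\<^bsub>formal_tensors A B\<^esub> y =
    x \<otimes>\<^bsub>formal_tensors A B\<^esub> y + x' \<otimes>\<^bsub>formal_tensors A B\<^esub> y"
  using keys_add[of x x']
  by (subst (1 2 3) formal_mult_superset[where K = "Poly_Mapping.keys x \<union> Poly_Mapping.keys x'"
        and L = "Poly_Mapping.keys y"])
    (auto simp: lookup_add distrib_right single_add sum.distrib)

lemma formal_mult_add_right:
  "x \<otimes>\<^bsub>formal_tensors A B\<^esub> (y + y') =
    x \<otimes>\<^bsub>formal_tensors A B\<^esub> y + x \<otimes>\<^bsub>formal_tensors A B\<^esub> y'"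
  using keys_add[of y y']
  by (subst (1 2 3) formal_mult_superset[where K = "Poly_Mapping.keys x"
        and L = "Poly_Mapping.keys y \<union> Poly_Mapping.keys y'"])
    (auto simp: lookup_add distrib_left single_add sum.distrib)

lemma formal_mult_scale_left:
  "pm_scale c x \<otimes>\<^bsub>formal_tensors A B\<^esub> y = pm_scale c (x \<otimes>\<^bsub>formal_tensors A B\<^esub> y)"
  using keys_pm_scale[of c x]
  by (subst (1 2) formal_mult_superset[where K = "Poly_Mapping.keys x" and L = "Poly_Mapping.keys y"])
    (auto simp: pm_scale_sum mult.assoc)

lemma formal_mult_scale_right:
  "x \<otimes>\<^bsub>formal_tensors A B\<^esub> pm_scale c y = pm_scale c (x \<otimes>\<^bsub>formal_tensors A B\<^esub> y)"
  using keys_pm_scale[of c y]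
  by (subst (1 2) formal_mult_superset[where K = "Poly_Mapping.keys x" and L = "Poly_Mapping.keys y"])
    (auto simp: pm_scale_sum mult.left_commute)

lemma formal_mult_zero [simp]:
  "0 \<otimes>\<^bsub>formal_tensors A B\<^esub> y = 0" "x \<otimes>\<^bsub>formal_tensors A B\<^esub> 0 = 0"
  by (simp_all add: formal_tensors_def)

lemma formal_mult_single [simp]:
  "Poly_Mapping.single k c \<otimes>\<^bsub>formal_tensors A B\<^esub> Poly_Mapping.single l d =
    Poly_Mapping.single (pair_mult A B k l) (c * d)"
  by (subst formal_mult_superset[where K = "{k}" and L = "{l}"]) auto

lemma formal_mult_diff:
  "(x - x') \<otimes>\<^bsub>formal_tensors A B\<^esub> y =
    x \<otimes>\<^bsub>formal_tensors A B\<^esub> y - x' \<otimes>\<^bsub>formal_tensors A B\<^esub> y"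
  "y \<otimes>\<^bsub>formal_tensors A B\<^esub> (x - x') =
    y \<otimes>\<^bsub>formal_tensors A B\<^esub> x - y \<otimes>\<^bsub>formal_tensors A B\<^esub> x'"
  using formal_mult_add_left[of A B "x - x'" x' y] formal_mult_add_right[of A B y "x - x'" x']
  by (simp_all add: algebra_simps)

locale algebra_pair = A: complex_algebra A + B: complex_algebra B
  for A :: "(complex, 'a, 'm) module_scheme" and B :: "(complex, 'b, 'n) module_scheme"
begin

abbreviation "FT \<equiv> formal_tensors A B"
abbreviation "NT \<equiv> null_tensors A B"

lemma formal_mult_closed:
  assumes "Poly_Mapping.keys x \<subseteq> carrier A \<times> carrier B" "Poly_Mapping.keys y \<subseteq> carrier A \<times> carrier B"
  shows "Poly_Mapping.keys (x \<otimes>\<^bsub>FT\<^esub> y) \<subseteq> carrier A \<times> carrier B"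
  using assms(1)
proof (induction x rule: formal_sum_induct)
  case (single k c)
  show ?case using assms(2)
  proof (induction y rule: formal_sum_induct)
    case (add s t)
    then show ?case using keys_add by (fastforce simp: formal_mult_add_right)
  qed (use single in auto)
next
  case (add s t)
  then show ?case using keys_add by (fastforce simp: formal_mult_add_left)
qed auto

lemma ring_formal_tensors: "ring FT"
proof (intro ringI abelian_groupI monoidI)
  fix x assume "x \<in> carrier FT"
  then show "\<exists>y\<in>carrier FT. y \<oplus>\<^bsub>FT\<^esub> x = \<zero>\<^bsub>FT\<^esub>"
    by (intro bexI[of _ "- x"]) auto
next
  fix x y z assume x: "x \<in> carrier FT" and y: "y \<in> carrier FT" and z: "z \<in> carrier FT"
  have 1: "Poly_Mapping.single k c \<otimes>\<^bsub>FT\<^esub> Poly_Mapping.single l d \<otimes>\<^bsub>FT\<^esub> z =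
      Poly_Mapping.single k c \<otimes>\<^bsub>FT\<^esub> (Poly_Mapping.single l d \<otimes>\<^bsub>FT\<^esub> z)"
    if kl: "k \<in> carrier A \<times> carrier B" "l \<in> carrier A \<times> carrier B" for k l c d
  proof -
    have "Poly_Mapping.keys z \<subseteq> carrier A \<times> carrier B" using z by simp
    then show ?thesis
    proof (induction z rule: formal_sum_induct)
      case (single m e)
      then show ?case using kl by (auto simp: A.m_assoc B.m_assoc mult.assoc)
    qed (simp_all add: formal_mult_add_left formal_mult_add_right)
  qed
  have 2: "Poly_Mapping.single k c \<otimes>\<^bsub>FT\<^esub> y \<otimes>\<^bsub>FT\<^esub> z = Poly_Mapping.single k c \<otimes>\<^bsub>FT\<^esub> (y \<otimes>\<^bsub>FT\<^esub> z)"
    if k: "k \<in> carrier A \<times> carrier B" for k c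
  proof -
    have "Poly_Mapping.keys y \<subseteq> carrier A \<times> carrier B" using y by simp
    then show ?thesis
      by (induction y rule: formal_sum_induct)
        (simp_all add: 1[OF k] formal_mult_add_left formal_mult_add_right del: formal_mult_single)
  qed
  have "Poly_Mapping.keys x \<subseteq> carrier A \<times> carrier B" using x by simp
  then show "x \<otimes>\<^bsub>FT\<^esub> y \<otimes>\<^bsub>FT\<^esub> z = x \<otimes>\<^bsub>FT\<^esub> (y \<otimes>\<^bsub>FT\<^esub> z)"
    by (induction x rule: formal_sum_induct)
      (simp_all add: 2 formal_mult_add_left formal_mult_add_right del: formal_mult_single)
next
  fix x assume "x \<in> carrier FT"
  then have x: "Poly_Mapping.keys x \<subseteq> carrier A \<times> carrier B" by simp
  show "\<one>\<^bsub>FT\<^esub> \<otimes>\<^bsub>FT\<^esub> x = x"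
    using x by (induction x rule: formal_sum_induct) (auto simp: formal_mult_add_right)
  show "x \<otimes>\<^bsub>FT\<^esub> \<one>\<^bsub>FT\<^esub> = x"
    using x by (induction x rule: formal_sum_induct) (auto simp: formal_mult_add_left)
next
  fix x y assume "x \<in> carrier FT" "y \<in> carrier FT"
  then show "x \<oplus>\<^bsub>FT\<^esub> y \<in> carrier FT"
    using keys_add[of x y] by auto
  show "x \<otimes>\<^bsub>FT\<^esub> y \<in> carrier FT"
    using \<open>x \<in> carrier FT\<close> \<open>y \<in> carrier FT\<close> formal_mult_closed[of x y] by simp
qed (auto simp: formal_mult_add_left formal_mult_add_right algebra_simps)

lemma complex_algebra_formal_tensors: "complex_algebra FT"
proof (rule complex_algebraI[OF ring_formal_tensors])
  fix c x assume "x \<in> carrier FT"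
  then show "c \<odot>\<^bsub>FT\<^esub> x \<in> carrier FT"
    using keys_pm_scale[of c x] by auto
qed (auto simp: pm_scale_add_left pm_scale_add_right formal_mult_scale_left formal_mult_scale_right)

sublocale FT: complex_algebra FT
  by (rule complex_algebra_formal_tensors)

lemma pm_scale_module: "Modules.module (pm_scale :: complex \<Rightarrow> ('k \<Rightarrow>\<^sub>0 complex) \<Rightarrow> _)"
  by unfold_locales (auto simp: pm_scale_add_left pm_scale_add_right)

interpretation pm: Modules.module "pm_scale :: complex \<Rightarrow> (('a \<times> 'b) \<Rightarrow>\<^sub>0 complex) \<Rightarrow> _"
  by (rule pm_scale_module)

lemma null_tensors_scale: "x \<in> NT \<Longrightarrow> pm_scale c x \<in> NT"
  and null_tensors_add: "x \<in> NT \<Longrightarrow> y \<in> NT \<Longrightarrow> x + y \<in> NT"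
  and null_tensors_zero: "0 \<in> NT"
  and null_tensors_base: "x \<in> bilinearity_relations A B \<Longrightarrow> x \<in> NT"
  by (simp_all add: null_tensors_def pm.span_scale pm.span_add pm.span_zero pm.span_base)

lemma null_tensors_induct [consumes 1, case_names base zero add scale]:
  assumes "x \<in> NT" "\<And>r. r \<in> bilinearity_relations A B \<Longrightarrow> P r" "P 0"
    "\<And>x y. P x \<Longrightarrow> P y \<Longrightarrow> P (x + y)" "\<And>c x. P x \<Longrightarrow> P (pm_scale c x)"
  shows "P x"
  using assms(1) unfolding null_tensors_def
  by (induction rule: pm.span_induct) (auto simp: pm.subspace_def intro: assms(2-))

lemma bilinearity_relationsE:
  assumes "r \<in> bilinearity_relations A B"
  obtains (add_left) x x' y where "x \<in> carrier A" "x' \<in> carrier A" "y \<in> carrier B"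
      "r = Poly_Mapping.single (x \<oplus>\<^bsub>A\<^esub> x', y) 1 - Poly_Mapping.single (x, y) 1
        - Poly_Mapping.single (x', y) 1"
    | (add_right) x y y' where "x \<in> carrier A" "y \<in> carrier B" "y' \<in> carrier B"
      "r = Poly_Mapping.single (x, y \<oplus>\<^bsub>B\<^esub> y') 1 - Poly_Mapping.single (x, y) 1
        - Poly_Mapping.single (x, y') 1"
    | (scale_left) c x y where "x \<in> carrier A" "y \<in> carrier B"
      "r = Poly_Mapping.single (c \<odot>\<^bsub>A\<^esub> x, y) 1 - Poly_Mapping.single (x, y) c"
    | (scale_right) c x y where "x \<in> carrier A" "y \<in> carrier B"
      "r = Poly_Mapping.single (x, c \<odot>\<^bsub>B\<^esub> y) 1 - Poly_Mapping.single (x, y) c"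
  using assms unfolding bilinearity_relations_def by (elim UnE CollectE exE conjE)

lemma bilinearity_relationsI:
  "x \<in> carrier A \<Longrightarrow> x' \<in> carrier A \<Longrightarrow> y \<in> carrier B \<Longrightarrow>
    Poly_Mapping.single (x \<oplus>\<^bsub>A\<^esub> x', y) 1 - Poly_Mapping.single (x, y) 1
      - Poly_Mapping.single (x', y) 1 \<in> bilinearity_relations A B"
  "x \<in> carrier A \<Longrightarrow> y \<in> carrier B \<Longrightarrow> y' \<in> carrier B \<Longrightarrow>
    Poly_Mapping.single (x, y \<oplus>\<^bsub>B\<^esub> y') 1 - Poly_Mapping.single (x, y) 1
      - Poly_Mapping.single (x, y') 1 \<in> bilinearity_relations A B"
  "x \<in> carrier A \<Longrightarrow> y \<in> carrier B \<Longrightarrow>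
    Poly_Mapping.single (c \<odot>\<^bsub>A\<^esub> x, y) 1 - Poly_Mapping.single (x, y) c \<in> bilinearity_relations A B"
  "x \<in> carrier A \<Longrightarrow> y \<in> carrier B \<Longrightarrow>
    Poly_Mapping.single (x, c \<odot>\<^bsub>B\<^esub> y) 1 - Poly_Mapping.single (x, y) c \<in> bilinearity_relations A B"
  unfolding bilinearity_relations_def
  subgoal by (rule UnI1, rule UnI1, rule UnI1, intro CollectI exI conjI, rule refl)
  subgoal by (rule UnI1, rule UnI1, rule UnI2, intro CollectI exI conjI, rule refl)
  subgoal by (rule UnI1, rule UnI2, intro CollectI exI conjI, rule refl)
  subgoal by (rule UnI2, intro CollectI exI conjI, rule refl)
  done

lemma null_tensors_closed: "x \<in> NT \<Longrightarrow> x \<in> carrier FT"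
proof (induction rule: null_tensors_induct)
  case (base r)
  have s: "Poly_Mapping.single (x, y) c \<in> carrier FT"
    if "x \<in> carrier A" "y \<in> carrier B" for x y and c :: complex
    using that by (simp split: if_splits)
  have d: "x - y \<in> carrier FT" if "x \<in> carrier FT" "y \<in> carrier FT" for x y
    using that keys_add[of x "- y"] by auto
  from base show ?case
    by (cases rule: bilinearity_relationsE) (use s d in simp_all)
next
  case (add x y)
  then show ?case using FT.a_closed[of x y] by simp
next
  case (scale c x)
  then show ?case using FT.smul_closed[of x c] by simp
qed simp

text \<open>Multiplying by a basis pair turns a bilinearity relation into another one of the same
  kind, with the entries multiplied. This is the reason why the span of these relations is an
  ideal.\<close>

lemma single_mult_relation:
  assumes k: "k \<in> carrier A \<times> carrier B" and r: "r \<in> bilinearity_relations A B"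
  shows "Poly_Mapping.single k c \<otimes>\<^bsub>FT\<^esub> r \<in> NT" "r \<otimes>\<^bsub>FT\<^esub> Poly_Mapping.single k c \<in> NT"
proof -
  obtain u v where [simp]: "k = (u, v)" by (cases k)
  have [simp]: "u \<in> carrier A" "v \<in> carrier B" using k by simp_all
  have 1: "Poly_Mapping.single (u, v) 1 \<otimes>\<^bsub>FT\<^esub> r \<in> bilinearity_relations A B"
    using r
  proof (cases rule: bilinearity_relationsE)
    case (add_left x x' y)
    then show ?thesis
      using bilinearity_relationsI(1)[of "u \<otimes>\<^bsub>A\<^esub> x" "u \<otimes>\<^bsub>A\<^esub> x'" "v \<otimes>\<^bsub>B\<^esub> y"]
      by (simp add: formal_mult_diff A.r_distr)
  next
    case (add_right x y y')
    then show ?thesis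
      using bilinearity_relationsI(2)[of "u \<otimes>\<^bsub>A\<^esub> x" "v \<otimes>\<^bsub>B\<^esub> y" "v \<otimes>\<^bsub>B\<^esub> y'"]
      by (simp add: formal_mult_diff B.r_distr)
  next
    case (scale_left c x y)
    then show ?thesis
      using bilinearity_relationsI(3)[of "u \<otimes>\<^bsub>A\<^esub> x" "v \<otimes>\<^bsub>B\<^esub> y"]
      by (simp add: formal_mult_diff A.smult_mult_right)
  next
    case (scale_right c x y)
    then show ?thesis
      using bilinearity_relationsI(4)[of "u \<otimes>\<^bsub>A\<^esub> x" "v \<otimes>\<^bsub>B\<^esub> y"]
      by (simp add: formal_mult_diff B.smult_mult_right)
  qed
  have 2: "r \<otimes>\<^bsub>FT\<^esub> Poly_Mapping.single (u, v) 1 \<in> bilinearity_relations A B"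
    using r
  proof (cases rule: bilinearity_relationsE)
    case (add_left x x' y)
    then show ?thesis
      using bilinearity_relationsI(1)[of "x \<otimes>\<^bsub>A\<^esub> u" "x' \<otimes>\<^bsub>A\<^esub> u" "y \<otimes>\<^bsub>B\<^esub> v"]
      by (simp add: formal_mult_diff A.l_distr)
  next
    case (add_right x y y')
    then show ?thesis
      using bilinearity_relationsI(2)[of "x \<otimes>\<^bsub>A\<^esub> u" "y \<otimes>\<^bsub>B\<^esub> v" "y' \<otimes>\<^bsub>B\<^esub> v"]
      by (simp add: formal_mult_diff B.l_distr)
  next
    case (scale_left c x y)
    then show ?thesis
      using bilinearity_relationsI(3)[of "x \<otimes>\<^bsub>A\<^esub> u" "y \<otimes>\<^bsub>B\<^esub> v"]
      by (simp add: formal_mult_diff A.smult_mult_left)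
  next
    case (scale_right c x y)
    then show ?thesis
      using bilinearity_relationsI(4)[of "x \<otimes>\<^bsub>A\<^esub> u" "y \<otimes>\<^bsub>B\<^esub> v"]
      by (simp add: formal_mult_diff B.smult_mult_left)
  qed
  show "Poly_Mapping.single k c \<otimes>\<^bsub>FT\<^esub> r \<in> NT"
    using null_tensors_scale[OF null_tensors_base[OF 1], of c]
    by (simp add: formal_mult_scale_left[symmetric])
  show "r \<otimes>\<^bsub>FT\<^esub> Poly_Mapping.single k c \<in> NT"
    using null_tensors_scale[OF null_tensors_base[OF 2], of c]
    by (simp add: formal_mult_scale_right[symmetric])
qed

lemma ideal_null_tensors: "ideal NT FT"
proof (rule idealI[OF ring_formal_tensors])
  show "subgroup NT (add_monoid FT)"
  proof (rule subgroup.intro)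
    fix x assume x: "x \<in> NT"
    have "\<ominus>\<^bsub>FT\<^esub> x = pm_scale (-1) x"
      using FT.smul_minus_one[OF null_tensors_closed[OF x]] by simp
    then show "inv\<^bsub>add_monoid FT\<^esub> x \<in> NT"
      using null_tensors_scale[OF x, of "-1"] by (simp add: a_inv_def)
  next
    show "NT \<subseteq> carrier (add_monoid FT)"
      using null_tensors_closed by auto
  qed (auto simp: null_tensors_add null_tensors_zero)
next
  fix r z assume r: "r \<in> NT" and z: "z \<in> carrier FT"
  have single: "Poly_Mapping.single k c \<otimes>\<^bsub>FT\<^esub> r \<in> NT \<and> r \<otimes>\<^bsub>FT\<^esub> Poly_Mapping.single k c \<in> NT"
    if "k \<in> carrier A \<times> carrier B" for k c
    using r
    by (induction rule: null_tensors_induct)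
      (simp_all add: single_mult_relation[OF that] null_tensors_zero formal_mult_add_left
        formal_mult_add_right null_tensors_add formal_mult_scale_left formal_mult_scale_right
        null_tensors_scale)
  have "Poly_Mapping.keys z \<subseteq> carrier A \<times> carrier B" using z by simp
  then have "z \<otimes>\<^bsub>FT\<^esub> r \<in> NT \<and> r \<otimes>\<^bsub>FT\<^esub> z \<in> NT"
    by (induction rule: formal_sum_induct)
      (simp_all add: single null_tensors_zero formal_mult_add_left formal_mult_add_right null_tensors_add)
  then show "z \<otimes>\<^bsub>FT\<^esub> r \<in> NT" "r \<otimes>\<^bsub>FT\<^esub> z \<in> NT" by auto
qed

lemma complex_algebra_tensor: "complex_algebra (tensor A B)"
  unfolding tensor_def by (rule FT.quotient_complex_algebra[OF ideal_null_tensors])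

sublocale T: complex_algebra "tensor A B"
  by (rule complex_algebra_tensor)

lemma single_closed: "x \<in> carrier A \<Longrightarrow> y \<in> carrier B \<Longrightarrow>
  Poly_Mapping.single (x, y) (c :: complex) \<in> carrier FT"
  by (simp split: if_splits)

lemma tensor_coset_hom: "(\<lambda>t. NT +>\<^bsub>FT\<^esub> t) \<in> algebra_homs FT (tensor A B)"
  unfolding tensor_def by (rule FT.coset_algebra_hom[OF ideal_null_tensors])

lemma pure_tensor_closed [simp, intro]:
  "x \<in> carrier A \<Longrightarrow> y \<in> carrier B \<Longrightarrow> pure_tensor A B x y \<in> carrier (tensor A B)"
  unfolding pure_tensor_def
  by (intro algebra_homs_closed[OF tensor_coset_hom] single_closed)

lemma pure_tensor_mult:
  "x \<in> carrier A \<Longrightarrow> y \<in> carrier B \<Longrightarrow> x' \<in> carrier A \<Longrightarrow> y' \<in> carrier B \<Longrightarrow>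
    pure_tensor A B x y \<otimes>\<^bsub>tensor A B\<^esub> pure_tensor A B x' y' =
    pure_tensor A B (x \<otimes>\<^bsub>A\<^esub> x') (y \<otimes>\<^bsub>B\<^esub> y')"
  unfolding pure_tensor_def
  by (subst algebra_homs_mult[OF tensor_coset_hom, symmetric])
    (simp_all add: single_closed del: formal_tensors_sel(1))

lemma pure_tensor_one: "pure_tensor A B \<one>\<^bsub>A\<^esub> \<one>\<^bsub>B\<^esub> = \<one>\<^bsub>tensor A B\<^esub>"
  using algebra_homs_one[OF tensor_coset_hom] by (simp add: pure_tensor_def)

lemma coset_single_scale:
  assumes "x \<in> carrier A" "y \<in> carrier B"
  shows "NT +>\<^bsub>FT\<^esub> Poly_Mapping.single (x, y) c = c \<odot>\<^bsub>tensor A B\<^esub> pure_tensor A B x y"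
proof -
  have "NT +>\<^bsub>FT\<^esub> (c \<odot>\<^bsub>FT\<^esub> Poly_Mapping.single (x, y) 1) = c \<odot>\<^bsub>tensor A B\<^esub> pure_tensor A B x y"
    unfolding pure_tensor_def
    using assms by (intro algebra_homs_smult[OF tensor_coset_hom] single_closed)
  then show ?thesis by simp
qed

lemma coset_diff:
  assumes "s \<in> carrier FT" "t \<in> carrier FT"
  shows "NT +>\<^bsub>FT\<^esub> s = NT +>\<^bsub>FT\<^esub> t \<longleftrightarrow> s - t \<in> NT"
proof -
  have "s \<ominus>\<^bsub>FT\<^esub> t = s - t"
    using FT.smul_minus_one[OF assms(2)] by (simp add: FT.minus_eq pm_scale_minus_one)
  then show ?thesis
    using FT.coset_eq_iff[OF ideal_null_tensors assms] by simp
qed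

lemma pure_tensor_add_left:
  assumes "x \<in> carrier A" "x' \<in> carrier A" "y \<in> carrier B"
  shows "pure_tensor A B (x \<oplus>\<^bsub>A\<^esub> x') y = pure_tensor A B x y \<oplus>\<^bsub>tensor A B\<^esub> pure_tensor A B x' y"
proof -
  have "pure_tensor A B x y \<oplus>\<^bsub>tensor A B\<^esub> pure_tensor A B x' y =
      NT +>\<^bsub>FT\<^esub> (Poly_Mapping.single (x, y) 1 \<oplus>\<^bsub>FT\<^esub> Poly_Mapping.single (x', y) 1)"
    unfolding pure_tensor_def
    using assms by (intro algebra_homs_add[OF tensor_coset_hom, symmetric] single_closed)
  also have "\<dots> = pure_tensor A B (x \<oplus>\<^bsub>A\<^esub> x') y"
    unfolding pure_tensor_def
    using assms null_tensors_base[OF bilinearity_relationsI(1)[OF assms]]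
      FT.a_closed[OF single_closed[of x y 1] single_closed[of x' y 1]]
    by (subst eq_commute, subst coset_diff) (simp_all add: algebra_simps)
  finally show ?thesis ..
qed

lemma pure_tensor_add_right:
  assumes "x \<in> carrier A" "y \<in> carrier B" "y' \<in> carrier B"
  shows "pure_tensor A B x (y \<oplus>\<^bsub>B\<^esub> y') = pure_tensor A B x y \<oplus>\<^bsub>tensor A B\<^esub> pure_tensor A B x y'"
proof -
  have "pure_tensor A B x y \<oplus>\<^bsub>tensor A B\<^esub> pure_tensor A B x y' =
      NT +>\<^bsub>FT\<^esub> (Poly_Mapping.single (x, y) 1 \<oplus>\<^bsub>FT\<^esub> Poly_Mapping.single (x, y') 1)"
    unfolding pure_tensor_def
    using assms by (intro algebra_homs_add[OF tensor_coset_hom, symmetric] single_closed)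
  also have "\<dots> = pure_tensor A B x (y \<oplus>\<^bsub>B\<^esub> y')"
    unfolding pure_tensor_def
    using assms null_tensors_base[OF bilinearity_relationsI(2)[OF assms]]
      FT.a_closed[OF single_closed[of x y 1] single_closed[of x y' 1]]
    by (subst eq_commute, subst coset_diff) (simp_all add: algebra_simps)
  finally show ?thesis ..
qed

lemma pure_tensor_smult_left:
  assumes "x \<in> carrier A" "y \<in> carrier B"
  shows "pure_tensor A B (c \<odot>\<^bsub>A\<^esub> x) y = c \<odot>\<^bsub>tensor A B\<^esub> pure_tensor A B x y"
proof -
  have "pure_tensor A B (c \<odot>\<^bsub>A\<^esub> x) y = NT +>\<^bsub>FT\<^esub> Poly_Mapping.single (x, y) c"
    unfolding pure_tensor_def
    using assms null_tensors_base[OF bilinearity_relationsI(3)[OF assms]]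
    by (subst coset_diff) (simp_all add: single_closed)
  then show ?thesis using coset_single_scale[OF assms] by simp
qed

lemma pure_tensor_smult_right:
  assumes "x \<in> carrier A" "y \<in> carrier B"
  shows "pure_tensor A B x (c \<odot>\<^bsub>B\<^esub> y) = c \<odot>\<^bsub>tensor A B\<^esub> pure_tensor A B x y"
proof -
  have "pure_tensor A B x (c \<odot>\<^bsub>B\<^esub> y) = NT +>\<^bsub>FT\<^esub> Poly_Mapping.single (x, y) c"
    unfolding pure_tensor_def
    using assms null_tensors_base[OF bilinearity_relationsI(4)[OF assms]]
    by (subst coset_diff) (simp_all add: single_closed)
  then show ?thesis using coset_single_scale[OF assms] by simp
qed

text \<open>There is no case for scalars, since a coefficient is absorbed into the left entry of a
  pure tensor.\<close>

lemma tensor_induct [consumes 1, case_names pure add]: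
  assumes T: "T \<in> carrier (tensor A B)"
    and pure: "\<And>x y. x \<in> carrier A \<Longrightarrow> y \<in> carrier B \<Longrightarrow> P (pure_tensor A B x y)"
    and add: "\<And>S T. S \<in> carrier (tensor A B) \<Longrightarrow> T \<in> carrier (tensor A B) \<Longrightarrow> P S \<Longrightarrow> P T \<Longrightarrow>
      P (S \<oplus>\<^bsub>tensor A B\<^esub> T)"
  shows "P T"
proof -
  obtain t where t: "t \<in> carrier FT" and T: "T = NT +>\<^bsub>FT\<^esub> t"
    using T by (auto simp: tensor_def FT.quotient_carrier[OF ideal_null_tensors])
  have single: "P (NT +>\<^bsub>FT\<^esub> Poly_Mapping.single k c)" if k: "k \<in> carrier A \<times> carrier B" for k c
  proof -
    obtain x y where [simp]: "k = (x, y)" by (cases k)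
    have "x \<in> carrier A" "y \<in> carrier B" using k by simp_all
    then show ?thesis
      using pure[of "c \<odot>\<^bsub>A\<^esub> x" y] by (simp add: coset_single_scale pure_tensor_smult_left)
  qed
  have "Poly_Mapping.keys t \<subseteq> carrier A \<times> carrier B" using t by simp
  then have "P (NT +>\<^bsub>FT\<^esub> t)"
  proof (induction t rule: formal_sum_induct)
    case zero
    then show ?case using single[of "(\<one>\<^bsub>A\<^esub>, \<one>\<^bsub>B\<^esub>)" 0] by simp
  next
    case (add s t)
    then have cl: "s \<in> carrier FT" "t \<in> carrier FT" by auto
    then show ?case
      using assms(3)[OF algebra_homs_closed[OF tensor_coset_hom cl(1)]
          algebra_homs_closed[OF tensor_coset_hom cl(2)]] add
        algebra_homs_add[OF tensor_coset_hom cl]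
      by (simp del: formal_tensors_sel(1))
  qed (simp add: single)
  then show ?thesis by (simp add: T)
qed

end

section \<open>The universal property of the tensor product\<close>

definition bilinear_maps ::
    "(complex, 'a, 'm) module_scheme \<Rightarrow> (complex, 'b, 'n) module_scheme \<Rightarrow>
      (complex, 'c, 'l) module_scheme \<Rightarrow> ('a \<Rightarrow> 'b \<Rightarrow> 'c) set" where
  "bilinear_maps A B M = {\<phi>. (\<forall>x\<in>carrier A. \<phi> x \<in> linear_maps B M) \<and>
     (\<forall>y\<in>carrier B. (\<lambda>x. \<phi> x y) \<in> linear_maps A M)}"

lemma bilinear_mapsI:
  assumes "\<And>x. x \<in> carrier A \<Longrightarrow> \<phi> x \<in> linear_maps B M"
    and "\<And>y. y \<in> carrier B \<Longrightarrow> (\<lambda>x. \<phi> x y) \<in> linear_maps A M"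
  shows "\<phi> \<in> bilinear_maps A B M"
  using assms by (simp add: bilinear_maps_def)

context algebra_pair
begin

context
  fixes M :: "(complex, 'c, 'l) module_scheme" and \<phi>
  assumes M: "complex_algebra M" and \<phi>: "\<phi> \<in> bilinear_maps A B M"
begin

interpretation M: complex_algebra M by (rule M)

lemma bilinear_closed: "x \<in> carrier A \<Longrightarrow> y \<in> carrier B \<Longrightarrow> \<phi> x y \<in> carrier M"
  using \<phi> by (auto simp: bilinear_maps_def dest: linear_maps_closed)

lemma bilinear_simps:
  "x \<in> carrier A \<Longrightarrow> x' \<in> carrier A \<Longrightarrow> y \<in> carrier B \<Longrightarrow> \<phi> (x \<oplus>\<^bsub>A\<^esub> x') y = \<phi> x y \<oplus>\<^bsub>M\<^esub> \<phi> x' y"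
  "x \<in> carrier A \<Longrightarrow> y' \<in> carrier B \<Longrightarrow> y \<in> carrier B \<Longrightarrow> \<phi> x (y \<oplus>\<^bsub>B\<^esub> y') = \<phi> x y \<oplus>\<^bsub>M\<^esub> \<phi> x y'"
  "x \<in> carrier A \<Longrightarrow> y \<in> carrier B \<Longrightarrow> \<phi> (c \<odot>\<^bsub>A\<^esub> x) y = c \<odot>\<^bsub>M\<^esub> \<phi> x y"
  "x \<in> carrier A \<Longrightarrow> y \<in> carrier B \<Longrightarrow> \<phi> x (c \<odot>\<^bsub>B\<^esub> y) = c \<odot>\<^bsub>M\<^esub> \<phi> x y"
  using \<phi> by (auto simp: bilinear_maps_def linear_maps_def)

abbreviation "ev \<equiv> formal_eval M (\<lambda>k. \<phi> (fst k) (snd k))"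

lemma formal_eval_linear: "ev \<in> linear_maps FT M"
proof (rule linear_mapsI)
  have [simp]: "(\<lambda>k. \<phi> (fst k) (snd k)) \<in> carrier A \<times> carrier B \<rightarrow> carrier M"
    by (auto simp: bilinear_closed)
  show "ev x \<in> carrier M" if "x \<in> carrier FT" for x
    using that by (intro M.formal_eval_closed[of _ "carrier A \<times> carrier B"]) auto
  show "ev (x \<oplus>\<^bsub>FT\<^esub> y) = ev x \<oplus>\<^bsub>M\<^esub> ev y" if "x \<in> carrier FT" "y \<in> carrier FT" for x y
    using that by (simp add: M.formal_eval_add[of _ "carrier A \<times> carrier B"])
  show "ev (c \<odot>\<^bsub>FT\<^esub> x) = c \<odot>\<^bsub>M\<^esub> ev x" if "x \<in> carrier FT" for x c
    using that by (simp add: M.formal_eval_scale[of _ "carrier A \<times> carrier B"])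
qed

lemma formal_eval_diff:
  assumes "s \<in> carrier FT" "t \<in> carrier FT"
  shows "ev (s - t) = ev s \<ominus>\<^bsub>M\<^esub> ev t" "s - t \<in> carrier FT"
proof -
  have "s \<ominus>\<^bsub>FT\<^esub> t = s - t"
    using FT.smul_minus_one[OF assms(2)] by (simp add: FT.minus_eq pm_scale_minus_one)
  then show "ev (s - t) = ev s \<ominus>\<^bsub>M\<^esub> ev t" "s - t \<in> carrier FT"
    using linear_maps_minus[OF formal_eval_linear FT.complex_algebra_axioms M assms]
      FT.minus_closed[OF assms] by simp_all
qed

lemma formal_eval_null: "t \<in> NT \<Longrightarrow> ev t = \<zero>\<^bsub>M\<^esub>"
proof -
  assume "t \<in> NT"
  then have "t \<in> carrier FT \<and> ev t = \<zero>\<^bsub>M\<^esub>"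
  proof (induction rule: null_tensors_induct)
    case (base r)
    have cl: "r \<in> carrier FT" using base by (intro null_tensors_closed null_tensors_base)
    have cancel: "(a \<oplus>\<^bsub>M\<^esub> b) \<ominus>\<^bsub>M\<^esub> a \<ominus>\<^bsub>M\<^esub> b = \<zero>\<^bsub>M\<^esub>" if "a \<in> carrier M" "b \<in> carrier M" for a b
      using that by (simp add: M.minus_eq M.a_comm[of a b] M.a_assoc M.r_neg)
    from base have "ev r = \<zero>\<^bsub>M\<^esub>"
      by (cases rule: bilinearity_relationsE)
        (simp_all add: formal_eval_diff single_closed bilinear_simps
          bilinear_closed cancel M.right_minus_eq del: formal_tensors_sel(1))
    with cl show ?case by simp
  next
    case (add x y)
    then show ?case
      using linear_maps_add[OF formal_eval_linear, of x y] FT.a_closed[of x y]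
      by (simp del: formal_tensors_sel(1))
  next
    case (scale c x)
    then show ?case
      using linear_maps_smult[OF formal_eval_linear, of x c] FT.smul_closed[of x c]
      by (simp del: formal_tensors_sel(1))
  qed simp
  then show ?thesis by simp
qed

lemma tensor_lift_eq: "tensor_lift M \<phi> = (\<lambda>T. the_elem (ev ` T))"
  by (simp add: tensor_lift_def[abs_def] formal_eval_def[abs_def])

lemma tensor_lift_linear: "tensor_lift M \<phi> \<in> linear_maps (tensor A B) M"
  unfolding tensor_lift_eq tensor_def
  by (rule FT.quotient_lift_linear[OF ideal_null_tensors formal_eval_linear M formal_eval_null])

lemma tensor_lift_pure:
  assumes "x \<in> carrier A" "y \<in> carrier B"
  shows "tensor_lift M \<phi> (pure_tensor A B x y) = \<phi> x y"
  unfolding tensor_lift_eq pure_tensor_def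
  using FT.coset_image_eq[OF ideal_null_tensors formal_eval_linear M formal_eval_null
      single_closed[OF assms]] assms
  by (simp add: bilinear_closed del: formal_tensors_sel(1))

end

lemma tensor_linear_eqI:
  assumes f: "f \<in> linear_maps (tensor A B) M" and g: "g \<in> linear_maps (tensor A B) M"
    and eq: "\<And>x y. x \<in> carrier A \<Longrightarrow> y \<in> carrier B \<Longrightarrow> f (pure_tensor A B x y) = g (pure_tensor A B x y)"
    and T: "T \<in> carrier (tensor A B)"
  shows "f T = g T"
  using T
  by (induction rule: tensor_induct)
    (simp_all add: eq linear_maps_add[OF f] linear_maps_add[OF g])

lemma tensor_homI:
  assumes M: "complex_algebra M" and f: "f \<in> linear_maps (tensor A B) M"
    and one: "f (pure_tensor A B \<one>\<^bsub>A\<^esub> \<one>\<^bsub>B\<^esub>) = \<one>\<^bsub>M\<^esub>"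
    and mult: "\<And>x y x' y'. x \<in> carrier A \<Longrightarrow> y \<in> carrier B \<Longrightarrow> x' \<in> carrier A \<Longrightarrow> y' \<in> carrier B \<Longrightarrow>
      f (pure_tensor A B (x \<otimes>\<^bsub>A\<^esub> x') (y \<otimes>\<^bsub>B\<^esub> y')) =
      f (pure_tensor A B x y) \<otimes>\<^bsub>M\<^esub> f (pure_tensor A B x' y')"
  shows "f \<in> algebra_homs (tensor A B) M"
proof (rule algebra_homsI[OF f])
  interpret M: complex_algebra M by fact
  note cl = linear_maps_closed[OF f] and add = linear_maps_add[OF f]
  fix S T assume S: "S \<in> carrier (tensor A B)" and T: "T \<in> carrier (tensor A B)"
  have pure: "f (pure_tensor A B x y \<otimes>\<^bsub>tensor A B\<^esub> T) = f (pure_tensor A B x y) \<otimes>\<^bsub>M\<^esub> f T"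
    if "x \<in> carrier A" "y \<in> carrier B" for x y
    using T
    by (induction rule: tensor_induct)
      (simp_all add: that pure_tensor_mult mult T.r_distr M.r_distr add cl)
  show "f (S \<otimes>\<^bsub>tensor A B\<^esub> T) = f S \<otimes>\<^bsub>M\<^esub> f T"
    using S
    by (induction rule: tensor_induct)
      (simp_all add: T pure T.l_distr M.l_distr add cl)
qed (simp add: one[symmetric] pure_tensor_one)

end

lemma (in algebra_pair) tensor_lift_hom:
  assumes M: "complex_algebra M" and \<phi>: "\<phi> \<in> bilinear_maps A B M"
    and one: "\<phi> \<one>\<^bsub>A\<^esub> \<one>\<^bsub>B\<^esub> = \<one>\<^bsub>M\<^esub>"
    and mult: "\<And>x y x' y'. x \<in> carrier A \<Longrightarrow> y \<in> carrier B \<Longrightarrow> x' \<in> carrier A \<Longrightarrow> y' \<in> carrier B \<Longrightarrow>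
      \<phi> (x \<otimes>\<^bsub>A\<^esub> x') (y \<otimes>\<^bsub>B\<^esub> y') = \<phi> x y \<otimes>\<^bsub>M\<^esub> \<phi> x' y'"
  shows "tensor_lift M \<phi> \<in> algebra_homs (tensor A B) M"
  by (rule tensor_homI[OF M tensor_lift_linear[OF M \<phi>]])
    (simp_all add: tensor_lift_pure[OF M \<phi>] one mult)

section \<open>Functoriality, flip and associator\<close>

lemma bilinear_pure_maps:
  assumes "complex_algebra C" "complex_algebra D" "f \<in> linear_maps A C" "g \<in> linear_maps B D"
  shows "(\<lambda>x y. pure_tensor C D (f x) (g y)) \<in> bilinear_maps A B (tensor C D)"
proof -
  interpret CD: algebra_pair C D using assms by (intro algebra_pair.intro)
  show ?thesis
    using assms(3,4)
    by (intro bilinear_mapsI linear_mapsI)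
      (simp_all add: linear_maps_closed linear_maps_add linear_maps_smult CD.pure_tensor_add_left
        CD.pure_tensor_add_right CD.pure_tensor_smult_left CD.pure_tensor_smult_right)
qed

context
  fixes A :: "(complex, 'a, 'm) module_scheme" and B :: "(complex, 'b, 'n) module_scheme"
    and C :: "(complex, 'c, 'l) module_scheme" and D :: "(complex, 'd, 'k) module_scheme"
  assumes A: "complex_algebra A" and B: "complex_algebra B"
    and C: "complex_algebra C" and D: "complex_algebra D"
begin

interpretation AB: algebra_pair A B using A B by (rule algebra_pair.intro)
interpretation CD: algebra_pair C D using C D by (rule algebra_pair.intro)

lemma tensor_map_pure:
  assumes "f \<in> linear_maps A C" "g \<in> linear_maps B D" "x \<in> carrier A" "y \<in> carrier B"
  shows "tensor_map C D f g (pure_tensor A B x y) = pure_tensor C D (f x) (g y)"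
  unfolding tensor_map_def
  using AB.tensor_lift_pure[OF CD.complex_algebra_tensor bilinear_pure_maps[OF C D assms(1,2)]]
    assms(3,4) by simp

lemma tensor_map_hom:
  assumes f: "f \<in> algebra_homs A C" and g: "g \<in> algebra_homs B D"
  shows "tensor_map C D f g \<in> algebra_homs (tensor A B) (tensor C D)"
  unfolding tensor_map_def
  using f g
  by (intro AB.tensor_lift_hom CD.complex_algebra_tensor bilinear_pure_maps C D algebra_homs_linear)
    (simp_all add: algebra_homs_simps[OF f] algebra_homs_simps[OF g] CD.pure_tensor_one
      CD.pure_tensor_mult)

end

context
  fixes A :: "(complex, 'a, 'm) module_scheme" and B :: "(complex, 'b, 'n) module_scheme"
  assumes A: "complex_algebra A" and B: "complex_algebra B"
begin

interpretation AB: algebra_pair A B using A B by (rule algebra_pair.intro)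
interpretation BA: algebra_pair B A using B A by (rule algebra_pair.intro)

lemma bilinear_flip: "(\<lambda>x y. pure_tensor B A y x) \<in> bilinear_maps A B (tensor B A)"
  by (intro bilinear_mapsI linear_mapsI)
    (simp_all add: BA.pure_tensor_add_left BA.pure_tensor_add_right BA.pure_tensor_smult_left
      BA.pure_tensor_smult_right)

lemma tensor_flip_pure:
  "x \<in> carrier A \<Longrightarrow> y \<in> carrier B \<Longrightarrow>
    tensor_flip A B (pure_tensor A B x y) = pure_tensor B A y x"
  unfolding tensor_flip_def
  by (simp add: AB.tensor_lift_pure[OF BA.complex_algebra_tensor bilinear_flip])

lemma tensor_flip_hom: "tensor_flip A B \<in> algebra_homs (tensor A B) (tensor B A)"
  unfolding tensor_flip_def
  by (intro AB.tensor_lift_hom BA.complex_algebra_tensor bilinear_flip)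
    (simp_all add: BA.pure_tensor_one BA.pure_tensor_mult)

end

context
  fixes A :: "(complex, 'a, 'm) module_scheme" and B :: "(complex, 'b, 'n) module_scheme"
    and C :: "(complex, 'c, 'l) module_scheme"
  assumes A: "complex_algebra A" and B: "complex_algebra B" and C: "complex_algebra C"
begin

interpretation AB: algebra_pair A B using A B by (rule algebra_pair.intro)
interpretation BC: algebra_pair B C using B C by (rule algebra_pair.intro)
interpretation ABC: algebra_pair A "tensor B C"
  using A BC.complex_algebra_tensor by (rule algebra_pair.intro)
interpretation ABC': algebra_pair "tensor A B" C
  using AB.complex_algebra_tensor C by (rule algebra_pair.intro)

abbreviation (input) "inner z \<equiv> (\<lambda>x y. pure_tensor A (tensor B C) x (pure_tensor B C y z))"
abbreviation (input) "outer \<equiv> (\<lambda>t z. tensor_lift (tensor A (tensor B C)) (inner z) t)"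

lemma bilinear_assoc_inner:
  "z \<in> carrier C \<Longrightarrow> inner z \<in> bilinear_maps A B (tensor A (tensor B C))"
  by (intro bilinear_mapsI linear_mapsI)
    (simp_all add: BC.pure_tensor_add_left BC.pure_tensor_smult_left ABC.pure_tensor_add_left
      ABC.pure_tensor_add_right ABC.pure_tensor_smult_left ABC.pure_tensor_smult_right)

lemma assoc_outer_pure:
  "x \<in> carrier A \<Longrightarrow> y \<in> carrier B \<Longrightarrow> z \<in> carrier C \<Longrightarrow>
    outer (pure_tensor A B x y) z = pure_tensor A (tensor B C) x (pure_tensor B C y z)"
  by (simp add: AB.tensor_lift_pure[OF ABC.complex_algebra_tensor bilinear_assoc_inner])

lemma assoc_outer_linear:
  "z \<in> carrier C \<Longrightarrow> (\<lambda>t. outer t z) \<in> linear_maps (tensor A B) (tensor A (tensor B C))"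
  by (rule AB.tensor_lift_linear[OF ABC.complex_algebra_tensor bilinear_assoc_inner])

text \<open>Linearity in t is built into the inner lift. Linearity in z is visible only for pure t
  and extends additively to all t.\<close>

lemma bilinear_assoc_outer: "outer \<in> bilinear_maps (tensor A B) C (tensor A (tensor B C))"
proof (rule bilinear_mapsI[OF linear_mapsI])
  fix t assume t: "t \<in> carrier (tensor A B)"
  note lin = assoc_outer_linear
  show "outer t z \<in> carrier (tensor A (tensor B C))" if "z \<in> carrier C" for z
    using linear_maps_closed[OF lin[OF that] t] .
  show "outer t (z \<oplus>\<^bsub>C\<^esub> z') = outer t z \<oplus>\<^bsub>tensor A (tensor B C)\<^esub> outer t z'"
    if z: "z \<in> carrier C" "z' \<in> carrier C" for z z'
    using t
  proof (induction rule: AB.tensor_induct)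
    case (pure x y)
    then show ?case using z
      by (simp add: assoc_outer_pure BC.pure_tensor_add_right ABC.pure_tensor_add_right)
  next
    case (add S T)
    then show ?case using z
      by (simp add: linear_maps_add[OF lin] linear_maps_closed[OF lin] ABC.T.a_ac)
  qed
  show "outer t (c \<odot>\<^bsub>C\<^esub> z) = c \<odot>\<^bsub>tensor A (tensor B C)\<^esub> outer t z" if z: "z \<in> carrier C" for c z
    using t
  proof (induction rule: AB.tensor_induct)
    case (pure x y)
    then show ?case using z
      by (simp add: assoc_outer_pure BC.pure_tensor_smult_right ABC.pure_tensor_smult_right)
  next
    case (add S T)
    then show ?case using z
      by (simp add: linear_maps_add[OF lin] linear_maps_closed[OF lin] ABC.T.smul_add_right)
  qed
qed (rule assoc_outer_linear)

lemma tensor_assoc_pure: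
  assumes "x \<in> carrier A" "y \<in> carrier B" "z \<in> carrier C"
  shows "tensor_assoc A B C (pure_tensor (tensor A B) C (pure_tensor A B x y) z) =
    pure_tensor A (tensor B C) x (pure_tensor B C y z)"
  unfolding tensor_assoc_def Let_def
  using assms
  by (simp add: ABC'.tensor_lift_pure[OF ABC.complex_algebra_tensor bilinear_assoc_outer]
      assoc_outer_pure)

lemma tensor_assoc_hom:
  "tensor_assoc A B C \<in> algebra_homs (tensor (tensor A B) C) (tensor A (tensor B C))"
  unfolding tensor_assoc_def Let_def
proof (rule ABC'.tensor_lift_hom[OF ABC.complex_algebra_tensor bilinear_assoc_outer])
  note lin = assoc_outer_linear
  show "outer \<one>\<^bsub>tensor A B\<^esub> \<one>\<^bsub>C\<^esub> = \<one>\<^bsub>tensor A (tensor B C)\<^esub>"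
    using assoc_outer_pure[of "\<one>\<^bsub>A\<^esub>" "\<one>\<^bsub>B\<^esub>" "\<one>\<^bsub>C\<^esub>"]
    by (simp add: AB.pure_tensor_one BC.pure_tensor_one ABC.pure_tensor_one)
  fix s z t w
  assume s: "s \<in> carrier (tensor A B)" and z: "z \<in> carrier C"
    and t: "t \<in> carrier (tensor A B)" and w: "w \<in> carrier C"
  have pure_left: "outer (pure_tensor A B x y \<otimes>\<^bsub>tensor A B\<^esub> t) (z \<otimes>\<^bsub>C\<^esub> w) =
      outer (pure_tensor A B x y) z \<otimes>\<^bsub>tensor A (tensor B C)\<^esub> outer t w"
    if xy: "x \<in> carrier A" "y \<in> carrier B" for x y
    using t
  proof (induction rule: AB.tensor_induct)
    case (pure x' y')
    then show ?case using xy z w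
      by (simp add: AB.pure_tensor_mult BC.pure_tensor_mult ABC.pure_tensor_mult assoc_outer_pure)
  next
    case (add S T)
    then show ?case using xy z w
      by (simp add: AB.T.r_distr ABC.T.r_distr linear_maps_add[OF lin] linear_maps_closed[OF lin])
  qed
  show "outer (s \<otimes>\<^bsub>tensor A B\<^esub> t) (z \<otimes>\<^bsub>C\<^esub> w) =
      outer s z \<otimes>\<^bsub>tensor A (tensor B C)\<^esub> outer t w"
    using s
  proof (induction rule: AB.tensor_induct)
    case (pure x y)
    then show ?case by (rule pure_left)
  next
    case (add S T)
    then show ?case using t z w
      by (simp add: AB.T.l_distr ABC.T.l_distr linear_maps_add[OF lin] linear_maps_closed[OF lin])
  qed
qed

end

text \<open>Lets the Hopf record of \<open>U_q\<close> and its underlying algebra share literally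
  the same tensor square.\<close>

lemma tensor_cong:
  assumes "carrier A' = carrier A" "mult A' = mult A" "one A' = one A" "add A' = add A"
    "smult A' = smult A"
    and "carrier B' = carrier B" "mult B' = mult B" "one B' = one B" "add B' = add B"
    "smult B' = smult B"
  shows "tensor A' B' = tensor A B" "pure_tensor A' B' = pure_tensor A B"
proof -
  have "formal_tensors A' B' = formal_tensors A B" "null_tensors A' B' = null_tensors A B"
    using assms by (simp_all add: formal_tensors_def null_tensors_def bilinearity_relations_def)
  then show "tensor A' B' = tensor A B" "pure_tensor A' B' = pure_tensor A B"
    by (simp_all add: tensor_def pure_tensor_def fun_eq_iff)
qed

section \<open>Iterated q-commutators\<close>

text \<open>The coefficient \<open>- u\<close> stands in for a subtraction, so that the laws for
  sums and scalars rewrite the expression directly.\<close>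

definition q_commutator ::
    "(complex, 'a, 'm) module_scheme \<Rightarrow> complex \<Rightarrow> 'a \<Rightarrow> 'a \<Rightarrow> 'a" where
  "q_commutator A u x z = x \<otimes>\<^bsub>A\<^esub> z \<oplus>\<^bsub>A\<^esub> (- u) \<odot>\<^bsub>A\<^esub> (z \<otimes>\<^bsub>A\<^esub> x)"

text \<open>With \<open>L\<close> and \<open>R\<close> the left and right multiplications by \<open>x\<close>, this is
  \<open>(L - t q\<^sup>1\<^sup>-\<^sup>n R) (L - t q\<^sup>3\<^sup>-\<^sup>n R) \<dots> (L - t q\<^sup>n\<^sup>-\<^sup>1 R) z\<close>. By the q-binomial theorem it is the left
  hand side of the quantum Serre relation when \<open>t = 1\<close>.\<close>

fun q_serre ::
    "(complex, 'a, 'm) module_scheme \<Rightarrow> complex \<Rightarrow> nat \<Rightarrow> complex \<Rightarrow> 'a \<Rightarrow> 'a \<Rightarrow> 'a" where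
  "q_serre A q 0 t x z = z"
| "q_serre A q (Suc n) t x z = q_commutator A (t * inverse q ^ n) x (q_serre A q n (q * t) x z)"

text \<open>The Pascal recursion of \<open>gauss_binomial\<close> is the recursion of
  \<open>q_serre\<close> read coefficient by coefficient: left multiplication by x keeps r, right
  multiplication raises it by one. The powers of q in the Pascal recursion that depend on r are
  absorbed by passing from t to q t, hence the induction over all t. No q-integer is inverted, so
  roots of unity are allowed.\<close>

lemma q_serre_free_algebra:
  fixes x z :: "'x free_alg"
  assumes q: "q \<noteq> 0"
  shows "(\<Sum>r\<le>n. scalar ((-1) ^ r * t ^ r * gauss_binomial q n r) * x ^ (n - r) * z * x ^ r) =
    q_serre free_algebra q n t x z"
proof (induction n arbitrary: t)
  case 0
  then show ?case by (simp add: scalar_mult)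
next
  case (Suc n)
  define T where "T r = x ^ (Suc n - r) * z * x ^ r" for r
  define c where "c r = (-1) ^ r * (q * t) ^ r * gauss_binomial q n r" for r
  define d where "d r = (-1) ^ r * t ^ r * gauss_binomial q (Suc n) r" for r
  have pw: "q powi (int r - int n) = q ^ r * inverse q ^ n" for r
    using q by (simp add: power_int_diff power_inverse field_simps)
  have d_Suc: "d (Suc r) = c (Suc r) - t * inverse q ^ n * c r" for r
    unfolding d_def c_def gauss_binomial.simps pw by (simp add: algebra_simps power_mult_distrib)
  have d0: "d 0 = c 0"
    by (simp add: c_def d_def)
  \<comment> \<open>The sum \<open>x * ?S\<close> stops at n. The vanishing coefficient lets it run
    to \<open>Suc n\<close>, where it meets the shifted sum.\<close>
  have cn: "c (Suc n) = 0"
    by (simp add: c_def gauss_binomial_eq_0)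
  let ?S = "\<Sum>r\<le>n. pm_scale (c r) (x ^ (n - r) * z * x ^ r)"
  have S: "q_serre free_algebra q n (q * t) x z = ?S"
    unfolding c_def scalar_mult[symmetric] using Suc.IH[of "q * t"] by (simp add: mult.assoc)
  have xS: "x * ?S = (\<Sum>r\<le>n. pm_scale (c r) (T r))"
    unfolding sum_distrib_left
  proof (intro sum.cong refl)
    fix r assume "r \<in> {..n}"
    then have "x ^ (Suc n - r) = x * x ^ (n - r)" by (simp add: Suc_diff_le)
    then show "x * pm_scale (c r) (x ^ (n - r) * z * x ^ r) = pm_scale (c r) (T r)"
      by (simp add: T_def mult_scalar[symmetric] mult.assoc)
  qed
  have Sx: "?S * x = (\<Sum>r\<le>n. pm_scale (c r) (T (Suc r)))"
    unfolding sum_distrib_right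
    by (intro sum.cong refl) (simp add: T_def scalar_mult[symmetric] mult.assoc power_commutes)
  have "(\<Sum>r\<le>Suc n. pm_scale (d r) (T r)) =
      pm_scale (d 0) (T 0) + (\<Sum>r\<le>n. pm_scale (d (Suc r)) (T (Suc r)))"
    by (rule sum.atMost_Suc_shift)
  also have "\<dots> = (pm_scale (c 0) (T 0) + (\<Sum>r\<le>n. pm_scale (c (Suc r)) (T (Suc r)))) +
      (\<Sum>r\<le>n. pm_scale (- (t * inverse q ^ n)) (pm_scale (c r) (T (Suc r))))"
    by (simp add: d0 d_Suc diff_conv_add_uminus pm_scale_add_left sum.distrib add.assoc
        del: add_uminus_conv_diff)
  also have "pm_scale (c 0) (T 0) + (\<Sum>r\<le>n. pm_scale (c (Suc r)) (T (Suc r))) =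
      (\<Sum>r\<le>Suc n. pm_scale (c r) (T r))"
    by (rule sum.atMost_Suc_shift[symmetric])
  also have "\<dots> = x * ?S"
    by (simp add: cn xS)
  also have "(\<Sum>r\<le>n. pm_scale (- (t * inverse q ^ n)) (pm_scale (c r) (T (Suc r)))) =
      pm_scale (- (t * inverse q ^ n)) (?S * x)"
    by (simp only: Sx pm_scale_sum)
  finally have "(\<Sum>r\<le>Suc n. pm_scale (d r) (T r)) =
      q_commutator free_algebra (t * inverse q ^ n) x ?S"
    by (simp add: q_commutator_def free_algebra_def)
  moreover have "(\<Sum>r\<le>Suc n. scalar ((-1) ^ r * t ^ r * gauss_binomial q (Suc n) r) *
      x ^ (Suc n - r) * z * x ^ r) = (\<Sum>r\<le>Suc n. pm_scale (d r) (T r))"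
    unfolding d_def T_def scalar_mult[symmetric] by (simp only: mult.assoc)
  ultimately show ?case
    by (simp only: q_serre.simps S)
qed

lemma q_serre_hom:
  assumes f: "f \<in> algebra_homs A B" and A: "complex_algebra A"
    and x: "x \<in> carrier A" and z: "z \<in> carrier A"
  shows "q_serre A q n t x z \<in> carrier A"
    and "f (q_serre A q n t x z) = q_serre B q n t (f x) (f z)"
proof -
  interpret complex_algebra A by fact
  have closed: "q_serre A q n t x z \<in> carrier A" for n t
    using x z by (induction n arbitrary: t) (simp_all add: q_commutator_def)
  then show "q_serre A q n t x z \<in> carrier A" .
  show "f (q_serre A q n t x z) = q_serre B q n t (f x) (f z)"
    using x z closed
    by (induction n arbitrary: t) (simp_all add: q_commutator_def algebra_homs_simps[OF f])
qed

context complex_algebra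
begin

lemma q_commutator_closed [simp, intro]:
  "x \<in> carrier A \<Longrightarrow> z \<in> carrier A \<Longrightarrow> q_commutator A u x z \<in> carrier A"
  by (simp add: q_commutator_def)

lemma q_serre_closed [simp, intro]:
  "x \<in> carrier A \<Longrightarrow> z \<in> carrier A \<Longrightarrow> q_serre A q n t x z \<in> carrier A"
  by (induction n arbitrary: t) simp_all

lemma smul_cancel: "x \<in> carrier A \<Longrightarrow> c \<odot> x \<oplus> (- c) \<odot> x = \<zero>"
  by (simp flip: smul_add_left)

text \<open>With L and R the multiplications by x from the left and from the right,
  \<open>q_commutator A u x\<close> is L - uR, and L and R commute by associativity.\<close>

lemma q_commutator_commute:
  assumes "x \<in> carrier A" "z \<in> carrier A"
  shows "q_commutator A u x (q_commutator A v x z) = q_commutator A v x (q_commutator A u x z)"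
  using assms
  by (simp add: q_commutator_def l_distr r_distr smul_add_right smult_mult_left smult_mult_right
      m_assoc a_ac mult.commute)

lemma q_serre_q_commutator:
  assumes "x \<in> carrier A" "z \<in> carrier A"
  shows "q_serre A q n t x (q_commutator A u x z) = q_commutator A u x (q_serre A q n t x z)"
  using assms by (induction n arbitrary: t) (simp_all add: q_commutator_commute)

text \<open>The parameters of the factors are t q^(-n), ..., t q^n in steps of q^2, and the factors
  commute. The definition peels off the first of them; here the last is peeled off instead.\<close>

lemma q_serre_Suc_inverse:
  assumes "x \<in> carrier A" "z \<in> carrier A" "q \<noteq> 0"
  shows "q_serre A q (Suc n) t x z = q_commutator A (t * q ^ n) x (q_serre A q n (t * inverse q) x z)"
proof (induction n arbitrary: t)
  case (Suc n)
  have "q_serre A q (Suc (Suc n)) t x z =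
      q_commutator A (t * inverse q ^ Suc n) x (q_serre A q (Suc n) (q * t) x z)"
    by simp
  also have "\<dots> = q_commutator A (t * inverse q ^ Suc n) x
      (q_commutator A (t * q ^ Suc n) x (q_serre A q n t x z))"
    using Suc.IH[of "q * t"] assms(3) by (simp add: field_simps)
  also have "\<dots> = q_commutator A (t * q ^ Suc n) x
      (q_commutator A (t * inverse q ^ Suc n) x (q_serre A q n t x z))"
    using assms by (intro q_commutator_commute) auto
  also have "q_commutator A (t * inverse q ^ Suc n) x (q_serre A q n t x z) =
      q_serre A q (Suc n) (t * inverse q) x z"
  proof -
    have t: "q * (t * inverse q) = t" using assms(3) by simp
    show ?thesis unfolding q_serre.simps t by (simp add: mult.assoc)
  qed
  finally show ?case .
qed (use assms in simp)

lemma q_commutator_zero: "x \<in> carrier A \<Longrightarrow> q_commutator A u x \<zero> = \<zero>"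
  by (simp add: q_commutator_def)

lemma q_serre_zero: "x \<in> carrier A \<Longrightarrow> q_serre A q n t x \<zero> = \<zero>"
  by (induction n arbitrary: t) (simp_all add: q_commutator_zero)

lemma q_commutator_add:
  "x \<in> carrier A \<Longrightarrow> z \<in> carrier A \<Longrightarrow> z' \<in> carrier A \<Longrightarrow>
    q_commutator A u x (z \<oplus> z') = q_commutator A u x z \<oplus> q_commutator A u x z'"
  by (simp add: q_commutator_def l_distr r_distr smul_add_right a_ac)

lemma q_serre_add:
  "x \<in> carrier A \<Longrightarrow> z \<in> carrier A \<Longrightarrow> z' \<in> carrier A \<Longrightarrow>
    q_serre A q n t x (z \<oplus> z') = q_serre A q n t x z \<oplus> q_serre A q n t x z'"
  by (induction n arbitrary: t) (simp_all add: q_commutator_add)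

lemma q_commutator_smult:
  "x \<in> carrier A \<Longrightarrow> z \<in> carrier A \<Longrightarrow> q_commutator A u x (c \<odot> z) = c \<odot> q_commutator A u x z"
  by (simp add: q_commutator_def smult_mult_left smult_mult_right smul_add_right mult.commute)

lemma q_serre_smult:
  "x \<in> carrier A \<Longrightarrow> z \<in> carrier A \<Longrightarrow> q_serre A q n t x (c \<odot> z) = c \<odot> q_serre A q n t x z"
  by (induction n arbitrary: t) (simp_all add: q_commutator_smult)

lemma q_commutator_smult_left:
  "x \<in> carrier A \<Longrightarrow> z \<in> carrier A \<Longrightarrow> q_commutator A u (c \<odot> x) z = c \<odot> q_commutator A u x z"
  by (simp add: q_commutator_def smult_mult_left smult_mult_right smul_add_right mult.commute)

lemma q_serre_smult_left:
  "x \<in> carrier A \<Longrightarrow> z \<in> carrier A \<Longrightarrow> q_serre A q n t (c \<odot> x) z = c ^ n \<odot> q_serre A q n t x z"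
  by (induction n arbitrary: t) (simp_all add: q_commutator_smult_left q_commutator_smult mult.commute)

lemma q_commutator_commutation:
  assumes xyz: "x \<in> carrier A" "y \<in> carrier A" "z \<in> carrier A"
    and yx: "y \<otimes> x = a \<odot> (x \<otimes> y)" and yz: "y \<otimes> z = w \<odot> (z \<otimes> y)"
  shows "y \<otimes> q_commutator A u x z = (a * w) \<odot> (q_commutator A u x z \<otimes> y)"
proof -
  have 1: "y \<otimes> (x \<otimes> z) = (a * w) \<odot> (x \<otimes> (z \<otimes> y))"
  proof -
    have "y \<otimes> (x \<otimes> z) = (y \<otimes> x) \<otimes> z" using xyz by (simp add: m_assoc)
    also have "\<dots> = a \<odot> (x \<otimes> (y \<otimes> z))" using xyz by (simp add: yx smult_mult_left m_assoc)
    finally show ?thesis using xyz by (simp add: yz smult_mult_right)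
  qed
  have 2: "y \<otimes> (z \<otimes> x) = (a * w) \<odot> (z \<otimes> (x \<otimes> y))"
  proof -
    have "y \<otimes> (z \<otimes> x) = (y \<otimes> z) \<otimes> x" using xyz by (simp add: m_assoc)
    also have "\<dots> = w \<odot> (z \<otimes> (y \<otimes> x))" using xyz by (simp add: yz smult_mult_left m_assoc)
    finally show ?thesis using xyz by (simp add: yx smult_mult_right mult.commute)
  qed
  show ?thesis
    using xyz
    by (simp add: q_commutator_def r_distr l_distr smult_mult_left smult_mult_right 1 2 m_assoc
        smul_add_right mult_ac)
qed

lemma q_serre_commutation:
  assumes "x \<in> carrier A" "y \<in> carrier A" "z \<in> carrier A"
    and "y \<otimes> x = a \<odot> (x \<otimes> y)" and "y \<otimes> z = w \<odot> (z \<otimes> y)"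
  shows "y \<otimes> q_serre A q n t x z = (a ^ n * w) \<odot> (q_serre A q n t x z \<otimes> y)"
  using assms
proof (induction n arbitrary: t)
  case (Suc n)
  then show ?case
    using q_commutator_commutation[OF assms(1,2) _ assms(4) Suc.IH] by (simp add: mult.assoc)
qed simp

text \<open>If \<open>y\<close> q-commutes with \<open>z\<close> with the parameter of the innermost q-commutator, it contributes
  nothing to that q-commutator, and it then q-commutes with the result with the next parameter.\<close>

lemma q_serre_add_left:
  assumes xyz: "x \<in> carrier A" "y \<in> carrier A" "z \<in> carrier A" and q: "q \<noteq> 0"
    and yx: "y \<otimes> x = inverse q ^ 2 \<odot> (x \<otimes> y)"
    and yz: "y \<otimes> z = (t * q ^ n * inverse q) \<odot> (z \<otimes> y)"
  shows "q_serre A q n t (x \<oplus> y) z = q_serre A q n t x z"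
  using yz
proof (induction n arbitrary: t)
  case (Suc n)
  have IH: "q_serre A q n (q * t) (x \<oplus> y) z = q_serre A q n (q * t) x z"
    using Suc.prems q by (intro Suc.IH) (simp add: mult_ac)
  let ?z = "q_serre A q n (q * t) x z" and ?u = "t * inverse q ^ n"
  have "(inverse q ^ 2) ^ n * (t * q ^ Suc n * inverse q) = ?u"
    using q by (simp add: field_simps mult_2_right flip: power_mult power_add)
  then have yz': "y \<otimes> ?z = ?u \<odot> (?z \<otimes> y)"
    using q_serre_commutation[OF xyz yx Suc.prems, of q n "q * t"]
    by (simp only:)
  have "q_commutator A ?u (x \<oplus> y) ?z =
      q_commutator A ?u x ?z \<oplus> (?u \<odot> (?z \<otimes> y) \<oplus> (- ?u) \<odot> (?z \<otimes> y))"
    using xyz unfolding q_commutator_def yz'[symmetric]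
    by (simp add: l_distr r_distr smul_add_right a_ac)
  also have "\<dots> = q_commutator A ?u x ?z"
    using xyz by (simp add: smul_cancel del: smul_uminus_left)
  finally show ?case using IH by simp
qed simp

text \<open>The mirror image of \<open>q_serre_add_left\<close>. The negligible part x now meets z
  with the parameter at the low end, t q^(1-n), and each further factor raises it by q^2, so the
  product is unwound from the other end.\<close>

lemma q_serre_add_right:
  assumes xyz: "x \<in> carrier A" "y \<in> carrier A" "z \<in> carrier A" and q: "q \<noteq> 0"
    and xy: "x \<otimes> y = q ^ 2 \<odot> (y \<otimes> x)"
    and xz: "x \<otimes> z = (t * inverse q ^ n * q) \<odot> (z \<otimes> x)"
  shows "q_serre A q n t (x \<oplus> y) z = q_serre A q n t y z"
  using xz
proof (induction n arbitrary: t)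
  case (Suc n)
  have IH: "q_serre A q n (t * inverse q) (x \<oplus> y) z = q_serre A q n (t * inverse q) y z"
    using Suc.prems q by (intro Suc.IH) (simp add: mult_ac)
  let ?z = "q_serre A q n (t * inverse q) y z" and ?u = "t * q ^ n"
  have "(q ^ 2) ^ n * (t * inverse q ^ Suc n * q) = ?u"
    using q by (simp add: field_simps mult_2_right flip: power_mult power_add)
  then have xz': "x \<otimes> ?z = ?u \<odot> (?z \<otimes> x)"
    using q_serre_commutation[OF xyz(2,1,3) xy Suc.prems, of q n "t * inverse q"]
    by (simp only:)
  have "q_commutator A ?u (x \<oplus> y) ?z =
      q_commutator A ?u y ?z \<oplus> (?u \<odot> (?z \<otimes> x) \<oplus> (- ?u) \<odot> (?z \<otimes> x))"
    using xyz unfolding q_commutator_def xz'[symmetric]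
    by (simp add: l_distr r_distr smul_add_right a_ac)
  also have "\<dots> = q_commutator A ?u y ?z"
    using xyz by (simp add: smul_cancel)
  finally show ?case
    using IH xyz q by (simp add: q_serre_Suc_inverse del: q_serre.simps)
qed simp

text \<open>When k and l are moved to the right, both terms of each q-commutator acquire the same
  scalar, because k passes z with the same factor w with which l passes x. So the Serre element of x
  and z splits off on the left. This reduces the Serre elements in E \<otimes> K and in E K^-1 to
  those in E.\<close>

lemma q_serre_factor:
  assumes c: "x \<in> carrier A" "z \<in> carrier A" "k \<in> carrier A" "l \<in> carrier A"
    and kx: "k \<otimes> x = a \<odot> (x \<otimes> k)" and kz: "k \<otimes> z = w \<odot> (z \<otimes> k)"
    and lx: "l \<otimes> x = w \<odot> (x \<otimes> l)" and kl: "k \<otimes> l = l \<otimes> k"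
  shows "\<exists>p\<in>carrier A. q_serre A q n t (x \<otimes> k) (z \<otimes> l) = q_serre A q n t x z \<otimes> p"
proof -
  \<comment> \<open>Up to a scalar, p is a product of l and n copies of k. The two commutation
    clauses are the invariant that makes the scalars of the two terms agree in the next
    q-commutator.\<close>
  have "\<exists>p\<in>carrier A. k \<otimes> p = p \<otimes> k \<and> p \<otimes> x = (a ^ n * w) \<odot> (x \<otimes> p) \<and>
    q_serre A q n t (x \<otimes> k) (z \<otimes> l) = q_serre A q n t x z \<otimes> p"
  proof (induction n arbitrary: t)
    case 0
    then show ?case using assms by (intro bexI[of _ l]) auto
  next
    case (Suc n)
    obtain p where p: "p \<in> carrier A" and kp: "k \<otimes> p = p \<otimes> k"
      and px: "p \<otimes> x = (a ^ n * w) \<odot> (x \<otimes> p)"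
      and eq: "q_serre A q n (q * t) (x \<otimes> k) (z \<otimes> l) = q_serre A q n (q * t) x z \<otimes> p"
      using Suc.IH by blast
    let ?y = "q_serre A q n (q * t) x z" and ?u = "t * inverse q ^ n" and ?b = "a ^ n * w"
    have y: "?y \<in> carrier A" using c by simp
    have ky: "k \<otimes> ?y = ?b \<odot> (?y \<otimes> k)"
      using q_serre_commutation[OF c(1,3,2) kx kz] .
    have 1: "x \<otimes> k \<otimes> (?y \<otimes> p) = ?b \<odot> (x \<otimes> ?y \<otimes> (k \<otimes> p))"
    proof -
      have "x \<otimes> k \<otimes> (?y \<otimes> p) = x \<otimes> (k \<otimes> ?y) \<otimes> p"
        using c p y by (simp add: m_assoc)
      then show ?thesis
        using c p y by (simp add: ky smult_mult_left smult_mult_right m_assoc)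
    qed
    have 2: "?y \<otimes> p \<otimes> (x \<otimes> k) = ?b \<odot> (?y \<otimes> x \<otimes> (k \<otimes> p))"
    proof -
      have "?y \<otimes> p \<otimes> (x \<otimes> k) = ?y \<otimes> (p \<otimes> x) \<otimes> k"
        using c p y by (simp add: m_assoc)
      then show ?thesis
        using c p y by (simp add: px kp smult_mult_left smult_mult_right m_assoc)
    qed
    have "q_commutator A ?u (x \<otimes> k) (?y \<otimes> p) = q_commutator A ?u x ?y \<otimes> (?b \<odot> (k \<otimes> p))"
      using c p y unfolding q_commutator_def 1 2
      by (simp add: l_distr smult_mult_left smult_mult_right smul_add_right mult.commute)
    moreover have "?b \<odot> (k \<otimes> p) \<otimes> x = (a ^ Suc n * w) \<odot> (x \<otimes> (?b \<odot> (k \<otimes> p)))"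
    proof -
      have "k \<otimes> p \<otimes> x = ?b \<odot> (k \<otimes> x \<otimes> p)"
        using c p by (simp add: m_assoc px smult_mult_right)
      also have "\<dots> = (a ^ Suc n * w) \<odot> (x \<otimes> (k \<otimes> p))"
        using c p by (simp add: kx smult_mult_left m_assoc mult_ac)
      finally show ?thesis
        using c p by (simp add: smult_mult_left smult_mult_right mult_ac)
    qed
    moreover have "k \<otimes> (?b \<odot> (k \<otimes> p)) = ?b \<odot> (k \<otimes> p) \<otimes> k"
      using c p by (simp add: smult_mult_left smult_mult_right m_assoc flip: kp)
    ultimately show ?case
      using c p eq by (intro bexI[of _ "?b \<odot> (k \<otimes> p)"]) auto
  qed
  then show ?thesis by blast
qed

end

section \<open>Serre elements in the opposite algebra\<close>

lemma opposite_algebra_sel [simp]: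
  "carrier (opposite_algebra A) = carrier A"
  "x \<otimes>\<^bsub>opposite_algebra A\<^esub> y = y \<otimes>\<^bsub>A\<^esub> x"
  "\<one>\<^bsub>opposite_algebra A\<^esub> = \<one>\<^bsub>A\<^esub>"
  "\<zero>\<^bsub>opposite_algebra A\<^esub> = \<zero>\<^bsub>A\<^esub>"
  "x \<oplus>\<^bsub>opposite_algebra A\<^esub> y = x \<oplus>\<^bsub>A\<^esub> y"
  "c \<odot>\<^bsub>opposite_algebra A\<^esub> x = c \<odot>\<^bsub>A\<^esub> x"
  by (simp_all add: opposite_algebra_def)

context complex_algebra
begin

lemma complex_algebra_opposite: "complex_algebra (opposite_algebra A)"
proof (rule complex_algebraI)
  show "ring (opposite_algebra A)"
  proof (intro ringI abelian_groupI monoidI)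
    fix x assume "x \<in> carrier (opposite_algebra A)"
    then show "\<exists>y\<in>carrier (opposite_algebra A).
        y \<oplus>\<^bsub>opposite_algebra A\<^esub> x = \<zero>\<^bsub>opposite_algebra A\<^esub>"
      by (intro bexI[of _ "\<ominus> x"]) (auto simp: l_neg)
  qed (simp_all add: a_ac m_assoc l_distr r_distr)
qed (simp_all add: smul_add_left smul_add_right smult_mult_left smult_mult_right)

lemma q_commutator_opposite:
  assumes "x \<in> carrier A" "z \<in> carrier A" "u \<noteq> 0"
  shows "q_commutator (opposite_algebra A) u x z = (- u) \<odot> q_commutator A (inverse u) x z"
  using assms by (simp add: q_commutator_def smul_add_right a_comm)

text \<open>Exchanging left and right multiplication turns L - uR into - u (L - u^-1 R), so the
  parameters t q^(1-n), ..., t q^(n-1) are inverted. For t = 1 they form a symmetric set, and the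
  Serre element is preserved up to a scalar.\<close>

lemma q_serre_opposite:
  assumes xz: "x \<in> carrier A" "z \<in> carrier A" and q: "q \<noteq> 0" and t: "t \<noteq> 0"
  shows "\<exists>c. q_serre (opposite_algebra A) q n t x z = c \<odot> q_serre A q n (inverse t) x z"
  using t
proof (induction n arbitrary: t)
  case 0
  then show ?case using xz by (intro exI[of _ 1]) simp
next
  case (Suc n)
  obtain c where c: "q_serre (opposite_algebra A) q n (q * t) x z =
      c \<odot> q_serre A q n (inverse (q * t)) x z"
    using Suc.IH[of "q * t"] Suc.prems q by auto
  let ?u = "t * inverse q ^ n"
  have "q_serre (opposite_algebra A) q (Suc n) t x z =
      (- ?u * c) \<odot> q_commutator A (inverse ?u) x (q_serre A q n (inverse (q * t)) x z)"
    using xz q Suc.prems by (simp add: c q_commutator_opposite q_commutator_smult)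
  also have "q_commutator A (inverse ?u) x (q_serre A q n (inverse (q * t)) x z) =
      q_serre A q (Suc n) (inverse t) x z"
    unfolding q_serre_Suc_inverse[OF xz q]
    by (simp add: power_inverse mult.commute)
  finally show ?case by blast
qed

end

section \<open>The relations of the quantized enveloping algebra\<close>

text \<open>Separates the quantum algebra from the Lie algebra: the facts about the Cartan matrix
  listed here are derived from root theory in the last section.\<close>

locale quantum_datum =
  fixes a :: "'i \<Rightarrow> 'i \<Rightarrow> int" and d :: "'i \<Rightarrow> nat" and q :: complex
  assumes q_nonzero: "q \<noteq> 0"
    and q_power: "q ^ (2 * d i) \<noteq> 1"
    and diagonal: "a i i = 2"
    and symmetrizable: "int (d i) * a i j = int (d j) * a j i"
    and off_diagonal: "i \<noteq> j \<Longrightarrow> a i j \<le> 0"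
begin

abbreviation "qi i \<equiv> q ^ d i"
abbreviation "qa i j \<equiv> (q ^ d i) powi a i j"
abbreviation "qc i \<equiv> 1 / (q ^ d i - inverse (q ^ d i))"
abbreviation "serre_order i j \<equiv> nat (1 - a i j)"
abbreviation "U \<equiv> presented (uq_relators a d q)"
abbreviation "\<iota> \<equiv> presented_of (uq_relators a d q)"

lemma qi_nonzero: "qi i \<noteq> 0"
  using q_nonzero by simp

lemma qa_nonzero: "qa i j \<noteq> 0"
  using q_nonzero by simp

text \<open>Both are powers of q, with the exponents d_i a_ij and d_j a_ji.\<close>

lemma qa_commute: "qa i j = qa j i"
proof -
  have "qa i j = q powi (int (d i) * a i j)" for i j
    by (simp add: power_int_mult)
  then show ?thesis by (simp add: symmetrizable)
qed

lemma qa_diagonal: "qa i i = qi i ^ 2"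
  by (simp add: diagonal)

lemma serre_order_Suc: "i \<noteq> j \<Longrightarrow> serre_order i j = Suc (nat (- a i j))"
  using off_diagonal[of i j] by simp

lemma qa_off_diagonal: "i \<noteq> j \<Longrightarrow> qa i j = inverse (qi i ^ nat (- a i j))"
  using off_diagonal[of i j] q_nonzero
  by (metis int_nat_eq minus_minus neg_0_le_iff_le power_int_minus power_int_of_nat)

end

text \<open>The Serre relations are kept apart because the functions on words satisfy only these
  relations at first. The conjugation relations are written as q-commutations, the form in which the
  lemmas on q-commutators take them.\<close>

definition uq_cartan_relations ::
    "('i \<Rightarrow> 'i \<Rightarrow> int) \<Rightarrow> ('i \<Rightarrow> nat) \<Rightarrow> complex \<Rightarrow> (complex, 'b, 'm) module_scheme \<Rightarrow>
      ('i uq_gen \<Rightarrow> 'b) \<Rightarrow> bool" where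
  "uq_cartan_relations a d q B f \<longleftrightarrow> range f \<subseteq> carrier B \<and>
     (\<forall>i. f (GK i) \<otimes>\<^bsub>B\<^esub> f (GKinv i) = \<one>\<^bsub>B\<^esub> \<and> f (GKinv i) \<otimes>\<^bsub>B\<^esub> f (GK i) = \<one>\<^bsub>B\<^esub>) \<and>
     (\<forall>i j. f (GK i) \<otimes>\<^bsub>B\<^esub> f (GK j) = f (GK j) \<otimes>\<^bsub>B\<^esub> f (GK i)) \<and>
     (\<forall>i j. f (GK i) \<otimes>\<^bsub>B\<^esub> f (GE j) = ((q ^ d i) powi a i j) \<odot>\<^bsub>B\<^esub> (f (GE j) \<otimes>\<^bsub>B\<^esub> f (GK i))) \<and>
     (\<forall>i j. f (GK i) \<otimes>\<^bsub>B\<^esub> f (GF j) =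
        inverse ((q ^ d i) powi a i j) \<odot>\<^bsub>B\<^esub> (f (GF j) \<otimes>\<^bsub>B\<^esub> f (GK i))) \<and>
     (\<forall>i j. f (GE i) \<otimes>\<^bsub>B\<^esub> f (GF j) = f (GF j) \<otimes>\<^bsub>B\<^esub> f (GE i) \<oplus>\<^bsub>B\<^esub>
        (if i = j then (1 / (q ^ d i - inverse (q ^ d i))) \<odot>\<^bsub>B\<^esub> (f (GK i) \<ominus>\<^bsub>B\<^esub> f (GKinv i))
         else \<zero>\<^bsub>B\<^esub>))"

definition uq_relations ::
    "('i \<Rightarrow> 'i \<Rightarrow> int) \<Rightarrow> ('i \<Rightarrow> nat) \<Rightarrow> complex \<Rightarrow> (complex, 'b, 'm) module_scheme \<Rightarrow>
      ('i uq_gen \<Rightarrow> 'b) \<Rightarrow> bool" where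
  "uq_relations a d q B f \<longleftrightarrow> uq_cartan_relations a d q B f \<and>
     (\<forall>i j. i \<noteq> j \<longrightarrow> q_serre B (q ^ d i) (nat (1 - a i j)) 1 (f (GE i)) (f (GE j)) = \<zero>\<^bsub>B\<^esub>) \<and>
     (\<forall>i j. i \<noteq> j \<longrightarrow> q_serre B (q ^ d i) (nat (1 - a i j)) 1 (f (GF i)) (f (GF j)) = \<zero>\<^bsub>B\<^esub>)"

lemmas uq_relations_defs = uq_relations_def uq_cartan_relations_def

text \<open>Stated for opaque families, so that simplification acts on the shape of the union and
  leaves the relators alone.\<close>

lemma relator_families_ball:
  "(\<forall>r\<in>(\<Union>i. {k i, k' i}) \<union> (\<Union>i j. {kk i j, ke i j, kf i j, ef i j}) \<union>
      (\<Union>X\<in>{x, y}. {s X i j | i j. i \<noteq> j}). P r) \<longleftrightarrow>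
    (\<forall>i. P (k i) \<and> P (k' i)) \<and> (\<forall>i j. P (kk i j) \<and> P (ke i j) \<and> P (kf i j) \<and> P (ef i j)) \<and>
    (\<forall>i j. i \<noteq> j \<longrightarrow> P (s x i j)) \<and> (\<forall>i j. i \<noteq> j \<longrightarrow> P (s y i j))"
proof -
  have "(\<forall>r\<in>{s X i j | i j. i \<noteq> j}. P r) \<longleftrightarrow> (\<forall>i j. i \<noteq> j \<longrightarrow> P (s X i j))" for X
    by blast
  then show ?thesis by (simp add: ball_Un)
qed

lemma uq_relators_ball:
  "(\<forall>r\<in>uq_relators a d q. P r) \<longleftrightarrow>
     (\<forall>i. P (gen (GK i) * gen (GKinv i) - 1) \<and> P (gen (GKinv i) * gen (GK i) - 1)) \<and>
     (\<forall>i j. P (gen (GK i) * gen (GK j) - gen (GK j) * gen (GK i)) \<and>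
       P (gen (GK i) * gen (GE j) * gen (GKinv i) - scalar ((q ^ d i) powi a i j) * gen (GE j)) \<and>
       P (gen (GK i) * gen (GF j) * gen (GKinv i) - scalar ((q ^ d i) powi (- a i j)) * gen (GF j)) \<and>
       P (gen (GE i) * gen (GF j) - gen (GF j) * gen (GE i) -
         (if i = j then scalar (1 / (q ^ d i - inverse (q ^ d i))) * (gen (GK i) - gen (GKinv i))
          else 0))) \<and>
     (\<forall>i j. i \<noteq> j \<longrightarrow> P (\<Sum>r\<le>nat (1 - a i j).
        scalar ((-1) ^ r * gauss_binomial (q ^ d i) (nat (1 - a i j)) r) *
        gen (GE i) ^ (nat (1 - a i j) - r) * gen (GE j) * gen (GE i) ^ r)) \<and>
     (\<forall>i j. i \<noteq> j \<longrightarrow> P (\<Sum>r\<le>nat (1 - a i j).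
        scalar ((-1) ^ r * gauss_binomial (q ^ d i) (nat (1 - a i j)) r) *
        gen (GF i) ^ (nat (1 - a i j) - r) * gen (GF j) * gen (GF i) ^ r))"
  unfolding uq_relators_def by (rule relator_families_ball)

lemma (in complex_algebra) conjugation_iff:
  assumes "k \<in> carrier A" "l \<in> carrier A" "x \<in> carrier A" "k \<otimes> l = \<one>" "l \<otimes> k = \<one>"
  shows "k \<otimes> x \<otimes> l = c \<odot> x \<longleftrightarrow> k \<otimes> x = c \<odot> (x \<otimes> k)"
proof
  assume *: "k \<otimes> x \<otimes> l = c \<odot> x"
  have "k \<otimes> x = k \<otimes> x \<otimes> l \<otimes> k" using assms by (simp add: m_assoc)
  then show "k \<otimes> x = c \<odot> (x \<otimes> k)" using assms by (simp add: * smult_mult_left)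
next
  assume "k \<otimes> x = c \<odot> (x \<otimes> k)"
  then show "k \<otimes> x \<otimes> l = c \<odot> x" using assms by (simp add: smult_mult_left m_assoc)
qed

lemma (in complex_algebra) minus_minus_eq_iff:
  assumes "x \<in> carrier A" "y \<in> carrier A" "z \<in> carrier A"
  shows "x \<ominus> y \<ominus> z = \<zero> \<longleftrightarrow> x = y \<oplus> z"
proof -
  have "x \<ominus> y \<ominus> z = x \<ominus> (y \<oplus> z)"
    using assms by (simp add: minus_eq minus_add a_ac)
  then show ?thesis using assms by (simp add: right_minus_eq)
qed

text \<open>Bridge between the presentation and relations in a target, used in both directions: to
  lift maps out of \<open>U_q\<close>, and to read off the relations that hold in \<open>U_q\<close>
  itself.\<close>

lemma uq_relations_iff:
  assumes h: "h \<in> algebra_homs free_algebra B" and B: "complex_algebra B" and q: "q \<noteq> 0"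
  shows "(\<forall>r\<in>uq_relators a d q. h r = \<zero>\<^bsub>B\<^esub>) \<longleftrightarrow> uq_relations a d q B (\<lambda>x. h (gen x))"
proof -
  interpret B: complex_algebra B by fact
  note [simp] = free_hom_simps[OF h B]
  let ?f = "\<lambda>x. h (gen x)"
  have serre: "h (\<Sum>r\<le>n. scalar ((-1) ^ r * gauss_binomial (q ^ d i) n r) *
      gen x ^ (n - r) * gen y * gen x ^ r) = q_serre B (q ^ d i) n 1 (?f x) (?f y)" for i n x y
    using q_serre_free_algebra[of "q ^ d i" 1 n "gen x" "gen y"] q
      q_serre_hom(2)[OF h complex_algebra_free_algebra]
    by simp
  let ?inv = "\<forall>i. ?f (GK i) \<otimes>\<^bsub>B\<^esub> ?f (GKinv i) = \<one>\<^bsub>B\<^esub> \<and> ?f (GKinv i) \<otimes>\<^bsub>B\<^esub> ?f (GK i) = \<one>\<^bsub>B\<^esub>"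
  let ?ef = "\<lambda>i j. if i = j then (1 / (q ^ d i - inverse (q ^ d i))) \<odot>\<^bsub>B\<^esub> (?f (GK i) \<ominus>\<^bsub>B\<^esub> ?f (GKinv i))
         else \<zero>\<^bsub>B\<^esub>"
  have ef: "h (gen (GE i) * gen (GF j) - gen (GF j) * gen (GE i) -
      (if i = j then scalar (1 / (q ^ d i - inverse (q ^ d i))) * (gen (GK i) - gen (GKinv i))
       else 0)) = \<zero>\<^bsub>B\<^esub> \<longleftrightarrow>
      ?f (GE i) \<otimes>\<^bsub>B\<^esub> ?f (GF j) = ?f (GF j) \<otimes>\<^bsub>B\<^esub> ?f (GE i) \<oplus>\<^bsub>B\<^esub> ?ef i j" for i j
    by (cases "i = j", simp add: scalar_mult B.minus_minus_eq_iff) (simp add: B.right_minus_eq)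
  have minus: "h (x - y) = \<zero>\<^bsub>B\<^esub> \<longleftrightarrow> h x = h y" for x y
    by (simp add: B.right_minus_eq)
  have "(\<forall>r\<in>uq_relators a d q. h r = \<zero>\<^bsub>B\<^esub>) \<longleftrightarrow> ?inv \<and>
     (\<forall>i j. ?f (GK i) \<otimes>\<^bsub>B\<^esub> ?f (GK j) = ?f (GK j) \<otimes>\<^bsub>B\<^esub> ?f (GK i) \<and>
       ?f (GK i) \<otimes>\<^bsub>B\<^esub> ?f (GE j) \<otimes>\<^bsub>B\<^esub> ?f (GKinv i) = ((q ^ d i) powi a i j) \<odot>\<^bsub>B\<^esub> ?f (GE j) \<and>
       ?f (GK i) \<otimes>\<^bsub>B\<^esub> ?f (GF j) \<otimes>\<^bsub>B\<^esub> ?f (GKinv i) = ((q ^ d i) powi (- a i j)) \<odot>\<^bsub>B\<^esub> ?f (GF j) \<and>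
       ?f (GE i) \<otimes>\<^bsub>B\<^esub> ?f (GF j) = ?f (GF j) \<otimes>\<^bsub>B\<^esub> ?f (GE i) \<oplus>\<^bsub>B\<^esub> ?ef i j) \<and>
     (\<forall>i j. i \<noteq> j \<longrightarrow> q_serre B (q ^ d i) (nat (1 - a i j)) 1 (?f (GE i)) (?f (GE j)) = \<zero>\<^bsub>B\<^esub>) \<and>
     (\<forall>i j. i \<noteq> j \<longrightarrow> q_serre B (q ^ d i) (nat (1 - a i j)) 1 (?f (GF i)) (?f (GF j)) = \<zero>\<^bsub>B\<^esub>)"
    unfolding uq_relators_ball serre ef
    unfolding minus
    unfolding free_hom_simps[OF h B] scalar_mult ..
  also have "\<dots> \<longleftrightarrow> uq_relations a d q B ?f"
  \<comment> \<open>Conjugation by K_i can be traded for q-commutation with K_i once K_i is known to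
    be invertible. If it is not, both sides are false.\<close>
  proof (cases ?inv)
    case True
    have conj: "?f (GK i) \<otimes>\<^bsub>B\<^esub> ?f x \<otimes>\<^bsub>B\<^esub> ?f (GKinv i) = c \<odot>\<^bsub>B\<^esub> ?f x \<longleftrightarrow>
        ?f (GK i) \<otimes>\<^bsub>B\<^esub> ?f x = c \<odot>\<^bsub>B\<^esub> (?f x \<otimes>\<^bsub>B\<^esub> ?f (GK i))" for i x c
      using True by (intro B.conjugation_iff) simp_all
    have closed: "range ?f \<subseteq> carrier B \<longleftrightarrow> True"
      by auto
    show ?thesis
      unfolding uq_relations_defs conj power_int_minus closed all_conj_distrib
      by (simp only: conj_assoc simp_thms)
  qed (unfold uq_relations_defs, blast)
  finally show ?thesis .
qed

locale cartan_representation = quantum_datum a d q + complex_algebra A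
  for a :: "'i \<Rightarrow> 'i \<Rightarrow> int" and d and q and A :: "(complex, 'b, 'm) module_scheme" (structure)
    and f :: "'i uq_gen \<Rightarrow> 'b" +
  assumes cartan_relations: "uq_cartan_relations a d q A f"
begin

abbreviation "E i \<equiv> f (GE i)"
abbreviation "F i \<equiv> f (GF i)"
abbreviation "K i \<equiv> f (GK i)"
abbreviation "L i \<equiv> f (GKinv i)"

lemma gen_closed [simp]: "f x \<in> carrier A"
  using cartan_relations by (auto simp: uq_cartan_relations_def)

lemma K_L [simp]: "K i \<otimes> L i = \<one>" "L i \<otimes> K i = \<one>"
  and K_K: "K i \<otimes> K j = K j \<otimes> K i"
  and K_E: "K i \<otimes> E j = qa i j \<odot> (E j \<otimes> K i)"
  and K_F: "K i \<otimes> F j = inverse (qa i j) \<odot> (F j \<otimes> K i)"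
  and E_F: "E i \<otimes> F j = F j \<otimes> E i \<oplus> (if i = j then qc i \<odot> (K i \<ominus> L i) else \<zero>)"
  using cartan_relations by (auto simp: uq_cartan_relations_def)

lemma inverse_commutation:
  assumes "x \<in> carrier A" "c \<noteq> 0" "K i \<otimes> x = c \<odot> (x \<otimes> K i)"
  shows "L i \<otimes> x = inverse c \<odot> (x \<otimes> L i)"
proof -
  have "x \<otimes> L i = L i \<otimes> (K i \<otimes> x) \<otimes> L i"
    using assms(1) by (simp flip: m_assoc)
  also have "\<dots> = c \<odot> (L i \<otimes> x)"
    using assms(1) by (simp add: assms(3) smult_mult_left smult_mult_right m_assoc)
  finally show ?thesis using assms by simp
qed

lemma L_E: "L i \<otimes> E j = inverse (qa i j) \<odot> (E j \<otimes> L i)"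
  by (rule inverse_commutation[OF gen_closed qa_nonzero K_E])

lemma L_F: "L i \<otimes> F j = qa i j \<odot> (F j \<otimes> L i)"
  using inverse_commutation[OF _ _ K_F] qa_nonzero[of i j] by simp

lemma L_K: "L i \<otimes> K j = K j \<otimes> L i"
  using inverse_commutation[of "K j" 1 i] by (simp add: K_K)

lemma L_L: "L i \<otimes> L j = L j \<otimes> L i"
  using inverse_commutation[of "L j" 1 i] by (simp add: L_K)

end

locale uq_representation = quantum_datum a d q + complex_algebra A
  for a :: "'i \<Rightarrow> 'i \<Rightarrow> int" and d and q and A :: "(complex, 'b, 'm) module_scheme" (structure)
    and f :: "'i uq_gen \<Rightarrow> 'b" +
  assumes relations: "uq_relations a d q A f"

sublocale uq_representation \<subseteq> cartan_representation
  by unfold_locales (use relations in \<open>simp add: uq_relations_def\<close>)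

lemma (in uq_representation)
  serre_E: "i \<noteq> j \<Longrightarrow> q_serre A (qi i) (serre_order i j) 1 (E i) (E j) = \<zero>" and
  serre_F: "i \<noteq> j \<Longrightarrow> q_serre A (qi i) (serre_order i j) 1 (F i) (F j) = \<zero>"
  using relations by (auto simp: uq_relations_def)

lemma (in quantum_datum) uq_representation_U: "uq_representation a d q U (\<lambda>x. \<iota> (gen x))"
  using uq_relations_iff[OF presented_of_hom complex_algebra_presented q_nonzero, of a d]
    presented_of_eq_zero[of _ "uq_relators a d q"]
  by (intro uq_representation.intro uq_representation_axioms.intro quantum_datum_axioms
      complex_algebra_presented) auto

context uq_representation
begin

lemma free_eval_relators: "r \<in> uq_relators a d q \<Longrightarrow> free_eval A f r = \<zero>"
proof -
  have f: "range f \<subseteq> carrier A" by auto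
  have "uq_relations a d q A (\<lambda>x. free_eval A f (gen x))"
    using relations by (simp add: free_eval_gen[OF f])
  then show "r \<in> uq_relators a d q \<Longrightarrow> free_eval A f r = \<zero>"
    using uq_relations_iff[OF free_eval_hom[OF f] complex_algebra_axioms q_nonzero] by blast
qed

lemma uq_lift_hom: "presented_lift A f \<in> algebra_homs U A"
  by (intro presented_lift_hom complex_algebra_axioms free_eval_relators) auto

lemma uq_lift_gen: "presented_lift A f (\<iota> (gen x)) = f x"
proof -
  have f: "range f \<subseteq> carrier A" by auto
  show ?thesis
    by (subst presented_lift_of[OF f complex_algebra_axioms free_eval_relators])
      (simp_all add: free_eval_gen[OF f])
qed

end

section \<open>Comultiplication, counit and antipode\<close>

lemma (in algebra_pair) left_inclusion_hom: "(\<lambda>x. pure_tensor A B x \<one>\<^bsub>B\<^esub>) \<in> algebra_homs A (tensor A B)"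
  by (intro algebra_homsI linear_mapsI)
    (simp_all add: pure_tensor_add_left pure_tensor_smult_left pure_tensor_mult pure_tensor_one)

lemma (in algebra_pair) right_inclusion_hom: "(\<lambda>y. pure_tensor A B \<one>\<^bsub>A\<^esub> y) \<in> algebra_homs B (tensor A B)"
  by (intro algebra_homsI linear_mapsI)
    (simp_all add: pure_tensor_add_right pure_tensor_smult_right pure_tensor_mult pure_tensor_one)

lemma (in algebra_pair) pure_tensor_zero:
  "y \<in> carrier B \<Longrightarrow> pure_tensor A B \<zero>\<^bsub>A\<^esub> y = \<zero>\<^bsub>tensor A B\<^esub>"
  "x \<in> carrier A \<Longrightarrow> pure_tensor A B x \<zero>\<^bsub>B\<^esub> = \<zero>\<^bsub>tensor A B\<^esub>"
  using pure_tensor_smult_left[of "\<zero>\<^bsub>A\<^esub>" y 0] pure_tensor_smult_right[of x "\<zero>\<^bsub>B\<^esub>" 0] by simp_all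

lemma (in algebra_pair) pure_tensor_minus:
  "x \<in> carrier A \<Longrightarrow> x' \<in> carrier A \<Longrightarrow> y \<in> carrier B \<Longrightarrow>
    pure_tensor A B (x \<ominus>\<^bsub>A\<^esub> x') y = pure_tensor A B x y \<ominus>\<^bsub>tensor A B\<^esub> pure_tensor A B x' y"
  "x \<in> carrier A \<Longrightarrow> y \<in> carrier B \<Longrightarrow> y' \<in> carrier B \<Longrightarrow>
    pure_tensor A B x (y \<ominus>\<^bsub>B\<^esub> y') = pure_tensor A B x y \<ominus>\<^bsub>tensor A B\<^esub> pure_tensor A B x y'"
  by (simp_all add: A.minus_eq B.minus_eq T.minus_eq pure_tensor_add_left pure_tensor_add_right
      pure_tensor_smult_left pure_tensor_smult_right
      flip: A.smul_minus_one B.smul_minus_one T.smul_minus_one)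

lemma (in abelian_group) minus_add_minus:
  "x \<in> carrier G \<Longrightarrow> y \<in> carrier G \<Longrightarrow> z \<in> carrier G \<Longrightarrow> (x \<ominus> y) \<oplus> (y \<ominus> z) = x \<ominus> z"
  by (simp add: minus_eq a_assoc r_neg1)

lemma power_cancel:
  fixes x :: "'a :: field" assumes "x \<noteq> 0"
  shows "x * x ^ m * inverse x * inverse (x ^ m) = 1"
    and "inverse x * inverse (x ^ m) * x = inverse (x ^ m)"
  using assms by (simp_all add: field_simps)

context uq_representation
begin

interpretation AA: algebra_pair A A by unfold_locales

abbreviation "P \<equiv> pure_tensor A A"
abbreviation "T \<equiv> tensor A A"

text \<open>Formed from an arbitrary representation in A, so that it is available for every record
  in which the relations of \<open>U_q\<close> hold.\<close>

fun comult_gen :: "'i uq_gen \<Rightarrow> (('b \<times> 'b) \<Rightarrow>\<^sub>0 complex) set" where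
  "comult_gen (GE i) = P (E i) (K i) \<oplus>\<^bsub>T\<^esub> P \<one> (E i)"
| "comult_gen (GF i) = P (F i) \<one> \<oplus>\<^bsub>T\<^esub> P (L i) (F i)"
| "comult_gen (GK i) = P (K i) (K i)"
| "comult_gen (GKinv i) = P (L i) (L i)"

text \<open>Write \<Delta>(E_i) as x + y with x = E_i \<otimes> K_i and y = 1 \<otimes> E_i. On the
  target E_j \<otimes> K_j the part y contributes nothing, on 1 \<otimes> E_j the part x contributes
  nothing, and the two remaining terms vanish by the Serre relation in A. The q-commutation factors
  fit because q_i^(a_ij) = q_i^(1-n) for the order n = 1 - a_ij.\<close>

lemma q_serre_comult_E:
  assumes "i \<noteq> j"
  shows "q_serre T (qi i) (serre_order i j) 1 (comult_gen (GE i)) (comult_gen (GE j)) = \<zero>\<^bsub>T\<^esub>"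
proof -
  let ?n = "serre_order i j" and ?m = "nat (- a i j)"
  let ?x = "P (E i) (K i)" and ?y = "P \<one> (E i)" and ?x' = "P (E j) (K j)" and ?y' = "P \<one> (E j)"
  have n: "?n = Suc ?m" using assms by (rule serre_order_Suc)
  have qa: "qa i j = inverse (qi i ^ ?m)" using assms by (rule qa_off_diagonal)
  have nz: "qi i \<noteq> 0" by (rule qi_nonzero)
  have yx: "?y \<otimes>\<^bsub>T\<^esub> ?x = inverse (qi i) ^ 2 \<odot>\<^bsub>T\<^esub> (?x \<otimes>\<^bsub>T\<^esub> ?y)"
    using nz
    by (simp add: AA.pure_tensor_mult K_E qa_diagonal AA.pure_tensor_smult_right power_inverse
        del: power_int_mult)
  \<comment> \<open>The factor is q_i^(-a_ij) = q_i^(n-1), the parameter of the innermost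
    q-commutator, as \<open>q_serre_add_left\<close> demands.\<close>
  have yx': "?y \<otimes>\<^bsub>T\<^esub> ?x' = (1 * qi i ^ ?n * inverse (qi i)) \<odot>\<^bsub>T\<^esub> (?x' \<otimes>\<^bsub>T\<^esub> ?y)"
    using power_cancel(1)[OF nz, of ?m]
    by (simp add: AA.pure_tensor_mult K_E qa_commute[of j i] qa AA.pure_tensor_smult_right n)
  have xy: "?x \<otimes>\<^bsub>T\<^esub> ?y = (qi i) ^ 2 \<odot>\<^bsub>T\<^esub> (?y \<otimes>\<^bsub>T\<^esub> ?x)"
    by (simp add: AA.pure_tensor_mult K_E qa_diagonal AA.pure_tensor_smult_right)
  have xy': "?x \<otimes>\<^bsub>T\<^esub> ?y' = (1 * inverse (qi i) ^ ?n * qi i) \<odot>\<^bsub>T\<^esub> (?y' \<otimes>\<^bsub>T\<^esub> ?x)"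
    by (simp add: power_cancel(2)[OF nz] AA.pure_tensor_mult K_E qa AA.pure_tensor_smult_right n power_inverse)
  \<comment> \<open>Splitting off the factors 1 \<otimes> K, which commute with E \<otimes> 1,
    allows \<open>q_serre_factor\<close> with all scalars equal to 1.\<close>
  have fx: "?x = P (E i) \<one> \<otimes>\<^bsub>T\<^esub> P \<one> (K i)" "?x' = P (E j) \<one> \<otimes>\<^bsub>T\<^esub> P \<one> (K j)"
    by (simp_all add: AA.pure_tensor_mult)
  have "q_serre T (qi i) ?n 1 (P (E i) \<one>) (P (E j) \<one>) = \<zero>\<^bsub>T\<^esub>"
    using q_serre_hom(2)[OF AA.left_inclusion_hom complex_algebra_axioms, of "E i" "E j" "qi i" ?n 1]
    by (simp add: serre_E[OF assms] AA.pure_tensor_zero)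
  moreover obtain p where "p \<in> carrier T"
    "q_serre T (qi i) ?n 1 ?x ?x' = q_serre T (qi i) ?n 1 (P (E i) \<one>) (P (E j) \<one>) \<otimes>\<^bsub>T\<^esub> p"
    using AA.T.q_serre_factor[of "P (E i) \<one>" "P (E j) \<one>" "P \<one> (K i)" "P \<one> (K j)" 1 1 "qi i" ?n 1]
    unfolding fx by (auto simp: AA.pure_tensor_mult K_K)
  ultimately have 1: "q_serre T (qi i) ?n 1 ?x ?x' = \<zero>\<^bsub>T\<^esub>" by simp
  have 2: "q_serre T (qi i) ?n 1 ?y ?y' = \<zero>\<^bsub>T\<^esub>"
    using q_serre_hom(2)[OF AA.right_inclusion_hom complex_algebra_axioms, of "E i" "E j" "qi i" ?n 1]
    by (simp add: serre_E[OF assms] AA.pure_tensor_zero)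
  have "q_serre T (qi i) ?n 1 (?x \<oplus>\<^bsub>T\<^esub> ?y) (?x' \<oplus>\<^bsub>T\<^esub> ?y') =
      q_serre T (qi i) ?n 1 ?x ?x' \<oplus>\<^bsub>T\<^esub> q_serre T (qi i) ?n 1 ?y ?y'"
    using AA.T.q_serre_add_left[OF _ _ _ nz yx yx'] AA.T.q_serre_add_right[OF _ _ _ nz xy xy']
    by (simp add: AA.T.q_serre_add)
  then show ?thesis by (simp add: 1 2)
qed

text \<open>The argument for E with the tensor legs exchanged: here x = K_i^-1 \<otimes> F_i carries
  the grouplike factor, in its left leg, and y = F_i \<otimes> 1.\<close>

lemma q_serre_comult_F:
  assumes "i \<noteq> j"
  shows "q_serre T (qi i) (serre_order i j) 1 (comult_gen (GF i)) (comult_gen (GF j)) = \<zero>\<^bsub>T\<^esub>"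
proof -
  let ?n = "serre_order i j" and ?m = "nat (- a i j)"
  let ?y = "P (F i) \<one>" and ?x = "P (L i) (F i)" and ?y' = "P (F j) \<one>" and ?x' = "P (L j) (F j)"
  have n: "?n = Suc ?m" using assms by (rule serre_order_Suc)
  have qa: "qa i j = inverse (qi i ^ ?m)" using assms by (rule qa_off_diagonal)
  have nz: "qi i \<noteq> 0" by (rule qi_nonzero)
  have yx: "?y \<otimes>\<^bsub>T\<^esub> ?x = inverse (qi i) ^ 2 \<odot>\<^bsub>T\<^esub> (?x \<otimes>\<^bsub>T\<^esub> ?y)"
    using nz
    by (simp add: AA.pure_tensor_mult L_F qa_diagonal AA.pure_tensor_smult_left power_inverse)
  have yx': "?y \<otimes>\<^bsub>T\<^esub> ?x' = (1 * qi i ^ ?n * inverse (qi i)) \<odot>\<^bsub>T\<^esub> (?x' \<otimes>\<^bsub>T\<^esub> ?y)"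
    using power_cancel(1)[OF nz, of ?m]
    by (simp add: AA.pure_tensor_mult L_F qa_commute[of j i] qa AA.pure_tensor_smult_left n)
  have xy: "?x \<otimes>\<^bsub>T\<^esub> ?y = (qi i) ^ 2 \<odot>\<^bsub>T\<^esub> (?y \<otimes>\<^bsub>T\<^esub> ?x)"
    by (simp add: AA.pure_tensor_mult L_F qa_diagonal AA.pure_tensor_smult_left)
  have xy': "?x \<otimes>\<^bsub>T\<^esub> ?y' = (1 * inverse (qi i) ^ ?n * qi i) \<odot>\<^bsub>T\<^esub> (?y' \<otimes>\<^bsub>T\<^esub> ?x)"
    by (simp add: power_cancel(2)[OF nz] AA.pure_tensor_mult L_F qa AA.pure_tensor_smult_left n power_inverse)
  have fx: "?x = P \<one> (F i) \<otimes>\<^bsub>T\<^esub> P (L i) \<one>" "?x' = P \<one> (F j) \<otimes>\<^bsub>T\<^esub> P (L j) \<one>"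
    by (simp_all add: AA.pure_tensor_mult)
  have "q_serre T (qi i) ?n 1 (P \<one> (F i)) (P \<one> (F j)) = \<zero>\<^bsub>T\<^esub>"
    using q_serre_hom(2)[OF AA.right_inclusion_hom complex_algebra_axioms, of "F i" "F j" "qi i" ?n 1]
    by (simp add: serre_F[OF assms] AA.pure_tensor_zero)
  moreover obtain p where "p \<in> carrier T"
    "q_serre T (qi i) ?n 1 ?x ?x' = q_serre T (qi i) ?n 1 (P \<one> (F i)) (P \<one> (F j)) \<otimes>\<^bsub>T\<^esub> p"
    using AA.T.q_serre_factor[of "P \<one> (F i)" "P \<one> (F j)" "P (L i) \<one>" "P (L j) \<one>" 1 1 "qi i" ?n 1]
    unfolding fx by (auto simp: AA.pure_tensor_mult L_L)
  ultimately have 1: "q_serre T (qi i) ?n 1 ?x ?x' = \<zero>\<^bsub>T\<^esub>" by simp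
  have 2: "q_serre T (qi i) ?n 1 ?y ?y' = \<zero>\<^bsub>T\<^esub>"
    using q_serre_hom(2)[OF AA.left_inclusion_hom complex_algebra_axioms, of "F i" "F j" "qi i" ?n 1]
    by (simp add: serre_F[OF assms] AA.pure_tensor_zero)
  have "q_serre T (qi i) ?n 1 (?x \<oplus>\<^bsub>T\<^esub> ?y) (?x' \<oplus>\<^bsub>T\<^esub> ?y') =
      q_serre T (qi i) ?n 1 ?x ?x' \<oplus>\<^bsub>T\<^esub> q_serre T (qi i) ?n 1 ?y ?y'"
    using AA.T.q_serre_add_left[OF _ _ _ nz yx yx'] AA.T.q_serre_add_right[OF _ _ _ nz xy xy']
    by (simp add: AA.T.q_serre_add)
  then show ?thesis by (simp add: 1 2 AA.T.a_comm[of "P (F _) \<one>"])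
qed

lemma comult_gen_commutator:
  "comult_gen (GE i) \<otimes>\<^bsub>T\<^esub> comult_gen (GF j) = comult_gen (GF j) \<otimes>\<^bsub>T\<^esub> comult_gen (GE i) \<oplus>\<^bsub>T\<^esub>
    (if i = j then qc i \<odot>\<^bsub>T\<^esub> (comult_gen (GK i) \<ominus>\<^bsub>T\<^esub> comult_gen (GKinv i)) else \<zero>\<^bsub>T\<^esub>)"
proof -
  have EL: "E i \<otimes> L j = qa i j \<odot> (L j \<otimes> E i)"
    using L_E[of j i] qa_nonzero[of j i] by (simp add: qa_commute[of i j])
  \<comment> \<open>The scalars from moving E_i past K_j^-1 on the left and K_i past F_j on the
    right are inverse to each other, so the mixed terms cancel in the commutator.\<close>
  have middle: "P (E i \<otimes> L j) (K i \<otimes> F j) = P (L j \<otimes> E i) (F j \<otimes> K i)"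
    using qa_nonzero[of i j]
    by (simp add: EL K_F AA.pure_tensor_smult_left AA.pure_tensor_smult_right)
  define c where "c = (if i = j then qc i \<odot> (K i \<ominus> L i) else \<zero>)"
  have c: "c \<in> carrier A" by (simp add: c_def)
  have EF: "E i \<otimes> F j = F j \<otimes> E i \<oplus> c"
    unfolding c_def by (rule E_F)
  have "comult_gen (GE i) \<otimes>\<^bsub>T\<^esub> comult_gen (GF j) =
      comult_gen (GF j) \<otimes>\<^bsub>T\<^esub> comult_gen (GE i) \<oplus>\<^bsub>T\<^esub> (P c (K i) \<oplus>\<^bsub>T\<^esub> P (L j) c)"
    using c
    by (simp add: AA.T.l_distr AA.T.r_distr AA.pure_tensor_mult middle EF AA.pure_tensor_add_left
        AA.pure_tensor_add_right AA.T.a_ac)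
  \<comment> \<open>For i = j this telescopes: (K - K^-1) \<otimes> K + K^-1 \<otimes> (K - K^-1) =
    K \<otimes> K - K^-1 \<otimes> K^-1.\<close>
  also have "P c (K i) \<oplus>\<^bsub>T\<^esub> P (L j) c =
    (if i = j then qc i \<odot>\<^bsub>T\<^esub> (comult_gen (GK i) \<ominus>\<^bsub>T\<^esub> comult_gen (GKinv i)) else \<zero>\<^bsub>T\<^esub>)"
    by (simp add: c_def AA.pure_tensor_smult_left AA.pure_tensor_smult_right AA.pure_tensor_minus
        AA.pure_tensor_zero AA.T.minus_add_minus flip: AA.T.smul_add_right)
  finally show ?thesis .
qed

lemma comult_representation: "uq_representation a d q T comult_gen"
proof (intro uq_representation.intro uq_representation_axioms.intro quantum_datum_axioms
    AA.complex_algebra_tensor)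
  have "comult_gen x \<in> carrier T" for x
    by (cases x) simp_all
  then have closed: "range comult_gen \<subseteq> carrier T" by auto
  show "uq_relations a d q T comult_gen"
    unfolding uq_relations_defs
  proof (intro conjI allI impI closed)
    fix i j
    show "comult_gen (GK i) \<otimes>\<^bsub>T\<^esub> comult_gen (GE j) =
        qa i j \<odot>\<^bsub>T\<^esub> (comult_gen (GE j) \<otimes>\<^bsub>T\<^esub> comult_gen (GK i))"
      by (simp add: AA.T.l_distr AA.T.r_distr AA.pure_tensor_mult K_E K_K[of i j]
          AA.pure_tensor_smult_left AA.pure_tensor_smult_right AA.T.smul_add_right)
    show "comult_gen (GK i) \<otimes>\<^bsub>T\<^esub> comult_gen (GF j) =
        inverse (qa i j) \<odot>\<^bsub>T\<^esub> (comult_gen (GF j) \<otimes>\<^bsub>T\<^esub> comult_gen (GK i))"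
      by (simp add: AA.T.l_distr AA.T.r_distr AA.pure_tensor_mult K_F L_K
          AA.pure_tensor_smult_left AA.pure_tensor_smult_right AA.T.smul_add_right)
    show "comult_gen (GE i) \<otimes>\<^bsub>T\<^esub> comult_gen (GF j) =
      comult_gen (GF j) \<otimes>\<^bsub>T\<^esub> comult_gen (GE i) \<oplus>\<^bsub>T\<^esub>
      (if i = j then qc i \<odot>\<^bsub>T\<^esub> (comult_gen (GK i) \<ominus>\<^bsub>T\<^esub> comult_gen (GKinv i)) else \<zero>\<^bsub>T\<^esub>)"
      by (rule comult_gen_commutator)
  next
    fix i j :: 'i assume "i \<noteq> j"
    then show "q_serre T (qi i) (serre_order i j) 1 (comult_gen (GE i)) (comult_gen (GE j)) = \<zero>\<^bsub>T\<^esub>"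
      and "q_serre T (qi i) (serre_order i j) 1 (comult_gen (GF i)) (comult_gen (GF j)) = \<zero>\<^bsub>T\<^esub>"
      by (rule q_serre_comult_E q_serre_comult_F)+
  qed (simp_all add: AA.pure_tensor_mult AA.pure_tensor_one K_K)
qed

section \<open>The antipode as a representation in the opposite algebra\<close>

fun antipode_gen :: "'i uq_gen \<Rightarrow> 'b" where
  "antipode_gen (GE i) = \<ominus> (E i \<otimes> L i)"
| "antipode_gen (GF i) = \<ominus> (K i \<otimes> F i)"
| "antipode_gen (GK i) = L i"
| "antipode_gen (GKinv i) = K i"

interpretation Op: complex_algebra "opposite_algebra A"
  by (rule complex_algebra_opposite)

lemma opposite_minus: "x \<in> carrier A \<Longrightarrow> y \<in> carrier A \<Longrightarrow> x \<ominus>\<^bsub>opposite_algebra A\<^esub> y = x \<ominus> y"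
  using Op.smul_minus_one[of y] smul_minus_one[of y]
  by (simp add: Op.minus_eq minus_eq)

text \<open>Up to scalars S(E_i) and S(F_i) have the form x k with k a power of K_i. Passing to the
  opposite algebra costs a scalar, the factors k and l cost a factor on the right, and rescaling
  costs another scalar; each of these preserves a vanishing Serre element.\<close>

lemma q_serre_antipode:
  assumes x: "x \<in> carrier A" "z \<in> carrier A" "k \<in> carrier A" "l \<in> carrier A" and nz: "p \<noteq> 0"
    and kx: "k \<otimes> x = c \<odot> (x \<otimes> k)" and kz: "k \<otimes> z = w \<odot> (z \<otimes> k)"
    and lx: "l \<otimes> x = w \<odot> (x \<otimes> l)" and kl: "k \<otimes> l = l \<otimes> k"
    and zero: "q_serre A p n 1 x z = \<zero>"
  shows "q_serre (opposite_algebra A) p n 1 (b \<odot> (x \<otimes> k)) (b' \<odot> (z \<otimes> l)) = \<zero>"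
proof -
  obtain r where r: "r \<in> carrier A" "q_serre A p n 1 (x \<otimes> k) (z \<otimes> l) = \<zero> \<otimes> r"
    using q_serre_factor[OF x kx kz lx kl, of p n 1] zero by auto
  obtain c where "q_serre (opposite_algebra A) p n 1 (b \<odot> (x \<otimes> k)) (b' \<odot> (z \<otimes> l)) =
    c \<odot> q_serre A p n (inverse 1) (b \<odot> (x \<otimes> k)) (b' \<odot> (z \<otimes> l))"
    using q_serre_opposite[of "b \<odot> (x \<otimes> k)" "b' \<odot> (z \<otimes> l)" p 1 n] x nz by auto
  then show ?thesis
    using x r by (simp add: q_serre_smult q_serre_smult_left)
qed

lemma antipode_representation: "uq_representation a d q (opposite_algebra A) antipode_gen"
proof (intro uq_representation.intro uq_representation_axioms.intro quantum_datum_axioms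
    complex_algebra_opposite)
  have "antipode_gen x \<in> carrier (opposite_algebra A)" for x
    by (cases x) simp_all
  then have closed: "range antipode_gen \<subseteq> carrier (opposite_algebra A)" by auto
  have KF: "K i \<otimes> F i = (inverse (qa i i)) \<odot> (F i \<otimes> K i)" for i
    by (rule K_F)
  show "uq_relations a d q (opposite_algebra A) antipode_gen"
    unfolding uq_relations_defs
  proof (intro conjI allI impI closed)
    fix i j
    have "L i \<otimes> (E j \<otimes> L j) = inverse (qa i j) \<odot> (E j \<otimes> L j \<otimes> L i)"
    proof -
      have "L i \<otimes> (E j \<otimes> L j) = (L i \<otimes> E j) \<otimes> L j" by (simp add: m_assoc)
      then show ?thesis by (simp add: L_E smult_mult_left m_assoc L_L[of i j])
    qed
    then show "antipode_gen (GK i) \<otimes>\<^bsub>opposite_algebra A\<^esub> antipode_gen (GE j) = qa i j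
        \<odot>\<^bsub>opposite_algebra A\<^esub> (antipode_gen (GE j) \<otimes>\<^bsub>opposite_algebra A\<^esub> antipode_gen (GK i))"
      using qa_nonzero[of i j]
      by (simp add: smult_mult_left smult_mult_right flip: smul_minus_one)
    have "L i \<otimes> (K j \<otimes> F j) = qa i j \<odot> (K j \<otimes> F j \<otimes> L i)"
    proof -
      have "L i \<otimes> (K j \<otimes> F j) = K j \<otimes> (L i \<otimes> F j)" by (simp add: L_K flip: m_assoc)
      then show ?thesis by (simp add: L_F smult_mult_right m_assoc)
    qed
    then show "antipode_gen (GK i) \<otimes>\<^bsub>opposite_algebra A\<^esub> antipode_gen (GF j) = inverse (qa i j)
        \<odot>\<^bsub>opposite_algebra A\<^esub> (antipode_gen (GF j) \<otimes>\<^bsub>opposite_algebra A\<^esub> antipode_gen (GK i))"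
      using qa_nonzero[of i j]
      by (simp add: smult_mult_left smult_mult_right flip: smul_minus_one)
  next
    fix i j :: 'i assume "i \<noteq> j"
    show "q_serre (opposite_algebra A) (qi i) (serre_order i j) 1 (antipode_gen (GE i))
        (antipode_gen (GE j)) = \<zero>\<^bsub>opposite_algebra A\<^esub>"
      using q_serre_antipode[OF _ _ _ _ qi_nonzero L_E L_E _ L_L serre_E[OF \<open>i \<noteq> j\<close>],
          where b = "-1" and b' = "-1"]
        L_E[of j i]
      by (simp add: qa_commute[of j i] smul_minus_one)
    \<comment> \<open>The coefficients come from S(F_i) = - K_i F_i = - q_i^(-a_ii) F_i K_i, which
      puts S(F_i) into the form x k.\<close>
    have "q_serre (opposite_algebra A) (qi i) (serre_order i j) 1
        ((- inverse (qa i i)) \<odot> (F i \<otimes> K i)) ((- inverse (qa j j)) \<odot> (F j \<otimes> K j)) = \<zero>"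
      by (rule q_serre_antipode[OF _ _ _ _ qi_nonzero K_F K_F _ K_K serre_F[OF \<open>i \<noteq> j\<close>]])
        (simp_all add: K_F[of j i] qa_commute[of j i])
    then show "q_serre (opposite_algebra A) (qi i) (serre_order i j) 1 (antipode_gen (GF i))
        (antipode_gen (GF j)) = \<zero>\<^bsub>opposite_algebra A\<^esub>"
      by (simp add: KF smul_uminus_left)
  next
    fix i j
    define c where "c = (if i = j then qc i \<odot> (K i \<ominus> L i) else \<zero>)"
    have c: "c \<in> carrier A" by (simp add: c_def)
    have EF: "E i \<otimes> F j = F j \<otimes> E i \<oplus> c"
      unfolding c_def by (rule E_F)
    have EK: "E i \<otimes> K j = inverse (qa i j) \<odot> (K j \<otimes> E i)"
      using K_E[of j i] qa_nonzero[of j i] by (simp add: qa_commute[of i j])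
    have "(E i \<otimes> L i) \<otimes> (K j \<otimes> F j) = (E i \<otimes> K j) \<otimes> (L i \<otimes> F j)"
    proof -
      have "L i \<otimes> (K j \<otimes> F j) = K j \<otimes> (L i \<otimes> F j)" by (simp add: L_K flip: m_assoc)
      then show ?thesis by (simp add: m_assoc)
    qed
    \<comment> \<open>The two scalars cancel, and E_i F_j appears in the middle, where its
      commutation relation can be inserted.\<close>
    also have "\<dots> = K j \<otimes> (E i \<otimes> F j) \<otimes> L i"
      using qa_nonzero[of i j] by (simp add: EK L_F smult_mult_left smult_mult_right m_assoc)
    also have "\<dots> = (K j \<otimes> F j) \<otimes> (E i \<otimes> L i) \<oplus> K j \<otimes> c \<otimes> L i"
      using c by (simp add: EF r_distr l_distr m_assoc)
    finally have eq: "(E i \<otimes> L i) \<otimes> (K j \<otimes> F j) = (K j \<otimes> F j) \<otimes> (E i \<otimes> L i) \<oplus> K j \<otimes> c \<otimes> L i" .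
    \<comment> \<open>The element c is zero or, for i = j, a combination of K_i and K_i^-1, which
      conjugation by K_i fixes.\<close>
    have KcL: "K j \<otimes> c \<otimes> L i = c"
    proof (cases "i = j")
      case True
      have "K i \<otimes> (K i \<ominus> L i) \<otimes> L i = K i \<ominus> L i"
        by (simp add: minus_eq r_distr l_distr m_assoc r_minus l_minus)
      with True show ?thesis by (simp add: c_def smult_mult_left smult_mult_right)
    qed (simp add: c_def)
    have "(K j \<otimes> F j) \<otimes> (E i \<otimes> L i) = (E i \<otimes> L i) \<otimes> (K j \<otimes> F j) \<oplus> \<ominus> c"
      using c by (simp add: eq KcL a_assoc r_neg)
    moreover have "\<ominus> c = (if i = j then qc i \<odot> (L i \<ominus> K i) else \<zero>)"
    proof -
      have "\<ominus> (K k \<ominus> L k) = L k \<ominus> K k" for k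
        by (simp add: minus_eq minus_add a_comm)
      then show ?thesis by (simp add: c_def flip: smul_uminus_right)
    qed
    ultimately show "antipode_gen (GE i) \<otimes>\<^bsub>opposite_algebra A\<^esub> antipode_gen (GF j) =
        antipode_gen (GF j) \<otimes>\<^bsub>opposite_algebra A\<^esub> antipode_gen (GE i) \<oplus>\<^bsub>opposite_algebra A\<^esub>
        (if i = j then qc i \<odot>\<^bsub>opposite_algebra A\<^esub>
          (antipode_gen (GK i) \<ominus>\<^bsub>opposite_algebra A\<^esub> antipode_gen (GKinv i))
         else \<zero>\<^bsub>opposite_algebra A\<^esub>)"
      by (simp add: l_minus r_minus opposite_minus)
  qed (simp_all add: L_L)
qed

end

lemma (in quantum_datum) counit_representation: "uq_representation a d q complex_field uq_counit_gen"
proof (intro uq_representation.intro uq_representation_axioms.intro quantum_datum_axioms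
    complex_algebra_complex_field)
  interpret C: complex_algebra complex_field by (rule complex_algebra_complex_field)
  have zero: "q_serre complex_field p n t 0 0 = 0" for p n t
    using C.q_serre_zero[of 0 p n t] by simp
  have "(1 :: complex) \<ominus>\<^bsub>complex_field\<^esub> 1 = 0"
    using C.r_neg[of 1] by (simp add: C.minus_eq)
  then show "uq_relations a d q complex_field uq_counit_gen"
    unfolding uq_relations_defs by (simp add: zero)
qed

section \<open>The Hopf algebra structure\<close>

text \<open>Meant for the antipode axioms: the convolution of S with the identity is not known to be
  an algebra homomorphism, so comparison on generators is not enough, and a product is built up one
  generator at a time.\<close>

lemma presented_induct [consumes 1, case_names one gen add smult]:
  assumes X: "X \<in> carrier (presented R)"
    and one: "P \<one>\<^bsub>presented R\<^esub>"
    and gen: "\<And>x Y. Y \<in> carrier (presented R) \<Longrightarrow> P Y \<Longrightarrow>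
      P (presented_of R (gen x) \<otimes>\<^bsub>presented R\<^esub> Y)"
    and add: "\<And>Y Z. Y \<in> carrier (presented R) \<Longrightarrow> Z \<in> carrier (presented R) \<Longrightarrow> P Y \<Longrightarrow> P Z \<Longrightarrow>
      P (Y \<oplus>\<^bsub>presented R\<^esub> Z)"
    and smult: "\<And>c Y. Y \<in> carrier (presented R) \<Longrightarrow> P Y \<Longrightarrow> P (c \<odot>\<^bsub>presented R\<^esub> Y)"
  shows "P X"
proof -
  obtain p where p: "X = presented_of R p" using X by (auto simp: presented_carrier)
  have word: "P (presented_of R (Poly_Mapping.single (Word xs) 1))" for xs
  proof (induction xs)
    case Nil
    have "Poly_Mapping.single (Word []) 1 = (1 :: 'a free_alg)"
      by (simp flip: zero_free_word_def)
    then show ?case using one by (simp add: presented_of_simps)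
  next
    case (Cons x xs)
    have "Poly_Mapping.single (Word (x # xs)) 1 = gen x * Poly_Mapping.single (Word xs) (1 :: complex)"
      by (simp add: gen_def mult_single plus_free_word_def)
    then show ?case
      using gen[OF presented_of_closed Cons] by (simp add: presented_of_simps)
  qed
  have single: "P (presented_of R (Poly_Mapping.single w c))" for w c
    using smult[OF presented_of_closed word[of "letters w"], of c]
    by (simp flip: presented_of_simps(4))
  have "Poly_Mapping.keys p \<subseteq> UNIV" by simp
  then have "P (presented_of R p)"
  proof (induction p rule: formal_sum_induct)
    case zero
    then show ?case using single[of 0 0] by simp
  qed (simp_all add: single add presented_of_simps(2))
  with p show ?thesis by simp
qed

lemma id_algebra_hom: "id \<in> algebra_homs A A"
  using algebra_homs_id[of A] by (simp add: id_def)

context quantum_datum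
begin

abbreviation "H \<equiv> uq a d q"

lemma uq_alg_eq: "uq_alg a d q = U" and uq_of_eq: "uq_of a d q = \<iota>"
  by (simp_all add: uq_alg_def uq_of_def uq_ideal_def presented_def presented_of_def fun_eq_iff)

lemma uq_sel:
  "carrier H = carrier U" "mult H = mult U" "one H = one U" "zero H = zero U" "add H = add U"
  "smult H = smult U"
  "comult H = presented_lift (tensor U U) (uq_comult_gen a d q)"
  "counit H = presented_lift complex_field uq_counit_gen"
  "antipode H = presented_lift (opposite_algebra U) (\<lambda>x. \<iota> (uq_antipode_gen x))"
  by (simp_all add: uq_def module.defs hopf_data.defs uq_alg_eq uq_of_eq)

lemma uq_algebra_homs: "algebra_homs H X = algebra_homs U X" "algebra_homs Y H = algebra_homs Y U"
  by (simp_all add: algebra_homs_def linear_maps_def ring_hom_def uq_sel)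

lemma tensor_uq: "tensor H H = tensor U U" "pure_tensor H H = pure_tensor U U"
  by (rule tensor_cong; simp add: uq_sel)+

lemma complex_algebra_uq: "complex_algebra H"
  by (rule complex_algebra_cong[OF complex_algebra_presented[of "uq_relators a d q"]])
    (simp_all add: uq_sel)

sublocale H: complex_algebra H
  by (rule complex_algebra_uq)

sublocale HH: algebra_pair H H
  by unfold_locales

sublocale UU: uq_representation a d q U "\<lambda>x. \<iota> (gen x)"
  by (rule uq_representation_U)

lemma gen_closed [simp]: "\<iota> x \<in> carrier H"
  by (simp add: uq_sel)

lemma uq_homs_eqI:
  assumes "f \<in> algebra_homs H B" "g \<in> algebra_homs H B" "\<And>x. f (\<iota> (gen x)) = g (\<iota> (gen x))"
    "complex_algebra B" "X \<in> carrier H"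
  shows "f X = g X"
  by (rule presented_homs_eqI[OF assms(1,2)[unfolded uq_algebra_homs] assms(3,4)
        assms(5)[unfolded uq_sel(1)]])

text \<open>The same generators in two records: \<open>UU\<close> refers to the algebra over which
  the antipode is defined, \<open>R\<close> to the Hopf record in which the axioms are
  stated.\<close>

sublocale R: uq_representation a d q H "\<lambda>x. \<iota> (gen x)"
proof (intro uq_representation.intro uq_representation_axioms.intro quantum_datum_axioms
    complex_algebra_uq)
  have hom: "\<iota> \<in> algebra_homs free_algebra H"
    by (simp add: uq_algebra_homs presented_of_hom)
  have "\<forall>r\<in>uq_relators a d q. \<iota> r = \<zero>\<^bsub>H\<^esub>"
    by (simp add: presented_of_eq_zero uq_sel)
  then show "uq_relations a d q H (\<lambda>x. \<iota> (gen x))"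
    by (simp add: uq_relations_iff[OF hom complex_algebra_uq q_nonzero])
qed

lemma comult_gen_eq: "uq_comult_gen a d q = R.comult_gen"
proof
  fix x show "uq_comult_gen a d q x = R.comult_gen x"
    by (cases x)
      (simp_all add: Let_def tensor_uq uq_alg_eq uq_of_eq presented_of_simps uq_sel)
qed

sublocale comult_rep: uq_representation a d q "tensor H H" R.comult_gen
  by (rule R.comult_representation)

sublocale counit_rep: uq_representation a d q complex_field uq_counit_gen
  by (rule counit_representation)

section \<open>The structure maps and the Hopf axioms\<close>

lemma comult_algebra_hom: "comult H \<in> algebra_homs H (tensor H H)"
  and comult_gen: "comult H (\<iota> (gen x)) = R.comult_gen x"
  using comult_rep.uq_lift_hom comult_rep.uq_lift_gen[of x]
  by (simp_all add: uq_sel(7) comult_gen_eq uq_algebra_homs tensor_uq)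

lemma counit_algebra_hom: "counit H \<in> algebra_homs H complex_field"
  and counit_gen: "counit H (\<iota> (gen x)) = uq_counit_gen x"
  using counit_rep.uq_lift_hom counit_rep.uq_lift_gen[of x]
  by (simp_all add: uq_sel(8) uq_algebra_homs)

text \<open>The signs in the antipode are additive inverses taken in two different records, so their
  agreement has to be checked.\<close>

lemma antipode_gen_uq: "UU.antipode_gen = R.antipode_gen"
proof
  have "a_inv H = a_inv U"
    by (simp add: fun_eq_iff a_inv_def m_inv_def uq_sel)
  then show "UU.antipode_gen x = R.antipode_gen x" for x
    by (cases x) (simp_all add: uq_sel)
qed

lemma antipode_gen_eq: "(\<lambda>x. \<iota> (uq_antipode_gen x)) = UU.antipode_gen"
proof
  fix x show "\<iota> (uq_antipode_gen x) = UU.antipode_gen x"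
    by (cases x) (simp_all add: presented_of_simps)
qed

lemma antipode_algebra_hom: "antipode H \<in> algebra_homs H (opposite_algebra H)"
  and antipode_gen: "antipode H (\<iota> (gen x)) = R.antipode_gen x"
proof -
  interpret S: uq_representation a d q "opposite_algebra U" UU.antipode_gen
    by (rule UU.antipode_representation)
  have "algebra_homs H (opposite_algebra H) = algebra_homs U (opposite_algebra U)"
    by (simp add: algebra_homs_def linear_maps_def ring_hom_def uq_sel)
  then show "antipode H \<in> algebra_homs H (opposite_algebra H)"
    using S.uq_lift_hom by (simp add: uq_sel(9) antipode_gen_eq)
  show "antipode H (\<iota> (gen x)) = R.antipode_gen x"
    using S.uq_lift_gen[of x] by (simp add: uq_sel(9) antipode_gen_eq flip: antipode_gen_uq)
qed

lemmas antipode_simps = algebra_homs_simps[OF antipode_algebra_hom, unfolded opposite_algebra_sel]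

text \<open>Both sides are composites of algebra homomorphisms, so agreement on generators suffices.
  The two counit axioms follow in the same way.\<close>

lemma uq_coassociative:
  assumes "x \<in> carrier H"
  shows "tensor_assoc H H H (tensor_map (tensor H H) H (comult H) id (comult H x)) =
    tensor_map H (tensor H H) id (comult H) (comult H x)"
proof (rule uq_homs_eqI[OF _ _ _ _ assms])
  note alg = complex_algebra_uq HH.complex_algebra_tensor
  interpret TH: algebra_pair "tensor H H" H by unfold_locales
  interpret HT: algebra_pair H "tensor H H" by unfold_locales
  note hom1 = tensor_map_hom[OF alg(1) alg(1) alg(2) alg(1) comult_algebra_hom id_algebra_hom]
  note hom2 = tensor_map_hom[OF alg(1) alg(1) alg(1) alg(2) id_algebra_hom comult_algebra_hom]
  note assoc = tensor_assoc_hom[OF alg(1) alg(1) alg(1)]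
  show "(\<lambda>x. tensor_assoc H H H (tensor_map (tensor H H) H (comult H) id (comult H x)))
      \<in> algebra_homs H (tensor H (tensor H H))"
    by (rule algebra_homs_comp[OF comult_algebra_hom algebra_homs_comp[OF hom1 assoc]])
  show "(\<lambda>x. tensor_map H (tensor H H) id (comult H) (comult H x))
      \<in> algebra_homs H (tensor H (tensor H H))"
    by (rule algebra_homs_comp[OF comult_algebra_hom hom2])
  show "complex_algebra (tensor H (tensor H H))"
    by (rule HT.complex_algebra_tensor)
  have one: "comult H \<one>\<^bsub>H\<^esub> = pure_tensor H H \<one>\<^bsub>H\<^esub> \<one>\<^bsub>H\<^esub>"
    using algebra_homs_one[OF comult_algebra_hom] by (simp add: HH.pure_tensor_one)
  note lin = algebra_homs_linear[OF comult_algebra_hom] algebra_homs_linear[OF id_algebra_hom]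
  note simps = comult_gen one algebra_homs_add[OF hom1] algebra_homs_add[OF hom2]
    algebra_homs_add[OF assoc] tensor_map_pure[OF alg(1) alg(1) alg(2) alg(1) lin]
    tensor_map_pure[OF alg(1) alg(1) alg(1) alg(2) lin(2) lin(1)]
    tensor_assoc_pure[OF alg(1) alg(1) alg(1)] TH.pure_tensor_add_left HT.pure_tensor_add_right
    HT.T.a_assoc
  show "tensor_assoc H H H (tensor_map (tensor H H) H (comult H) id (comult H (\<iota> (gen y)))) =
      tensor_map H (tensor H H) id (comult H) (comult H (\<iota> (gen y)))" for y
    by (cases y) (simp_all add: simps)
qed

lemma uq_counit_left:
  assumes "x \<in> carrier H"
  shows "tensor_lift H (\<lambda>y z. counit H y \<odot>\<^bsub>H\<^esub> z) (comult H x) = x"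
proof -
  note counit = algebra_homs_simps[OF counit_algebra_hom, unfolded algebra_of_type_simps]
  have bil: "(\<lambda>y z. counit H y \<odot>\<^bsub>H\<^esub> z) \<in> bilinear_maps H H H"
    by (intro bilinear_mapsI linear_mapsI)
      (simp_all add: H.smul_add_left H.smul_add_right counit mult.commute)
  have hom: "tensor_lift H (\<lambda>y z. counit H y \<odot>\<^bsub>H\<^esub> z) \<in> algebra_homs (tensor H H) H"
    by (rule HH.tensor_lift_hom[OF complex_algebra_uq bil])
      (simp_all add: counit H.smult_mult_left H.smult_mult_right mult.commute)
  note simps = HH.tensor_lift_pure[OF complex_algebra_uq bil] algebra_homs_add[OF hom]
    comult_gen counit_gen counit
  have "tensor_lift H (\<lambda>y z. counit H y \<odot>\<^bsub>H\<^esub> z) (comult H (\<iota> (gen x))) = \<iota> (gen x)" for x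
    by (cases x) (simp_all add: simps)
  then show ?thesis
    by (rule uq_homs_eqI[OF algebra_homs_comp[OF comult_algebra_hom hom] algebra_homs_id _
          complex_algebra_uq assms])
qed

lemma uq_counit_right:
  assumes "x \<in> carrier H"
  shows "tensor_lift H (\<lambda>y z. counit H z \<odot>\<^bsub>H\<^esub> y) (comult H x) = x"
proof -
  note counit = algebra_homs_simps[OF counit_algebra_hom, unfolded algebra_of_type_simps]
  have bil: "(\<lambda>y z. counit H z \<odot>\<^bsub>H\<^esub> y) \<in> bilinear_maps H H H"
    by (intro bilinear_mapsI linear_mapsI)
      (simp_all add: H.smul_add_left H.smul_add_right counit mult.commute)
  have hom: "tensor_lift H (\<lambda>y z. counit H z \<odot>\<^bsub>H\<^esub> y) \<in> algebra_homs (tensor H H) H"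
    by (rule HH.tensor_lift_hom[OF complex_algebra_uq bil])
      (simp_all add: counit H.smult_mult_left H.smult_mult_right mult.commute)
  note simps = HH.tensor_lift_pure[OF complex_algebra_uq bil] algebra_homs_add[OF hom]
    comult_gen counit_gen counit
  have "tensor_lift H (\<lambda>y z. counit H z \<odot>\<^bsub>H\<^esub> y) (comult H (\<iota> (gen x))) = \<iota> (gen x)" for x
    by (cases x) (simp_all add: simps)
  then show ?thesis
    by (rule uq_homs_eqI[OF algebra_homs_comp[OF comult_algebra_hom hom] algebra_homs_id _
          complex_algebra_uq assms])
qed

lemma uq_induct [consumes 1, case_names one gen add smult]:
  assumes "X \<in> carrier H" "P \<one>\<^bsub>H\<^esub>"
    "\<And>x Y. Y \<in> carrier H \<Longrightarrow> P Y \<Longrightarrow> P (\<iota> (gen x) \<otimes>\<^bsub>H\<^esub> Y)"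
    "\<And>Y Z. Y \<in> carrier H \<Longrightarrow> Z \<in> carrier H \<Longrightarrow> P Y \<Longrightarrow> P Z \<Longrightarrow> P (Y \<oplus>\<^bsub>H\<^esub> Z)"
    "\<And>c Y. Y \<in> carrier H \<Longrightarrow> P Y \<Longrightarrow> P (c \<odot>\<^bsub>H\<^esub> Y)"
  shows "P X"
  using assms unfolding uq_sel by (rule presented_induct)

text \<open>\<open>S\<close> reverses products, so the convolution of \<open>S\<close> and the identity at \<open>xy\<close> is obtained by
  inserting its value at \<open>x\<close> in the middle of its value at \<open>y\<close>.\<close>

lemma uq_antipode_left:
  assumes "x \<in> carrier H"
  shows "tensor_lift H (\<lambda>y z. antipode H y \<otimes>\<^bsub>H\<^esub> z) (comult H x) = counit H x \<odot>\<^bsub>H\<^esub> \<one>\<^bsub>H\<^esub>"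
proof -
  note counit = algebra_homs_simps[OF counit_algebra_hom, unfolded algebra_of_type_simps]
  note comult = algebra_homs_simps[OF comult_algebra_hom]
  define m where "m u = tensor_lift H (\<lambda>y z. antipode H y \<otimes>\<^bsub>H\<^esub> u \<otimes>\<^bsub>H\<^esub> z)" for u
  have bil: "(\<lambda>y z. antipode H y \<otimes>\<^bsub>H\<^esub> u \<otimes>\<^bsub>H\<^esub> z) \<in> bilinear_maps H H H" if "u \<in> carrier H" for u
    using that
    by (intro bilinear_mapsI linear_mapsI)
      (simp_all add: antipode_simps H.l_distr H.r_distr H.smult_mult_left H.smult_mult_right)
  have bil_one: "(\<lambda>y z. antipode H y \<otimes>\<^bsub>H\<^esub> z) \<in> bilinear_maps H H H"
    by (intro bilinear_mapsI linear_mapsI)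
      (simp_all add: antipode_simps H.l_distr H.r_distr H.smult_mult_left H.smult_mult_right)
  note m_pure = HH.tensor_lift_pure[OF complex_algebra_uq bil, folded m_def]
  note lin = HH.tensor_lift_linear[OF complex_algebra_uq bil, folded m_def]
  note closed = linear_maps_closed[OF lin]
  note m_lin = linear_maps_add[OF lin] linear_maps_smult[OF lin]
  have m_add: "m (u \<oplus>\<^bsub>H\<^esub> v) T = m u T \<oplus>\<^bsub>H\<^esub> m v T"
    if "T \<in> carrier (tensor H H)" and uv: "u \<in> carrier H" "v \<in> carrier H" for u v T
    using that(1)
    by (induction rule: HH.tensor_induct)
      (simp_all add: uv m_pure m_lin closed antipode_simps H.l_distr H.r_distr H.a_ac)
  have m_smult: "m (c \<odot>\<^bsub>H\<^esub> \<one>\<^bsub>H\<^esub>) T = c \<odot>\<^bsub>H\<^esub> m \<one>\<^bsub>H\<^esub> T" if "T \<in> carrier (tensor H H)" for c T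
    using that
    by (induction rule: HH.tensor_induct)
      (simp_all add: m_pure m_lin closed antipode_simps H.smult_mult_left H.smult_mult_right
        H.smul_add_right)
  have m_mult: "m \<one>\<^bsub>H\<^esub> (S \<otimes>\<^bsub>tensor H H\<^esub> T) = m (m \<one>\<^bsub>H\<^esub> S) T"
    if S: "S \<in> carrier (tensor H H)" and T: "T \<in> carrier (tensor H H)" for S T
    using S
  proof (induction rule: HH.tensor_induct)
    case (pure x y)
    show ?case using T
    proof (induction rule: HH.tensor_induct)
      case (pure x' y')
      then show ?case using \<open>x \<in> carrier H\<close> \<open>y \<in> carrier H\<close>
        by (simp add: HH.pure_tensor_mult m_pure antipode_simps H.m_assoc)
    next
      case (add S' T')
      then show ?case using pure by (simp add: HH.T.r_distr m_lin closed m_pure antipode_simps)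
    qed
  next
    case (add S' T')
    then show ?case using T by (simp add: HH.T.l_distr m_lin closed m_add)
  qed
  have m_gen: "m \<one>\<^bsub>H\<^esub> (comult H (\<iota> (gen x))) = uq_counit_gen x \<odot>\<^bsub>H\<^esub> \<one>\<^bsub>H\<^esub>" for x
    by (cases x)
      (simp_all add: comult_gen m_lin m_pure antipode_gen antipode_simps H.l_minus H.r_minus
        H.m_assoc H.l_neg H.r_neg flip: H.m_assoc[of "\<iota> (gen (GKinv _))" "\<iota> (gen (GK _))"])
  have "m \<one>\<^bsub>H\<^esub> (comult H x) = counit H x \<odot>\<^bsub>H\<^esub> \<one>\<^bsub>H\<^esub>"
    using assms
  proof (induction rule: uq_induct)
    case one
    have "comult H \<one>\<^bsub>H\<^esub> = pure_tensor H H \<one>\<^bsub>H\<^esub> \<one>\<^bsub>H\<^esub>"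
      by (simp add: comult HH.pure_tensor_one)
    then show ?case by (simp add: counit m_pure antipode_simps)
  next
    case (gen x Y)
    then show ?case by (simp add: comult counit m_mult m_gen m_smult counit_gen)
  next
    case (add Y Z)
    then show ?case by (simp add: comult counit m_lin H.smul_add_left)
  next
    case (smult c Y)
    then show ?case by (simp add: comult counit m_lin)
  qed
  moreover have "m \<one>\<^bsub>H\<^esub> T = tensor_lift H (\<lambda>y z. antipode H y \<otimes>\<^bsub>H\<^esub> z) T"
    if "T \<in> carrier (tensor H H)" for T
    using that
    by (rule HH.tensor_linear_eqI[OF lin[OF H.one_closed]
          HH.tensor_lift_linear[OF complex_algebra_uq bil_one], rotated])
      (simp add: m_pure HH.tensor_lift_pure[OF complex_algebra_uq bil_one] antipode_simps)
  ultimately show ?thesis using assms by (simp add: comult)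
qed

text \<open>As for the left axiom, but nested the other way: the value at y is now inserted in the
  middle of the value at x.\<close>

lemma uq_antipode_right:
  assumes "x \<in> carrier H"
  shows "tensor_lift H (\<lambda>y z. y \<otimes>\<^bsub>H\<^esub> antipode H z) (comult H x) = counit H x \<odot>\<^bsub>H\<^esub> \<one>\<^bsub>H\<^esub>"
proof -
  note counit = algebra_homs_simps[OF counit_algebra_hom, unfolded algebra_of_type_simps]
  note comult = algebra_homs_simps[OF comult_algebra_hom]
  define m where "m u = tensor_lift H (\<lambda>y z. y \<otimes>\<^bsub>H\<^esub> u \<otimes>\<^bsub>H\<^esub> antipode H z)" for u
  have bil: "(\<lambda>y z. y \<otimes>\<^bsub>H\<^esub> u \<otimes>\<^bsub>H\<^esub> antipode H z) \<in> bilinear_maps H H H" if "u \<in> carrier H" for u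
    using that
    by (intro bilinear_mapsI linear_mapsI)
      (simp_all add: antipode_simps H.l_distr H.r_distr H.smult_mult_left H.smult_mult_right)
  have bil_one: "(\<lambda>y z. y \<otimes>\<^bsub>H\<^esub> antipode H z) \<in> bilinear_maps H H H"
    by (intro bilinear_mapsI linear_mapsI)
      (simp_all add: antipode_simps H.l_distr H.r_distr H.smult_mult_left H.smult_mult_right)
  note m_pure = HH.tensor_lift_pure[OF complex_algebra_uq bil, folded m_def]
  note lin = HH.tensor_lift_linear[OF complex_algebra_uq bil, folded m_def]
  note closed = linear_maps_closed[OF lin]
  note m_lin = linear_maps_add[OF lin] linear_maps_smult[OF lin]
  have m_add: "m (u \<oplus>\<^bsub>H\<^esub> v) T = m u T \<oplus>\<^bsub>H\<^esub> m v T"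
    if "T \<in> carrier (tensor H H)" and uv: "u \<in> carrier H" "v \<in> carrier H" for u v T
    using that(1)
    by (induction rule: HH.tensor_induct)
      (simp_all add: uv m_pure m_lin closed antipode_simps H.l_distr H.r_distr H.a_ac)
  have m_smult: "m (c \<odot>\<^bsub>H\<^esub> \<one>\<^bsub>H\<^esub>) T = c \<odot>\<^bsub>H\<^esub> m \<one>\<^bsub>H\<^esub> T" if "T \<in> carrier (tensor H H)" for c T
    using that
    by (induction rule: HH.tensor_induct)
      (simp_all add: m_pure m_lin closed antipode_simps H.smult_mult_left H.smult_mult_right
        H.smul_add_right)
  have m_mult: "m \<one>\<^bsub>H\<^esub> (S \<otimes>\<^bsub>tensor H H\<^esub> T) = m (m \<one>\<^bsub>H\<^esub> T) S"
    if S: "S \<in> carrier (tensor H H)" and T: "T \<in> carrier (tensor H H)" for S T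
    using T
  proof (induction rule: HH.tensor_induct)
    case (pure x y)
    show ?case using S
    proof (induction rule: HH.tensor_induct)
      case (pure x' y')
      then show ?case using \<open>x \<in> carrier H\<close> \<open>y \<in> carrier H\<close>
        by (simp add: HH.pure_tensor_mult m_pure antipode_simps H.m_assoc)
    next
      case (add S' T')
      then show ?case using pure by (simp add: HH.T.l_distr m_lin closed m_pure antipode_simps)
    qed
  next
    case (add S' T')
    then show ?case using S by (simp add: HH.T.r_distr m_lin closed m_add)
  qed
  have m_gen: "m \<one>\<^bsub>H\<^esub> (comult H (\<iota> (gen x))) = uq_counit_gen x \<odot>\<^bsub>H\<^esub> \<one>\<^bsub>H\<^esub>" for x
    by (cases x)
      (simp_all add: comult_gen m_lin m_pure antipode_gen antipode_simps H.l_minus H.r_minus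
        H.m_assoc H.l_neg H.r_neg flip: H.m_assoc[of "\<iota> (gen (GKinv _))" "\<iota> (gen (GK _))"])
  have "m \<one>\<^bsub>H\<^esub> (comult H x) = counit H x \<odot>\<^bsub>H\<^esub> \<one>\<^bsub>H\<^esub>"
    using assms
  proof (induction rule: uq_induct)
    case one
    have "comult H \<one>\<^bsub>H\<^esub> = pure_tensor H H \<one>\<^bsub>H\<^esub> \<one>\<^bsub>H\<^esub>"
      by (simp add: comult HH.pure_tensor_one)
    then show ?case by (simp add: counit m_pure antipode_simps)
  next
    case (gen x Y)
    then show ?case by (simp add: comult counit m_mult m_gen m_smult counit_gen mult.commute)
  next
    case (add Y Z)
    then show ?case by (simp add: comult counit m_lin H.smul_add_left)
  next
    case (smult c Y)
    then show ?case by (simp add: comult counit m_lin)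
  qed
  moreover have "m \<one>\<^bsub>H\<^esub> T = tensor_lift H (\<lambda>y z. y \<otimes>\<^bsub>H\<^esub> antipode H z) T"
    if "T \<in> carrier (tensor H H)" for T
    using that
    by (rule HH.tensor_linear_eqI[OF lin[OF H.one_closed]
          HH.tensor_lift_linear[OF complex_algebra_uq bil_one], rotated])
      (simp add: m_pure HH.tensor_lift_pure[OF complex_algebra_uq bil_one] antipode_simps)
  ultimately show ?thesis using assms by (simp add: comult)
qed

lemma hopf_algebra_uq: "hopf_algebra H"
proof (intro hopf_algebra.intro hopf_algebra_axioms.intro complex_algebra_uq)
  show "antipode H \<in> linear_maps H H"
    by (intro linear_mapsI antipode_simps)
qed (fact comult_algebra_hom counit_algebra_hom uq_coassociative uq_counit_left uq_counit_right
    uq_antipode_left uq_antipode_right)+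

end

section \<open>A module on which every \<open>E\<^sub>i\<close> acts nontrivially\<close>

context complex_algebra
begin

text \<open>As y commutes with x, taking the commutator with y passes through all factors to z and
  leaves the Serre element applied to b (k - l). Among the commuting factors are L - q^(-m) R, which
  kills k, and L - q^m R, which kills l.\<close>

lemma q_serre_commutes_target:
  assumes c: "x \<in> carrier A" "y \<in> carrier A" "z \<in> carrier A" "k \<in> carrier A" "l \<in> carrier A"
    and q: "q \<noteq> 0" and yx: "y \<otimes> x = x \<otimes> y"
    and yz: "y \<otimes> z = z \<otimes> y \<oplus> (b \<odot> k \<oplus> (- b) \<odot> l)"
    and kx: "k \<otimes> x = q ^ m \<odot> (x \<otimes> k)" and lx: "l \<otimes> x = inverse (q ^ m) \<odot> (x \<otimes> l)"
  shows "y \<otimes> q_serre A q (Suc m) 1 x z = q_serre A q (Suc m) 1 x z \<otimes> y"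
proof -
  let ?h = "b \<odot> k \<oplus> (- b) \<odot> l"
  have "y \<otimes> q_serre A q n t x z = q_serre A q n t x z \<otimes> y \<oplus> q_serre A q n t x ?h" for n t
  proof (induction n arbitrary: t)
    case (Suc n)
    let ?s = "q_serre A q n (q * t) x z" and ?g = "q_serre A q n (q * t) x ?h"
    have 1: "y \<otimes> (x \<otimes> ?s) = x \<otimes> ?s \<otimes> y \<oplus> x \<otimes> ?g"
    proof -
      have "y \<otimes> (x \<otimes> ?s) = x \<otimes> (y \<otimes> ?s)" using c by (simp add: yx flip: m_assoc)
      then show ?thesis using c by (simp add: Suc.IH r_distr m_assoc)
    qed
    have 2: "y \<otimes> (?s \<otimes> x) = ?s \<otimes> x \<otimes> y \<oplus> ?g \<otimes> x"
    proof -
      have "y \<otimes> (?s \<otimes> x) = (y \<otimes> ?s) \<otimes> x" using c by (simp add: m_assoc)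
      then show ?thesis using c by (simp add: Suc.IH l_distr m_assoc yx)
    qed
    show ?case
      using c
      by (simp add: q_commutator_def r_distr l_distr smult_mult_right smult_mult_left 1 2
          smul_add_right a_ac)
  qed (simp add: yz)
  moreover have "q_serre A q (Suc m) 1 x ?h = \<zero>"
  proof -
    have xk: "x \<otimes> k = inverse (q ^ m) \<odot> (k \<otimes> x)"
      using kx c q by simp
    have xl: "x \<otimes> l = q ^ m \<odot> (l \<otimes> x)"
      using lx c q by simp
    have zero: "q_commutator A (1 * inverse q ^ m) x k = \<zero>" "q_commutator A (1 * q ^ m) x l = \<zero>"
      using c by (simp_all add: q_commutator_def xk xl power_inverse smul_cancel)
    \<comment> \<open>The factor that kills k is the outermost one. It is moved inside to act on k
      first; for l the same is done with the factor from the other end.\<close>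
    have "q_serre A q (Suc m) 1 x k = \<zero>"
      unfolding q_serre.simps q_serre_q_commutator[OF c(1,4), symmetric] zero
      using c by (simp add: q_serre_zero)
    moreover have "q_serre A q (Suc m) 1 x l = \<zero>"
      unfolding q_serre_Suc_inverse[OF c(1,5) q] q_serre_q_commutator[OF c(1,5), symmetric] zero
      using c by (simp add: q_serre_zero)
    ultimately show ?thesis
      using c by (simp add: q_serre_add q_serre_smult del: q_serre.simps)
  qed
  ultimately show ?thesis
    using c by (simp del: q_serre.simps)
qed

text \<open>Writing \<open>b\<^sub>j\<close> for the \<open>j\<close>-fold q-commutator and \<open>u\<^sub>j = q\<^sup>m\<^sup>-\<^sup>2\<^sup>j\<close>, the commutator of \<open>y\<close> with
  \<open>b\<^bsub>j+1\<^esub>\<close> is a multiple of \<open>b\<^sub>j l\<close> with coefficient \<open>\<Sum>\<^bsub>i\<le>j\<^esub> b (u\<^sub>i - u\<^sub>i\<^sup>-\<^sup>1)\<close>, which vanishes for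
  \<open>j = m\<close> because \<open>u\<^bsub>m-i\<^esub> = u\<^sub>i\<^sup>-\<^sup>1\<close>.\<close>

lemma q_serre_commutes_source:
  assumes c: "x \<in> carrier A" "y \<in> carrier A" "z \<in> carrier A" "k \<in> carrier A" "l \<in> carrier A"
    and q: "q \<noteq> 0" and yz: "y \<otimes> z = z \<otimes> y"
    and yx: "y \<otimes> x = x \<otimes> y \<oplus> (b \<odot> k \<oplus> (- b) \<odot> l)"
    and kx: "k \<otimes> x = inverse q ^ 2 \<odot> (x \<otimes> k)" and lx: "l \<otimes> x = q ^ 2 \<odot> (x \<otimes> l)"
    and kz: "k \<otimes> z = q ^ m \<odot> (z \<otimes> k)" and lz: "l \<otimes> z = inverse (q ^ m) \<odot> (z \<otimes> l)"
  shows "y \<otimes> q_serre A q (Suc m) 1 x z = q_serre A q (Suc m) 1 x z \<otimes> y"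
proof -
  \<comment> \<open>The starting parameter depends on j so that the innermost factor is L - q^m R
    for every j. Then passing from j to j + 1 adds one outer factor, and B_(m+1) has starting
    parameter 1.\<close>
  define B where "B j = q_serre A q j (q ^ Suc m * inverse q ^ j) x z" for j
  define u where "u j = (inverse q ^ 2) ^ j * q ^ m" for j
  have u_eq: "u j = q ^ m * inverse q ^ (2 * j)" for j
    by (simp add: u_def power_mult)
  have B [simp]: "B j \<in> carrier A" for j
    using c by (simp add: B_def)
  have u: "u j \<noteq> 0" for j
    using q by (simp add: u_def)
  have B_Suc: "B (Suc j) = q_commutator A (u j) x (B j)" for j
  proof -
    have 1: "q * (q ^ Suc m * inverse q ^ Suc j) = q ^ Suc m * inverse q ^ j"
      using q by simp
    have 2: "q ^ Suc m * inverse q ^ Suc j * inverse q ^ j = u j"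
      using q by (simp add: u_eq mult_2 mult_2_right power_add field_simps)
    show ?thesis unfolding B_def q_serre.simps 1 2 ..
  qed
  have kB: "k \<otimes> B j = u j \<odot> (B j \<otimes> k)" for j
    using q_serre_commutation[OF c(1,4,3) kx kz, of q j "q ^ Suc m * inverse q ^ j"]
    by (simp only: B_def u_def)
  have lB: "l \<otimes> B j = inverse (u j) \<odot> (B j \<otimes> l)" for j
    using q_serre_commutation[OF c(1,5,3) lx lz, of q j "q ^ Suc m * inverse q ^ j"]
    by (simp add: B_def u_def power_inverse)
  \<comment> \<open>The terms with k cancel because k passes B_j with the scalar u_j, which is the
    parameter of the new q-commutator. Only terms with l survive.\<close>
  have step: "y \<otimes> B (Suc j) = B (Suc j) \<otimes> y \<oplus>
      ((b * (u j - inverse (u j))) \<odot> (B j \<otimes> l) \<oplus> q_commutator A (u j) x e)"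
    if e: "e \<in> carrier A" and yb: "y \<otimes> B j = B j \<otimes> y \<oplus> e" for j e
  proof -
    have 1: "y \<otimes> (x \<otimes> B j) = x \<otimes> B j \<otimes> y \<oplus> x \<otimes> e \<oplus>
      ((b * u j) \<odot> (B j \<otimes> k) \<oplus> (- (b * inverse (u j))) \<odot> (B j \<otimes> l))"
    proof -
      have "y \<otimes> (x \<otimes> B j) = (y \<otimes> x) \<otimes> B j" using c by (simp add: m_assoc)
      also have "\<dots> = x \<otimes> (y \<otimes> B j) \<oplus> (b \<odot> (k \<otimes> B j) \<oplus> (- b) \<odot> (l \<otimes> B j))"
        using c by (simp add: yx l_distr smult_mult_left m_assoc)
      finally show ?thesis using c e by (simp add: yb kB lB r_distr m_assoc)
    qed
    have 2: "y \<otimes> (B j \<otimes> x) = B j \<otimes> x \<otimes> y \<oplus> e \<otimes> x \<oplus> (b \<odot> (B j \<otimes> k) \<oplus> (- b) \<odot> (B j \<otimes> l))"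
    proof -
      have "y \<otimes> (B j \<otimes> x) = (y \<otimes> B j) \<otimes> x" using c by (simp add: m_assoc)
      also have "\<dots> = B j \<otimes> (y \<otimes> x) \<oplus> e \<otimes> x" using c e by (simp add: yb l_distr m_assoc)
      finally show ?thesis using c e
        by (simp add: yx r_distr smult_mult_right m_assoc a_ac)
    qed
    let ?p = "x \<otimes> B j \<otimes> y" and ?r = "B j \<otimes> x \<otimes> y" and ?s = "B j \<otimes> k" and ?t = "B j \<otimes> l"
    have s: "(b * u j) \<odot> ?s \<oplus> (- (u j * b)) \<odot> ?s = \<zero>"
      using smul_cancel[of ?s "b * u j"] c by (simp add: mult.commute)
    have t: "(- (b * inverse (u j))) \<odot> ?t \<oplus> (u j * b) \<odot> ?t = (b * (u j - inverse (u j))) \<odot> ?t"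
      using c by (simp add: algebra_simps flip: smul_add_left)
    have "y \<otimes> B (Suc j) = (?p \<oplus> (- u j) \<odot> ?r) \<oplus> (x \<otimes> e \<oplus> (- u j) \<odot> (e \<otimes> x)) \<oplus>
      (((b * u j) \<odot> ?s \<oplus> (- (u j * b)) \<odot> ?s) \<oplus> ((- (b * inverse (u j))) \<odot> ?t \<oplus> (u j * b) \<odot> ?t))"
      using c e
      by (simp add: B_Suc q_commutator_def r_distr smult_mult_right 1 2 smul_add_right a_ac)
    also have "\<dots> = (?p \<oplus> (- u j) \<odot> ?r) \<oplus> ((b * (u j - inverse (u j))) \<odot> ?t \<oplus> q_commutator A (u j) x e)"
      unfolding s t using c e by (simp add: q_commutator_def a_ac)
    also have "?p \<oplus> (- u j) \<odot> ?r = B (Suc j) \<otimes> y"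
      using c by (simp add: B_Suc q_commutator_def l_distr smult_mult_left m_assoc)
    finally show ?thesis .
  qed
  have main: "y \<otimes> B (Suc j) = B (Suc j) \<otimes> y \<oplus>
      (\<Sum>i\<le>j. b * (u i - inverse (u i))) \<odot> (B j \<otimes> l)" for j
  proof (induction j)
    case 0
    show ?case
      using step[of \<zero> 0] c yz by (simp add: B_def q_commutator_zero)
  next
    case (Suc j)
    let ?c = "\<Sum>i\<le>j. b * (u i - inverse (u i))"
    \<comment> \<open>Moving l past x gives q^2, which changes the parameter u_(j+1) back into u_j,
      the one that builds B_(j+1). So the error term keeps its shape and only its coefficient
      grows.\<close>
    have "q_commutator A (u (Suc j)) x (B j \<otimes> l) = B (Suc j) \<otimes> l"
    proof -
      have "B j \<otimes> l \<otimes> x = q ^ 2 \<odot> (B j \<otimes> x \<otimes> l)"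
        using c by (simp add: m_assoc lx smult_mult_right)
      moreover have "u (Suc j) * q ^ 2 = u j"
        using q by (simp add: u_def power2_eq_square field_simps)
      ultimately show ?thesis
        using c by (simp add: B_Suc[of j] q_commutator_def l_distr smult_mult_left m_assoc)
    qed
    then have "q_commutator A (u (Suc j)) x (?c \<odot> (B j \<otimes> l)) = ?c \<odot> (B (Suc j) \<otimes> l)"
      using c by (simp add: q_commutator_smult)
    then show ?case
      using step[OF _ Suc.IH] c by (simp add: algebra_simps flip: smul_add_left)
  qed
  have u_reflect: "inverse (u i) = u (m - i)" if "i \<le> m" for i
  proof -
    have "u i * u (m - i) = q ^ m * q ^ m * inverse q ^ (2 * i + 2 * (m - i))"
      by (simp add: u_eq power_add mult_ac)
    also have "2 * i + 2 * (m - i) = m + m" using that by simp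
    also have "q ^ m * q ^ m * inverse q ^ (m + m) = 1"
      using q by (simp add: power_add field_simps)
    finally show ?thesis by (rule inverse_unique)
  qed
  have "(\<Sum>i\<le>m. inverse (u i)) = (\<Sum>i\<le>m. u (m - i))"
    by (intro sum.cong refl) (simp add: u_reflect)
  also have "\<dots> = (\<Sum>i\<le>m. u i)"
    by (rule sum.nat_diff_reindex[of u "Suc m", simplified lessThan_Suc_atMost diff_Suc_Suc])
  finally have "(\<Sum>i\<le>m. b * (u i - inverse (u i))) = 0"
    by (simp add: sum_subtractf flip: sum_distrib_left)
  then have "y \<otimes> B (Suc m) = B (Suc m) \<otimes> y"
    using main[of m] c by simp
  moreover have "q ^ Suc m * inverse q ^ Suc m = 1"
    using q by (simp add: field_simps)
  ultimately show ?thesis by (simp only: B_def)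
qed

end

context cartan_representation
begin

lemma E_F': "E i \<otimes> F i = F i \<otimes> E i \<oplus> (qc i \<odot> K i \<oplus> (- qc i) \<odot> L i)"
  by (simp add: E_F minus_eq smul_add_right smul_uminus_right smul_uminus_left)

lemma F_E: "F i \<otimes> E i = E i \<otimes> F i \<oplus> (qc i \<odot> L i \<oplus> (- qc i) \<odot> K i)"
  by (simp add: E_F' a_assoc smul_uminus_left a_lcomm[of "qc i \<odot> L i"] r_neg r_neg1 r_neg2)

text \<open>The cases ask which of F_i and F_j fails to commute with E_k: the target, the source or
  neither. The Cartan relations suffice, so this holds before the Serre relations are imposed, and
  it will force them on functions on words.\<close>

lemma q_serre_F_commutes_E:
  assumes "i \<noteq> j"
  shows "E k \<otimes> q_serre A (qi i) (serre_order i j) 1 (F i) (F j) =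
    q_serre A (qi i) (serre_order i j) 1 (F i) (F j) \<otimes> E k"
proof -
  let ?m = "nat (- a i j)"
  have n: "serre_order i j = Suc ?m" using assms by (rule serre_order_Suc)
  have qa: "qa i j = inverse (qi i ^ ?m)" using assms by (rule qa_off_diagonal)
  consider "k = j" | "k = i" | "k \<noteq> i" "k \<noteq> j" by blast
  then show ?thesis
  proof cases
    case 1
    have "K j \<otimes> F i = qi i ^ ?m \<odot> (F i \<otimes> K j)" "L j \<otimes> F i = inverse (qi i ^ ?m) \<odot> (F i \<otimes> L j)"
      by (simp_all only: K_F L_F qa_commute[of j i] qa inverse_inverse_eq)
    then show ?thesis
      unfolding n 1
      by (intro q_serre_commutes_target[OF _ _ _ _ _ qi_nonzero _ E_F'])
        (use assms in \<open>simp_all add: E_F\<close>)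
  next
    case 2
    have "K i \<otimes> F i = inverse (qi i) ^ 2 \<odot> (F i \<otimes> K i)" "L i \<otimes> F i = (qi i) ^ 2 \<odot> (F i \<otimes> L i)"
      by (simp_all only: K_F L_F qa_diagonal power_inverse)
    moreover have "K i \<otimes> F j = qi i ^ ?m \<odot> (F j \<otimes> K i)" "L i \<otimes> F j = inverse (qi i ^ ?m) \<odot> (F j \<otimes> L i)"
      by (simp_all only: K_F L_F qa inverse_inverse_eq)
    ultimately show ?thesis
      unfolding n 2
      by (intro q_serre_commutes_source[OF _ _ _ _ _ qi_nonzero _ E_F'])
        (use assms in \<open>simp_all add: E_F\<close>)
  next
    case 3
    then show ?thesis
      using q_serre_commutation[of "F i" "E k" "F j" 1 1 "qi i" "serre_order i j" 1]
      by (simp add: E_F)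
  qed
qed

text \<open>The same with E and F, and hence K and K^-1, exchanged. It makes the space of functions
  killed by the Serre elements in the E_j stable under the F_k.\<close>

lemma q_serre_E_commutes_F:
  assumes "i \<noteq> j"
  shows "F k \<otimes> q_serre A (qi i) (serre_order i j) 1 (E i) (E j) =
    q_serre A (qi i) (serre_order i j) 1 (E i) (E j) \<otimes> F k"
proof -
  let ?m = "nat (- a i j)"
  have n: "serre_order i j = Suc ?m" using assms by (rule serre_order_Suc)
  have qa: "qa i j = inverse (qi i ^ ?m)" using assms by (rule qa_off_diagonal)
  consider "k = j" | "k = i" | "k \<noteq> i" "k \<noteq> j" by blast
  then show ?thesis
  proof cases
    case 1
    have "L j \<otimes> E i = qi i ^ ?m \<odot> (E i \<otimes> L j)" "K j \<otimes> E i = inverse (qi i ^ ?m) \<odot> (E i \<otimes> K j)"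
      by (simp_all only: K_E L_E qa_commute[of j i] qa inverse_inverse_eq)
    then show ?thesis
      unfolding n 1
      by (intro q_serre_commutes_target[OF _ _ _ _ _ qi_nonzero _ F_E])
        (use assms in \<open>simp_all add: E_F\<close>)
  next
    case 2
    have "L i \<otimes> E i = inverse (qi i) ^ 2 \<odot> (E i \<otimes> L i)" "K i \<otimes> E i = (qi i) ^ 2 \<odot> (E i \<otimes> K i)"
      by (simp_all only: K_E L_E qa_diagonal power_inverse)
    moreover have "L i \<otimes> E j = qi i ^ ?m \<odot> (E j \<otimes> L i)" "K i \<otimes> E j = inverse (qi i ^ ?m) \<odot> (E j \<otimes> K i)"
      by (simp_all only: K_E L_E qa inverse_inverse_eq)
    ultimately show ?thesis
      unfolding n 2
      by (intro q_serre_commutes_source[OF _ _ _ _ _ qi_nonzero _ F_E])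
        (use assms in \<open>simp_all add: E_F\<close>)
  next
    case 3
    then show ?thesis
      using q_serre_commutation[of "E i" "F k" "E j" 1 1 "qi i" "serre_order i j" 1]
      by (simp add: E_F)
  qed
qed

end

section \<open>Algebras of operators on functions\<close>

definition function_subspace :: "('w \<Rightarrow> complex) set \<Rightarrow> bool" where
  "function_subspace W \<longleftrightarrow> (\<lambda>w. 0) \<in> W \<and> (\<forall>\<phi>\<in>W. \<forall>\<psi>\<in>W. (\<lambda>w. \<phi> w + \<psi> w) \<in> W) \<and>
     (\<forall>c. \<forall>\<phi>\<in>W. (\<lambda>w. c * \<phi> w) \<in> W)"

lemma function_subspace_add:
  "function_subspace W \<Longrightarrow> \<phi> \<in> W \<Longrightarrow> \<psi> \<in> W \<Longrightarrow> (\<lambda>w. \<phi> w + \<psi> w) \<in> W"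
  and function_subspace_scale: "function_subspace W \<Longrightarrow> \<phi> \<in> W \<Longrightarrow> (\<lambda>w. c * \<phi> w) \<in> W"
  by (simp_all add: function_subspace_def)

text \<open>Operators are defined and linear on all functions and merely preserve W, which avoids a
  type for W. The price is that operators which agree on W may differ; dividing by the annihilator
  of W identifies them.\<close>

definition endo ::
    "('w \<Rightarrow> complex) set \<Rightarrow> (complex, ('w \<Rightarrow> complex) \<Rightarrow> 'w \<Rightarrow> complex) module" where
  "endo W = \<lparr>carrier = {T. (\<forall>\<phi> \<psi>. T (\<lambda>w. \<phi> w + \<psi> w) = (\<lambda>w. T \<phi> w + T \<psi> w)) \<and>
       (\<forall>c \<phi>. T (\<lambda>w. c * \<phi> w) = (\<lambda>w. c * T \<phi> w)) \<and> (\<forall>\<phi>\<in>W. T \<phi> \<in> W)},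
     mult = (\<lambda>S T \<phi>. S (T \<phi>)), one = (\<lambda>\<phi>. \<phi>), zero = (\<lambda>\<phi> w. 0),
     add = (\<lambda>S T \<phi> w. S \<phi> w + T \<phi> w), smult = (\<lambda>c T \<phi> w. c * T \<phi> w)\<rparr>"

lemma endo_sel:
  "carrier (endo W) = {T. (\<forall>\<phi> \<psi>. T (\<lambda>w. \<phi> w + \<psi> w) = (\<lambda>w. T \<phi> w + T \<psi> w)) \<and>
       (\<forall>c \<phi>. T (\<lambda>w. c * \<phi> w) = (\<lambda>w. c * T \<phi> w)) \<and> (\<forall>\<phi>\<in>W. T \<phi> \<in> W)}"
  "S \<otimes>\<^bsub>endo W\<^esub> T = (\<lambda>\<phi>. S (T \<phi>))"
  "\<one>\<^bsub>endo W\<^esub> = (\<lambda>\<phi>. \<phi>)"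
  "\<zero>\<^bsub>endo W\<^esub> = (\<lambda>\<phi> w. 0)"
  "S \<oplus>\<^bsub>endo W\<^esub> T = (\<lambda>\<phi> w. S \<phi> w + T \<phi> w)"
  "c \<odot>\<^bsub>endo W\<^esub> T = (\<lambda>\<phi> w. c * T \<phi> w)"
  by (simp_all add: endo_def)

lemma complex_algebra_endo:
  assumes "function_subspace W"
  shows "complex_algebra (endo W)"
proof -
  have zero: "(\<lambda>w. 0) \<in> W" and add: "\<phi> \<in> W \<Longrightarrow> \<psi> \<in> W \<Longrightarrow> (\<lambda>w. \<phi> w + \<psi> w) \<in> W"
    and scale: "\<phi> \<in> W \<Longrightarrow> (\<lambda>w. c * \<phi> w) \<in> W" for \<phi> \<psi> c
    using assms by (auto simp: function_subspace_def)
  show ?thesis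
  proof (rule complex_algebraI)
    show "ring (endo W)"
    proof (intro ringI abelian_groupI monoidI)
      fix T assume "T \<in> carrier (endo W)"
      then show "\<exists>S\<in>carrier (endo W). S \<oplus>\<^bsub>endo W\<^esub> T = \<zero>\<^bsub>endo W\<^esub>"
        using scale[of _ "-1"]
        by (intro bexI[of _ "\<lambda>\<phi> w. - T \<phi> w"]) (simp_all add: endo_sel)
    qed (simp_all add: endo_sel zero add algebra_simps)
  qed (simp_all add: endo_sel scale algebra_simps)
qed

text \<open>W enters only the carrier, so Serre elements may be computed among the operators on all
  functions.\<close>

lemma q_serre_endo_cong: "q_serre (endo W) q n t x z = q_serre (endo W') q n t x z"
  by (induction n arbitrary: t) (simp_all add: q_commutator_def endo_sel)

lemma function_subspace_UNIV: "function_subspace UNIV"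
  by (simp add: function_subspace_def)

definition annihilator :: "('w \<Rightarrow> complex) set \<Rightarrow> (('w \<Rightarrow> complex) \<Rightarrow> 'w \<Rightarrow> complex) set" where
  "annihilator W = {T \<in> carrier (endo W). \<forall>\<phi>\<in>W. T \<phi> = (\<lambda>w. 0)}"

lemma ideal_annihilator:
  assumes "function_subspace W"
  shows "ideal (annihilator W) (endo W)"
proof -
  interpret complex_algebra "endo W" by (rule complex_algebra_endo[OF assms])
  have zero: "T (\<lambda>w. 0) = (\<lambda>w. 0)" if "T \<in> carrier (endo W)" for T
  proof -
    have "\<forall>c \<phi>. T (\<lambda>w. c * \<phi> w) = (\<lambda>w. c * T \<phi> w)"
      using that by (simp add: endo_sel(1))
    from this[rule_format, of 0 "\<lambda>w. 0"] show ?thesis by simp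
  qed
  show ?thesis
  proof (rule idealI[OF ring_axioms])
    show "subgroup (annihilator W) (add_monoid (endo W))"
    proof (rule subgroup.intro)
      fix T assume T: "T \<in> annihilator W"
      then have cl: "T \<in> carrier (endo W)" by (simp add: annihilator_def)
      have "\<ominus>\<^bsub>endo W\<^esub> T \<in> carrier (endo W)" "\<ominus>\<^bsub>endo W\<^esub> T = (\<lambda>\<phi> w. (-1) * T \<phi> w)"
        using cl smul_minus_one[OF cl] by (simp_all add: endo_sel(6))
      then show "inv\<^bsub>add_monoid (endo W)\<^esub> T \<in> annihilator W"
        using T by (simp add: annihilator_def a_inv_def)
    next
      fix S T assume "S \<in> annihilator W" "T \<in> annihilator W"
      then show "S \<otimes>\<^bsub>add_monoid (endo W)\<^esub> T \<in> annihilator W"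
        using a_closed[of S T] by (simp add: annihilator_def endo_sel(5))
    next
      show "annihilator W \<subseteq> carrier (add_monoid (endo W))"
        by (auto simp: annihilator_def)
      show "\<one>\<^bsub>add_monoid (endo W)\<^esub> \<in> annihilator W"
        using zero_closed by (simp add: annihilator_def endo_sel(4))
    qed
  next
    fix S T assume S: "S \<in> annihilator W" and T: "T \<in> carrier (endo W)"
    have "T \<phi> \<in> W" if "\<phi> \<in> W" for \<phi>
      using T that by (simp add: endo_sel(1))
    then show "T \<otimes>\<^bsub>endo W\<^esub> S \<in> annihilator W" "S \<otimes>\<^bsub>endo W\<^esub> T \<in> annihilator W"
      using S T m_closed[of S T] m_closed[of T S] zero[OF T]
      by (simp_all add: annihilator_def endo_sel(2))
  qed
qed

lemma uq_cartan_relations_hom: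
  assumes h: "h \<in> algebra_homs A B" and A: "complex_algebra A" and B: "complex_algebra B"
    and rel: "uq_cartan_relations a d q A f"
  shows "uq_cartan_relations a d q B (\<lambda>x. h (f x))"
proof -
  interpret A: complex_algebra A by fact
  interpret B: complex_algebra B by fact
  have f: "f x \<in> carrier A" for x
    using rel by (auto simp: uq_cartan_relations_def)
  note lin = algebra_homs_linear[OF h]
  have ef: "h (if i = j then c \<odot>\<^bsub>A\<^esub> (f (GK i) \<ominus>\<^bsub>A\<^esub> f (GKinv i)) else \<zero>\<^bsub>A\<^esub>) =
    (if i = j then c \<odot>\<^bsub>B\<^esub> (h (f (GK i)) \<ominus>\<^bsub>B\<^esub> h (f (GKinv i))) else \<zero>\<^bsub>B\<^esub>)" for i j c
    using f by (simp add: algebra_homs_simps[OF h] linear_maps_minus[OF lin A B]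
        linear_maps_zero[OF lin A B])
  have ef_closed: "(if i = j then c \<odot>\<^bsub>A\<^esub> (f (GK i) \<ominus>\<^bsub>A\<^esub> f (GKinv i)) else \<zero>\<^bsub>A\<^esub>) \<in> carrier A" for i j c
    using f by simp
  have "range (\<lambda>x. h (f x)) \<subseteq> carrier B"
    using algebra_homs_closed[OF h f] by blast
  moreover have "h x \<otimes>\<^bsub>B\<^esub> h y = h (x \<otimes>\<^bsub>A\<^esub> y)" "h x \<oplus>\<^bsub>B\<^esub> h y = h (x \<oplus>\<^bsub>A\<^esub> y)"
    if "x \<in> carrier A" "y \<in> carrier A" for x y
    using that by (simp_all add: algebra_homs_simps[OF h])
  moreover have "c \<odot>\<^bsub>B\<^esub> h x = h (c \<odot>\<^bsub>A\<^esub> x)" if "x \<in> carrier A" for c x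
    using that by (simp add: algebra_homs_simps[OF h])
  ultimately show ?thesis
    using rel f ef_closed
    unfolding uq_cartan_relations_def ef[symmetric]
    by (simp add: algebra_homs_one[OF h, symmetric] del: image_subset_iff split del: if_split)
qed

section \<open>The dual Verma module and its Serre submodule\<close>

context quantum_datum
begin

text \<open>The space of functions on words is the dual of a lowest weight Verma module of the algebra
  without the Serre relations: \<open>E\<^sub>j\<close> is dual to the multiplication of words by the letter \<open>j\<close>, and
  \<open>weight i w\<close> is the eigenvalue of \<open>K\<^sub>i\<close> at the word \<open>w\<close>.\<close>

definition weight :: "'i \<Rightarrow> 'i list \<Rightarrow> complex" where
  "weight i w = prod_list (map (\<lambda>j. inverse (qa i j)) w)"

text \<open>The value of F_k \<phi> at a word. The recursion is forced: the value at j # w is that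
  of E_j F_k \<phi> at w, which the commutation relation of E_j and F_k expands, and F_k \<phi> is
  taken to vanish at the empty word.\<close>

primrec lowering :: "'i list \<Rightarrow> 'i \<Rightarrow> ('i list \<Rightarrow> complex) \<Rightarrow> complex" where
  "lowering [] k \<phi> = 0"
| "lowering (j # w) k \<phi> = lowering w k (\<lambda>v. \<phi> (j # v)) +
     (if j = k then qc k * (weight k w - inverse (weight k w)) * \<phi> w else 0)"

fun word_action :: "'i uq_gen \<Rightarrow> ('i list \<Rightarrow> complex) \<Rightarrow> 'i list \<Rightarrow> complex" where
  "word_action (GE j) \<phi> = (\<lambda>w. \<phi> (j # w))"
| "word_action (GF j) \<phi> = (\<lambda>w. lowering w j \<phi>)"
| "word_action (GK i) \<phi> = (\<lambda>w. weight i w * \<phi> w)"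
| "word_action (GKinv i) \<phi> = (\<lambda>w. inverse (weight i w) * \<phi> w)"

lemma weight_Cons: "weight i (j # w) = inverse (qa i j) * weight i w"
  by (simp add: weight_def)

lemma weight_append: "weight i (v @ w) = weight i v * weight i w"
  by (simp add: weight_def)

lemma weight_nonzero: "weight i w \<noteq> 0"
  using qa_nonzero by (auto simp: weight_def prod_list_zero_iff simp del: power_int_eq_0_iff)

lemma lowering_linear:
  "lowering w k (\<lambda>w. \<phi> w + \<psi> w) = lowering w k \<phi> + lowering w k \<psi>"
  "lowering w k (\<lambda>w. c * \<phi> w) = c * lowering w k \<phi>"
  by (induction w arbitrary: \<phi> \<psi>) (simp_all add: algebra_simps add_divide_distrib diff_divide_distrib)

lemma lowering_weight:
  "weight i w * lowering w k \<phi> = inverse (qa i k) * lowering w k (\<lambda>w. weight i w * \<phi> w)"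
proof (induction w arbitrary: \<phi>)
  case (Cons j w)
  let ?c = "qc k * (weight k w - inverse (weight k w))"
  have "lowering w k (\<lambda>v. weight i (j # v) * \<phi> (j # v)) =
      inverse (qa i j) * lowering w k (\<lambda>v. weight i v * \<phi> (j # v))"
    by (simp add: weight_Cons mult.assoc lowering_linear)
  then have "inverse (qa i k) * lowering (j # w) k (\<lambda>w. weight i w * \<phi> w) =
      inverse (qa i j) * (inverse (qa i k) * lowering w k (\<lambda>v. weight i v * \<phi> (j # v))) +
      inverse (qa i k) * (if j = k then ?c * (weight i w * \<phi> w) else 0)"
    by (simp add: algebra_simps)
  also have "\<dots> = weight i (j # w) * lowering (j # w) k \<phi>"
    unfolding Cons.IH[symmetric] by (simp add: weight_Cons algebra_simps)
  finally show ?case ..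
qed simp

lemma word_action_linear:
  "word_action x (\<lambda>w. \<phi> w + \<psi> w) = (\<lambda>w. word_action x \<phi> w + word_action x \<psi> w)"
  "word_action x (\<lambda>w. c * \<phi> w) = (\<lambda>w. c * word_action x \<phi> w)"
  by (cases x; simp add: fun_eq_iff lowering_linear algebra_simps)+

lemma word_action_relations:
  assumes W: "function_subspace W" and closed: "\<And>x \<phi>. \<phi> \<in> W \<Longrightarrow> word_action x \<phi> \<in> W"
  shows "uq_cartan_relations a d q (endo W) word_action"
proof -
  interpret N: complex_algebra "endo W" by (rule complex_algebra_endo[OF W])
  have act: "word_action x \<in> carrier (endo W)" for x
    using closed by (simp add: endo_sel word_action_linear)
  have diff: "K \<ominus>\<^bsub>endo W\<^esub> L = (\<lambda>\<phi> w. K \<phi> w - L \<phi> w)" if "L \<in> carrier (endo W)" for K L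
  proof -
    have "K \<ominus>\<^bsub>endo W\<^esub> L = K \<oplus>\<^bsub>endo W\<^esub> (-1) \<odot>\<^bsub>endo W\<^esub> L"
      using N.smul_minus_one[OF that] by (simp add: N.minus_eq)
    then show ?thesis by (simp add: endo_sel(5,6))
  qed
  have minus: "word_action (GK i) \<ominus>\<^bsub>endo W\<^esub> word_action (GKinv i) =
      (\<lambda>\<phi> w. (weight i w - inverse (weight i w)) * \<phi> w)" for i
    by (subst diff[OF act]) (simp add: fun_eq_iff algebra_simps)
  have KF: "word_action (GK i) \<otimes>\<^bsub>endo W\<^esub> word_action (GF j) =
      inverse (qa i j) \<odot>\<^bsub>endo W\<^esub> (word_action (GF j) \<otimes>\<^bsub>endo W\<^esub> word_action (GK i))" for i j
    by (simp only: endo_sel word_action.simps lowering_weight)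
  have EF: "word_action (GE i) \<otimes>\<^bsub>endo W\<^esub> word_action (GF j) =
      word_action (GF j) \<otimes>\<^bsub>endo W\<^esub> word_action (GE i) \<oplus>\<^bsub>endo W\<^esub>
      (if i = j then qc i \<odot>\<^bsub>endo W\<^esub> (word_action (GK i) \<ominus>\<^bsub>endo W\<^esub> word_action (GKinv i))
       else \<zero>\<^bsub>endo W\<^esub>)" for i j
    unfolding minus by (auto simp: endo_sel fun_eq_iff)
  have KE: "word_action (GK i) \<otimes>\<^bsub>endo W\<^esub> word_action (GE j) =
      qa i j \<odot>\<^bsub>endo W\<^esub> (word_action (GE j) \<otimes>\<^bsub>endo W\<^esub> word_action (GK i))" for i j
    using qa_nonzero[of i j] by (simp add: endo_sel weight_Cons fun_eq_iff)
  have range: "range word_action \<subseteq> carrier (endo W)"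
    using act by blast
  show ?thesis
    unfolding uq_cartan_relations_def
    by (intro conjI allI range KF EF KE)
      (simp_all add: endo_sel fun_eq_iff weight_nonzero)
qed

interpretation N: cartan_representation a d q "endo UNIV" word_action
  by (intro cartan_representation.intro cartan_representation_axioms.intro quantum_datum_axioms
      complex_algebra_endo function_subspace_UNIV word_action_relations) simp_all

abbreviation "serre_E i j \<equiv>
  q_serre (endo UNIV) (qi i) (serre_order i j) 1 (word_action (GE i)) (word_action (GE j))"
abbreviation "serre_F i j \<equiv>
  q_serre (endo UNIV) (qi i) (serre_order i j) 1 (word_action (GF i)) (word_action (GF j))"

text \<open>Every monomial of the Serre element has some F as its outermost operator, so all values
  at the empty word vanish. As the element commutes with every E_k, its value at a longer word is a
  value at a shorter one.\<close>

lemma serre_F_zero: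
  assumes "i \<noteq> j" shows "serre_F i j = (\<lambda>\<phi> w. 0)"
proof -
  have "q_serre (endo UNIV) p n t (word_action (GF i)) (word_action (GF j)) \<phi> [] = 0" for p n t \<phi>
    by (induction n arbitrary: t \<phi>) (simp_all add: q_commutator_def endo_sel)
  then have Nil: "serre_F i j \<phi> [] = 0" for \<phi> .
  have "serre_F i j \<phi> w = 0" for \<phi> w
  proof (induction w arbitrary: \<phi>)
    case (Cons k w)
    have "word_action (GE k) (serre_F i j \<phi>) = serre_F i j (word_action (GE k) \<phi>)"
      using N.q_serre_F_commutes_E[OF assms, of k] unfolding endo_sel(2) by (rule fun_cong)
    then have "serre_F i j \<phi> (k # w) = serre_F i j (word_action (GE k) \<phi>) w"
      by (subst (asm) word_action.simps(1)) (rule fun_cong)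
    then show ?case by (simp only: Cons.IH)
  qed (rule Nil)
  then show ?thesis by blast
qed

text \<open>Reading the letters of w applies a monomial in the E_k, so this is the largest E-stable
  space of functions on which the Serre elements in the E_k vanish.\<close>

definition serre_kernel :: "('i list \<Rightarrow> complex) set" where
  "serre_kernel = {\<phi>. \<forall>w i j. i \<noteq> j \<longrightarrow> serre_E i j (\<lambda>v. \<phi> (w @ v)) = (\<lambda>v. 0)}"

lemma serre_E_linear:
  "serre_E i j (\<lambda>w. \<phi> w + \<psi> w) = (\<lambda>w. serre_E i j \<phi> w + serre_E i j \<psi> w)"
  "serre_E i j (\<lambda>w. c * \<phi> w) = (\<lambda>w. c * serre_E i j \<phi> w)"
proof -
  have "serre_E i j \<in> carrier (endo UNIV)" by simp
  then show "serre_E i j (\<lambda>w. \<phi> w + \<psi> w) = (\<lambda>w. serre_E i j \<phi> w + serre_E i j \<psi> w)"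
    "serre_E i j (\<lambda>w. c * \<phi> w) = (\<lambda>w. c * serre_E i j \<phi> w)"
    unfolding endo_sel(1) by blast+
qed

lemma function_subspace_serre_kernel: "function_subspace serre_kernel"
  unfolding function_subspace_def serre_kernel_def
  using serre_E_linear(2)[of _ _ 0] by (auto simp: serre_E_linear)

lemma serre_kernelD: "\<phi> \<in> serre_kernel \<Longrightarrow> i \<noteq> j \<Longrightarrow> serre_E i j (\<lambda>v. \<phi> (w @ v)) = (\<lambda>v. 0)"
  unfolding serre_kernel_def by blast

lemma serre_kernelD_Nil:
  assumes "\<phi> \<in> serre_kernel" "i \<noteq> j" shows "serre_E i j \<phi> = (\<lambda>v. 0)"
  using serre_kernelD[OF assms, of "[]"] unfolding append_Nil .

lemma serre_kernel_E:
  assumes "\<phi> \<in> serre_kernel" shows "word_action (GE k) \<phi> \<in> serre_kernel"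
  unfolding serre_kernel_def using serre_kernelD[OF assms, of _ _ "k # _"] by simp

text \<open>Serre elements q-commute with K_k, and weights are multiplicative on words, so K_k acts
  on the function read after w as it does on \<phi>, up to a scalar.\<close>

lemma serre_kernel_K:
  assumes "\<phi> \<in> serre_kernel"
  shows "word_action (GK k) \<phi> \<in> serre_kernel" "word_action (GKinv k) \<phi> \<in> serre_kernel"
proof -
  have "serre_E i j (\<lambda>v. weight k v * \<phi> (w @ v)) = (\<lambda>v. 0)"
    "serre_E i j (\<lambda>v. inverse (weight k v) * \<phi> (w @ v)) = (\<lambda>v. 0)" if "i \<noteq> j" for i j w
  proof -
    let ?\<phi> = "\<lambda>v. \<phi> (w @ v)"
    have zero: "serre_E i j ?\<phi> = (\<lambda>v. 0)"
      using assms that by (rule serre_kernelD)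
    have "word_action (GK k) \<otimes>\<^bsub>endo UNIV\<^esub> serre_E i j =
        (qa k i ^ serre_order i j * qa k j) \<odot>\<^bsub>endo UNIV\<^esub> (serre_E i j \<otimes>\<^bsub>endo UNIV\<^esub> word_action (GK k))"
      by (rule N.q_serre_commutation) (simp_all only: N.gen_closed N.K_E)
    from fun_cong[OF this, of ?\<phi>]
    show "serre_E i j (\<lambda>v. weight k v * \<phi> (w @ v)) = (\<lambda>v. 0)"
      using qa_nonzero[of k i] qa_nonzero[of k j] q_nonzero
      unfolding endo_sel(2,6) zero word_action.simps by (simp add: fun_eq_iff)
    have "word_action (GKinv k) \<otimes>\<^bsub>endo UNIV\<^esub> serre_E i j =
        (inverse (qa k i) ^ serre_order i j * inverse (qa k j)) \<odot>\<^bsub>endo UNIV\<^esub>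
        (serre_E i j \<otimes>\<^bsub>endo UNIV\<^esub> word_action (GKinv k))"
      by (rule N.q_serre_commutation) (simp_all only: N.gen_closed N.L_E)
    from fun_cong[OF this, of ?\<phi>]
    show "serre_E i j (\<lambda>v. inverse (weight k v) * \<phi> (w @ v)) = (\<lambda>v. 0)"
      using qa_nonzero[of k i] qa_nonzero[of k j] q_nonzero
      unfolding endo_sel(2,6) zero word_action.simps by (simp add: fun_eq_iff)
  qed
  note 1 = this
  show "word_action (GK k) \<phi> \<in> serre_kernel" "word_action (GKinv k) \<phi> \<in> serre_kernel"
    unfolding serre_kernel_def
    using 1 by (simp_all add: weight_append mult.assoc serre_E_linear)
qed

text \<open>Induction on the word w of letters already read. For the empty word, F_k commutes with
  the Serre elements in the E_j. For a further letter l, the commutator of E_l and F_k leaves F_k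
  E_l and a term in K_k and K_k^-1, and the space is stable under E_l and K_k.\<close>

lemma serre_kernel_F:
  assumes "\<phi> \<in> serre_kernel" shows "word_action (GF k) \<phi> \<in> serre_kernel"
proof -
  have "serre_E i j (\<lambda>v. lowering (w @ v) k \<phi>) = (\<lambda>v. 0)" if "i \<noteq> j" for i j w
    using assms
  proof (induction w arbitrary: \<phi>)
    case Nil
    have zero: "serre_E i j \<phi> = (\<lambda>v. 0)"
      using Nil that by (rule serre_kernelD_Nil)
    have "word_action (GF k) (serre_E i j \<phi>) = serre_E i j (word_action (GF k) \<phi>)"
      using N.q_serre_E_commutes_F[OF that, of k] unfolding endo_sel(2) by (rule fun_cong)
    then have "(\<lambda>v. lowering v k (\<lambda>v. 0)) = serre_E i j (\<lambda>v. lowering v k \<phi>)"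
      unfolding zero word_action.simps(2) .
    moreover have "lowering v k (\<lambda>v. 0) = 0" for v
      using lowering_linear(2)[of v k 0 "\<lambda>v. 0"] by simp
    ultimately show ?case by (simp only: append_Nil)
  next
    case (Cons l w)
    let ?\<psi> = "word_action (GE l) \<phi>"
    \<comment> \<open>This is (K_k - K_k^-1) \<phi>, the function left over when E_k is moved past
      F_k, apart from the factor \<open>qc k\<close>.\<close>
    define \<chi> where "\<chi> = (\<lambda>v. weight k v * \<phi> v + (-1) * (inverse (weight k v) * \<phi> v))"
    have "\<chi> \<in> serre_kernel"
      unfolding \<chi>_def
      by (rule function_subspace_add[OF function_subspace_serre_kernel _
            function_subspace_scale[OF function_subspace_serre_kernel]])
        (use serre_kernel_K[OF Cons.prems, of k] in \<open>simp_all only: word_action.simps\<close>)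
    then have \<chi>: "serre_E i j (\<lambda>v. \<chi> (w @ v)) = (\<lambda>v. 0)"
      using that by (rule serre_kernelD)
    have \<psi>: "serre_E i j (\<lambda>v. lowering (w @ v) k ?\<psi>) = (\<lambda>v. 0)"
      by (rule Cons.IH[OF serre_kernel_E[OF Cons.prems]])
    have eq: "(\<lambda>v. lowering ((l # w) @ v) k \<phi>) = (\<lambda>v. lowering (w @ v) k ?\<psi> +
        (if l = k then qc k else 0) * \<chi> (w @ v))"
      by (simp add: \<chi>_def fun_eq_iff algebra_simps)
    show ?case
      unfolding eq serre_E_linear \<psi> \<chi> by simp
  qed
  then show ?thesis by (simp add: serre_kernel_def)
qed

lemma serre_kernel_closed: "\<phi> \<in> serre_kernel \<Longrightarrow> word_action x \<phi> \<in> serre_kernel"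
  by (cases x) (simp_all only: serre_kernel_E serre_kernel_F serre_kernel_K)

text \<open>A Serre element has degree n + 1 with n = 1 - a_ij \<ge> 1, so it evaluates \<phi> only
  at words of length at least 2.\<close>

lemma serre_kernel_short:
  assumes "\<And>w. length w \<ge> 2 \<Longrightarrow> \<phi> w = 0" shows "\<phi> \<in> serre_kernel"
proof -
  have S: "q_serre (endo UNIV) p n t (word_action (GE i)) (word_action (GE j)) \<psi> v = 0"
    if "\<And>w. length w = length v + Suc n \<Longrightarrow> \<psi> w = 0" for p n t i j \<psi> v
    using that
  proof (induction n arbitrary: t \<psi> v)
    case (Suc n)
    then show ?case by (simp add: q_commutator_def endo_sel)
  qed simp
  have "serre_E i j (\<lambda>v. \<phi> (w @ v)) v = 0" if "i \<noteq> j" for i j w v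
    using off_diagonal[OF that] by (intro S assms) simp
  then show ?thesis by (auto simp: serre_kernel_def)
qed

abbreviation "serre_quotient \<equiv> quotient_algebra (endo serre_kernel) (annihilator serre_kernel)"
abbreviation "serre_coset \<equiv> (+>\<^bsub>endo serre_kernel\<^esub>) (annihilator serre_kernel)"

text \<open>The Serre elements in the F_j act by zero on all functions, those in the E_j on the
  subspace. Both lie in the annihilator and become zero in the quotient.\<close>

lemma serre_quotient_representation:
  "uq_representation a d q serre_quotient (\<lambda>x. serre_coset (word_action x))"
proof -
  note sub = function_subspace_serre_kernel
  note ideal = ideal_annihilator[OF sub] and alg = complex_algebra_endo[OF sub]
  interpret N: complex_algebra "endo serre_kernel" by (rule alg)
  note quot = N.quotient_complex_algebra[OF ideal] and hom = N.coset_algebra_hom[OF ideal]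
  note rel = word_action_relations[OF sub serre_kernel_closed]
  have act: "word_action x \<in> carrier (endo serre_kernel)" for x
    using rel by (auto simp: uq_cartan_relations_def)
  have zero: "serre_coset T = \<zero>\<^bsub>serre_quotient\<^esub>" if "T \<in> annihilator serre_kernel" for T
    using ring.a_rcos_zero[OF N.ring_axioms ideal that] by (simp add: quotient_algebra_sel(4))
  have serre: "q_serre serre_quotient p n t (serre_coset (word_action x)) (serre_coset (word_action y)) =
      serre_coset (q_serre (endo UNIV) p n t (word_action x) (word_action y))"
    "q_serre (endo UNIV) p n t (word_action x) (word_action y) \<in> carrier (endo serre_kernel)"
    for p n t x y
    using q_serre_hom[OF hom alg act act, of p n t x y]
    by (simp_all add: q_serre_endo_cong[of serre_kernel _ _ _ _ _ UNIV])
  show ?thesis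
  proof (intro uq_representation.intro uq_representation_axioms.intro quantum_datum_axioms quot)
    show "uq_relations a d q serre_quotient (\<lambda>x. serre_coset (word_action x))"
      unfolding uq_relations_def
    proof (intro conjI allI impI uq_cartan_relations_hom[OF hom alg quot rel])
      fix i j :: 'i assume ij: "i \<noteq> j"
      note serre_kernelD_Nil[OF _ ij]
      then show "q_serre serre_quotient (qi i) (serre_order i j) 1 (serre_coset (word_action (GE i)))
          (serre_coset (word_action (GE j))) = \<zero>\<^bsub>serre_quotient\<^esub>"
        unfolding serre(1) by (intro zero) (simp add: annihilator_def serre(2))
      show "q_serre serre_quotient (qi i) (serre_order i j) 1 (serre_coset (word_action (GF i)))
          (serre_coset (word_action (GF j))) = \<zero>\<^bsub>serre_quotient\<^esub>"
        unfolding serre(1)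
        by (intro zero) (use serre(2)[of "qi i" "serre_order i j" 1 "GF i" "GF j"]
            in \<open>simp add: annihilator_def serre_F_zero[OF ij]\<close>)
    qed
  qed
qed

text \<open>The functional is a matrix coefficient: apply an operator to the indicator function of
  the word [i] and evaluate at the empty word. E_i reads the letter i and gives 1, while 1 and K_i
  give multiples of the value 0.\<close>

lemma separating_functional:
  obtains f where "f \<in> linear_maps H complex_field" "f \<one>\<^bsub>H\<^esub> = 0" "f (\<iota> (gen (GK i))) = 0"
    "f (\<iota> (gen (GE i))) = 1"
proof -
  note sub = function_subspace_serre_kernel
  note ideal = ideal_annihilator[OF sub] and alg = complex_algebra_endo[OF sub]
  interpret N: complex_algebra "endo serre_kernel" by (rule alg)
  interpret Q: uq_representation a d q serre_quotient "\<lambda>x. serre_coset (word_action x)"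
    by (rule serre_quotient_representation)
  define \<delta> :: "'i list \<Rightarrow> complex" where "\<delta> w = (if w = [i] then 1 else 0)" for w
  have \<delta>: "\<delta> \<in> serre_kernel"
    by (rule serre_kernel_short) (auto simp: \<delta>_def)
  define g where "g T = T \<delta> []" for T :: "('i list \<Rightarrow> complex) \<Rightarrow> 'i list \<Rightarrow> complex"
  have g: "g \<in> linear_maps (endo serre_kernel) complex_field"
    by (rule linear_mapsI) (simp_all add: g_def endo_sel)
  have ker: "g T = \<zero>\<^bsub>complex_field\<^esub>" if "T \<in> annihilator serre_kernel" for T
    using that \<delta> by (simp add: g_def annihilator_def)
  let ?\<pi> = "presented_lift serre_quotient (\<lambda>x. serre_coset (word_action x))"
  let ?g = "\<lambda>X. the_elem (g ` X)"
  have g_coset: "?g (serre_coset T) = g T" if "T \<in> carrier (endo serre_kernel)" for T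
    using N.coset_image_eq[OF ideal g complex_algebra_complex_field ker that] by simp
  have act: "word_action x \<in> carrier (endo serre_kernel)" for x
    using word_action_relations[OF sub serre_kernel_closed] by (auto simp: uq_cartan_relations_def)
  have \<pi>: "?\<pi> \<in> algebra_homs H serre_quotient"
    using Q.uq_lift_hom by (simp add: uq_algebra_homs)
  show thesis
  proof (rule that)
    show "(\<lambda>X. ?g (?\<pi> X)) \<in> linear_maps H complex_field"
      by (rule linear_maps_comp[OF algebra_homs_linear[OF \<pi>]
            N.quotient_lift_linear[OF ideal g complex_algebra_complex_field ker]])
    show "?g (?\<pi> \<one>\<^bsub>H\<^esub>) = 0"
      using g_coset[OF N.one_closed]
      by (simp add: algebra_homs_one[OF \<pi>] quotient_algebra_sel(3) g_def endo_sel(3) \<delta>_def)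
    show "?g (?\<pi> (\<iota> (gen (GK i)))) = 0" "?g (?\<pi> (\<iota> (gen (GE i)))) = 1"
      unfolding Q.uq_lift_gen g_coset[OF act] by (simp_all add: g_def \<delta>_def)
  qed
qed

end

section \<open>Cocentral morphisms\<close>

lemma trivial_hopf_sel:
  "carrier trivial_hopf = UNIV" "mult trivial_hopf = (*)" "one trivial_hopf = 1"
  "zero trivial_hopf = 0" "add trivial_hopf = (+)" "smult trivial_hopf = (*)"
  "comult trivial_hopf = (\<lambda>z. pure_tensor complex_field complex_field z 1)"
  "counit trivial_hopf = id" "antipode trivial_hopf = id"
  by (simp_all add: trivial_hopf_def module.defs hopf_data.defs algebra_of_type_def)

lemma complex_algebra_trivial_hopf: "complex_algebra trivial_hopf"
  by (rule complex_algebra_cong[OF complex_algebra_complex_field])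
    (simp_all add: trivial_hopf_sel algebra_of_type_def)

lemma algebra_homs_trivial_hopf:
  "algebra_homs trivial_hopf B = algebra_homs complex_field B"
  "algebra_homs B trivial_hopf = algebra_homs B complex_field"
  by (simp_all add: algebra_homs_def linear_maps_def ring_hom_def trivial_hopf_sel)

lemma tensor_trivial_hopf: "pure_tensor trivial_hopf trivial_hopf = pure_tensor complex_field complex_field"
  by (rule tensor_cong) (simp_all add: trivial_hopf_sel algebra_of_type_def)

text \<open>The scalars are the initial complex algebra, so identities between algebra homomorphisms
  out of them are automatic. Coassociativity, the compatibility of the induced map with \<Delta> and
  \<epsilon>, and its uniqueness are all of this kind.\<close>

lemma trivial_hopf_homs_eq:
  "f \<in> algebra_homs trivial_hopf B \<Longrightarrow> g \<in> algebra_homs trivial_hopf B \<Longrightarrow> f x = g x"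
  unfolding algebra_homs_trivial_hopf by (simp add: algebra_homs_eqI_scalars)

interpretation trivial: algebra_pair trivial_hopf trivial_hopf
  by (intro algebra_pair.intro complex_algebra_trivial_hopf)

lemma comult_trivial_hopf: "comult trivial_hopf = (\<lambda>z. pure_tensor trivial_hopf trivial_hopf z \<one>\<^bsub>trivial_hopf\<^esub>)"
  by (simp add: trivial_hopf_sel tensor_trivial_hopf)

lemma comult_trivial_hopf_hom:
  "comult trivial_hopf \<in> algebra_homs trivial_hopf (tensor trivial_hopf trivial_hopf)"
  unfolding comult_trivial_hopf by (rule trivial.left_inclusion_hom)

lemma hopf_algebra_trivial_hopf: "hopf_algebra trivial_hopf"
proof (intro hopf_algebra.intro hopf_algebra_axioms.intro complex_algebra_trivial_hopf
    comult_trivial_hopf_hom)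
  note alg = complex_algebra_trivial_hopf trivial.complex_algebra_tensor
  have id: "id \<in> algebra_homs complex_field complex_field"
    by (rule id_algebra_hom)
  show "counit trivial_hopf \<in> algebra_homs trivial_hopf complex_field"
    by (simp add: algebra_homs_trivial_hopf trivial_hopf_sel id)
  show "antipode trivial_hopf \<in> linear_maps trivial_hopf trivial_hopf"
    by (rule linear_mapsI) (simp_all add: trivial_hopf_sel)
  fix x :: complex assume x: "x \<in> carrier trivial_hopf"
  show "tensor_assoc trivial_hopf trivial_hopf trivial_hopf
      (tensor_map (tensor trivial_hopf trivial_hopf) trivial_hopf (comult trivial_hopf) id
        (comult trivial_hopf x)) =
    tensor_map trivial_hopf (tensor trivial_hopf trivial_hopf) id (comult trivial_hopf)
      (comult trivial_hopf x)"
    by (rule trivial_hopf_homs_eq[OF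
          algebra_homs_comp[OF comult_trivial_hopf_hom algebra_homs_comp[OF
            tensor_map_hom[OF alg(1,1,2,1) comult_trivial_hopf_hom id_algebra_hom]
            tensor_assoc_hom[OF alg(1,1,1)]]]
          algebra_homs_comp[OF comult_trivial_hopf_hom
            tensor_map_hom[OF alg(1,1,1,2) id_algebra_hom comult_trivial_hopf_hom]]])
  \<comment> \<open>Counit and antipode are the identity here, so the four remaining axioms all
    concern the multiplication map.\<close>
  have "(\<lambda>y z. y * z) \<in> bilinear_maps trivial_hopf trivial_hopf trivial_hopf"
    by (intro bilinear_mapsI linear_mapsI) (simp_all add: trivial_hopf_sel algebra_simps)
  from trivial.tensor_lift_pure[OF alg(1) this x trivial.A.one_closed]
  have lift: "tensor_lift trivial_hopf (\<lambda>y z. y * z) (comult trivial_hopf x) = x"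
    by (simp add: comult_trivial_hopf trivial_hopf_sel(3))
  show "tensor_lift trivial_hopf (\<lambda>y z. counit trivial_hopf y \<odot>\<^bsub>trivial_hopf\<^esub> z) (comult trivial_hopf x) = x"
    "tensor_lift trivial_hopf (\<lambda>y z. counit trivial_hopf z \<odot>\<^bsub>trivial_hopf\<^esub> y) (comult trivial_hopf x) = x"
    "tensor_lift trivial_hopf (\<lambda>y z. antipode trivial_hopf y \<otimes>\<^bsub>trivial_hopf\<^esub> z) (comult trivial_hopf x) =
      counit trivial_hopf x \<odot>\<^bsub>trivial_hopf\<^esub> \<one>\<^bsub>trivial_hopf\<^esub>"
    "tensor_lift trivial_hopf (\<lambda>y z. y \<otimes>\<^bsub>trivial_hopf\<^esub> antipode trivial_hopf z) (comult trivial_hopf x) =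
      counit trivial_hopf x \<odot>\<^bsub>trivial_hopf\<^esub> \<one>\<^bsub>trivial_hopf\<^esub>"
    using lift by (simp_all add: trivial_hopf_sel(2,3,6,8,9) mult.commute[of "_ :: complex"])
qed

lemma (in complex_algebra) eigenvector_eq_zero:
  assumes x: "x \<in> carrier A" and eq: "x = c \<odot> x" and c: "c \<noteq> 1"
  shows "x = \<zero>"
proof -
  have "(1 - c) \<odot> x = x \<oplus> (- 1) \<odot> (c \<odot> x)"
    using x smul_add_left[of x 1 "- c"] by simp
  also have "\<dots> = \<zero>"
    using x by (simp add: r_neg smul_minus_one flip: eq)
  finally have "inverse (1 - c) \<odot> ((1 - c) \<odot> x) = \<zero>" by simp
  then show ?thesis using x c by simp
qed

section \<open>The counit as the Hopf cocenter\<close>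

context quantum_datum
begin

text \<open>Both (id \<otimes> \<epsilon>) \<Delta> and (id \<otimes> \<epsilon>) \<Delta>^op send x
  to x \<otimes> 1. All maps involved are algebra homomorphisms, so this is compared on
  generators.\<close>

lemma cocentral_counit: "cocentral_morphism H trivial_hopf (counit H)"
  unfolding cocentral_morphism_def hopf_morphism_def
proof (intro conjI ballI hopf_algebra_uq hopf_algebra_trivial_hopf)
  note alg = complex_algebra_uq complex_algebra_trivial_hopf
  interpret HT: algebra_pair H trivial_hopf
    using alg by (rule algebra_pair.intro)
  have counit: "counit H \<in> algebra_homs H trivial_hopf"
    by (simp add: algebra_homs_trivial_hopf counit_algebra_hom)
  then show "counit H \<in> algebra_homs H trivial_hopf" .
  fix x assume x: "x \<in> carrier H"
  show "counit trivial_hopf (counit H x) = counit H x"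
    by (simp add: trivial_hopf_sel)
  note lin = algebra_homs_linear[OF counit] algebra_homs_linear[OF id_algebra_hom]
  have one: "counit H \<one>\<^bsub>H\<^esub> = 1"
    using algebra_homs_one[OF counit] by (simp add: trivial_hopf_sel)
  have 0: "(0 :: complex) = \<zero>\<^bsub>trivial_hopf\<^esub>" "(1 :: complex) = \<one>\<^bsub>trivial_hopf\<^esub>"
    by (simp_all add: trivial_hopf_sel)
  have closed: "(z :: complex) \<in> carrier trivial_hopf" for z
    by (simp add: trivial_hopf_sel)
  show "comult trivial_hopf (counit H x) =
      tensor_map trivial_hopf trivial_hopf (counit H) (counit H) (comult H x)"
  proof (rule uq_homs_eqI[OF algebra_homs_comp[OF counit comult_trivial_hopf_hom]
        algebra_homs_comp[OF comult_algebra_hom tensor_map_hom[OF alg(1,1,2,2) counit counit]] _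
        trivial.complex_algebra_tensor x])
    fix y
    note simps = comult_gen counit_gen comult_trivial_hopf one
      algebra_homs_add[OF tensor_map_hom[OF alg(1,1,2,2) counit counit]]
      tensor_map_pure[OF alg(1,1,2,2) lin(1,1)]
    show "comult trivial_hopf (counit H (\<iota> (gen y))) =
        tensor_map trivial_hopf trivial_hopf (counit H) (counit H) (comult H (\<iota> (gen y)))"
      by (cases y) (simp_all add: simps 0 trivial.pure_tensor_zero closed)
  qed
  show "tensor_map H trivial_hopf id (counit H) (comult H x) =
      tensor_map H trivial_hopf id (counit H) (tensor_flip H H (comult H x))"
  proof (rule uq_homs_eqI[OF
        algebra_homs_comp[OF comult_algebra_hom tensor_map_hom[OF alg(1,1,1,2) id_algebra_hom counit]]
        algebra_homs_comp[OF comult_algebra_hom algebra_homs_comp[OF tensor_flip_hom[OF alg(1,1)]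
            tensor_map_hom[OF alg(1,1,1,2) id_algebra_hom counit]]] _
        HT.complex_algebra_tensor x])
    fix y
    note simps = comult_gen counit_gen one
      algebra_homs_add[OF tensor_map_hom[OF alg(1,1,1,2) id_algebra_hom counit]]
      algebra_homs_add[OF tensor_flip_hom[OF alg(1,1)]] tensor_flip_pure[OF alg(1,1)]
      tensor_map_pure[OF alg(1,1,1,2) lin(2,1)]
    show "tensor_map H trivial_hopf id (counit H) (comult H (\<iota> (gen y))) =
        tensor_map H trivial_hopf id (counit H) (tensor_flip H H (comult H (\<iota> (gen y))))"
      by (cases y) (simp_all add: simps 0 HT.pure_tensor_zero closed)
  qed
qed

lemma cocentral_eq_counit:
  assumes cocentral: "cocentral_morphism H B \<pi>" and x: "x \<in> carrier H"
  shows "\<pi> x = counit H x \<odot>\<^bsub>B\<^esub> \<one>\<^bsub>B\<^esub>"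
proof -
  have "hopf_algebra B" and \<pi>: "\<pi> \<in> algebra_homs H B"
    and eq: "\<And>x. x \<in> carrier H \<Longrightarrow> tensor_map H B id \<pi> (comult H x) =
      tensor_map H B id \<pi> (tensor_flip H H (comult H x))"
    using cocentral by (auto simp: cocentral_morphism_def hopf_morphism_def)
  then have alg: "complex_algebra H" "complex_algebra B"
    by (simp_all add: complex_algebra_uq hopf_algebra.axioms)
  interpret B: complex_algebra B by (rule alg)
  interpret HB: algebra_pair H B using alg by (rule algebra_pair.intro)
  note lin = algebra_homs_linear[OF id_algebra_hom] algebra_homs_linear[OF \<pi>]
  note closed = algebra_homs_closed[OF \<pi>]
  have K: "\<pi> (R.K i) = \<one>\<^bsub>B\<^esub>" for i
  proof -
    obtain f where f: "f \<in> linear_maps H complex_field" "f \<one>\<^bsub>H\<^esub> = 0" "f (R.K i) = 0" "f (R.E i) = 1"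
      by (rule separating_functional)
    \<comment> \<open>Applying f to the left leg turns the identity in H \<otimes> B into one in B.
      Since f kills 1 and K_i, only \<pi>(K_i) = 1 remains.\<close>
    have bil: "(\<lambda>x b. f x \<odot>\<^bsub>B\<^esub> b) \<in> bilinear_maps H B B"
      using linear_maps_add[OF f(1)] linear_maps_smult[OF f(1)]
      by (intro bilinear_mapsI linear_mapsI)
        (simp_all add: B.smul_add_left B.smul_add_right mult.commute)
    note pure = HB.tensor_lift_pure[OF alg(2) bil]
    note add = linear_maps_add[OF HB.tensor_lift_linear[OF alg(2) bil]]
    note simps = comult_gen algebra_homs_add[OF tensor_map_hom[OF alg(1,1,1,2) id_algebra_hom \<pi>]]
      tensor_map_pure[OF alg(1,1,1,2) lin] algebra_homs_add[OF tensor_flip_hom[OF alg(1,1)]]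
      tensor_flip_pure[OF alg(1,1)]
    have "tensor_lift B (\<lambda>x b. f x \<odot>\<^bsub>B\<^esub> b) (tensor_map H B id \<pi> (comult H (R.E i))) =
        tensor_lift B (\<lambda>x b. f x \<odot>\<^bsub>B\<^esub> b) (tensor_map H B id \<pi> (tensor_flip H H (comult H (R.E i))))"
      by (simp add: eq)
    then show ?thesis
      by (simp add: simps pure add closed f algebra_homs_one[OF \<pi>])
  qed
  have L: "\<pi> (R.L i) = \<one>\<^bsub>B\<^esub>" for i
    using algebra_homs_mult[OF \<pi>, of "R.K i" "R.L i"] closed[of "R.L i"]
    by (simp add: K algebra_homs_one[OF \<pi>])
  \<comment> \<open>Here q_i^(a_ii) = q^(2 d_i), and the hypothesis on q enters.\<close>
  have qa: "qa i i \<noteq> 1" for i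
    using q_power[of i] by (simp add: diagonal power_mult mult.commute)
  have E: "\<pi> (R.E i) = \<zero>\<^bsub>B\<^esub>" for i
  proof (rule B.eigenvector_eq_zero[OF _ _ qa])
    have "\<pi> (R.K i \<otimes>\<^bsub>H\<^esub> R.E i) = \<pi> (qa i i \<odot>\<^bsub>H\<^esub> (R.E i \<otimes>\<^bsub>H\<^esub> R.K i))"
      by (simp only: R.K_E)
    then show "\<pi> (R.E i) = qa i i \<odot>\<^bsub>B\<^esub> \<pi> (R.E i)"
      by (simp add: algebra_homs_simps[OF \<pi>] K)
  qed (simp add: closed)
  have F: "\<pi> (R.F i) = \<zero>\<^bsub>B\<^esub>" for i
  proof (rule B.eigenvector_eq_zero)
    have "\<pi> (R.K i \<otimes>\<^bsub>H\<^esub> R.F i) = \<pi> (inverse (qa i i) \<odot>\<^bsub>H\<^esub> (R.F i \<otimes>\<^bsub>H\<^esub> R.K i))"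
      by (simp only: R.K_F)
    then show "\<pi> (R.F i) = inverse (qa i i) \<odot>\<^bsub>B\<^esub> \<pi> (R.F i)"
      by (simp add: algebra_homs_simps[OF \<pi>] K)
    show "inverse (qa i i) \<noteq> 1"
      using qa[of i] by (metis inverse_1 inverse_inverse_eq)
  qed (simp add: closed)
  show ?thesis
  proof (rule uq_homs_eqI[OF \<pi> algebra_homs_comp[OF counit_algebra_hom B.scalar_algebra_hom] _ alg(2) x])
    show "\<pi> (\<iota> (gen y)) = counit H (\<iota> (gen y)) \<odot>\<^bsub>B\<^esub> \<one>\<^bsub>B\<^esub>" for y
      by (cases y) (simp_all add: K L E F counit_gen)
  qed
qed

text \<open>By \<open>cocentral_eq_counit\<close> every cocentral morphism factors through the unit
  map of its target, and algebra homomorphisms out of the scalars are unique.\<close>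

lemma hopf_cocenter_uq: "is_hopf_cocenter TYPE('b) H trivial_hopf (counit H)"
  unfolding is_hopf_cocenter_def
proof (intro conjI allI impI cocentral_counit)
  have "c = counit H (c \<odot>\<^bsub>H\<^esub> \<one>\<^bsub>H\<^esub>)" for c
    using algebra_homs_smult[OF counit_algebra_hom, of "\<one>\<^bsub>H\<^esub>" c]
      algebra_homs_one[OF counit_algebra_hom] by simp
  then show "counit H ` carrier H = carrier trivial_hopf"
    unfolding trivial_hopf_sel by blast
  fix B :: "'b hopf_data" and f
  assume f: "cocentral_morphism H B f"
  then have B: "hopf_algebra B"
    by (simp add: cocentral_morphism_def hopf_morphism_def)
  interpret B: hopf_algebra B by fact
  note alg = complex_algebra_trivial_hopf B.complex_algebra_axioms
  define g where "g c = c \<odot>\<^bsub>B\<^esub> \<one>\<^bsub>B\<^esub>" for c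
  have g: "g \<in> algebra_homs trivial_hopf B"
    unfolding g_def[abs_def] algebra_homs_trivial_hopf by (rule B.scalar_algebra_hom)
  have morphism: "hopf_morphism trivial_hopf B g"
    unfolding hopf_morphism_def
  proof (intro conjI ballI hopf_algebra_trivial_hopf B g)
    fix c :: complex
    show "comult B (g c) = tensor_map B B g g (comult trivial_hopf c)"
      by (rule trivial_hopf_homs_eq[OF algebra_homs_comp[OF g B.comult_hom]
            algebra_homs_comp[OF comult_trivial_hopf_hom tensor_map_hom[OF alg(1,1,2,2) g g]]])
    show "counit B (g c) = counit trivial_hopf c"
      by (rule trivial_hopf_homs_eq[OF algebra_homs_comp[OF g B.counit_hom]
            hopf_algebra.counit_hom[OF hopf_algebra_trivial_hopf]])
  qed
  show "\<exists>!g. g \<in> extensional (carrier trivial_hopf) \<and> hopf_morphism trivial_hopf B g \<and>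
      (\<forall>x\<in>carrier H. g (counit H x) = f x)"
  proof (rule ex1I[of _ g])
    show "g \<in> extensional (carrier trivial_hopf) \<and> hopf_morphism trivial_hopf B g \<and>
        (\<forall>x\<in>carrier H. g (counit H x) = f x)"
      using morphism cocentral_eq_counit[OF f] by (simp add: g_def trivial_hopf_sel extensional_def)
    fix h assume "h \<in> extensional (carrier trivial_hopf) \<and> hopf_morphism trivial_hopf B h \<and>
        (\<forall>x\<in>carrier H. h (counit H x) = f x)"
    then have "h \<in> algebra_homs trivial_hopf B"
      by (simp add: hopf_morphism_def)
    then show "h = g"
      using trivial_hopf_homs_eq[OF _ g] by blast
  qed
qed

end

section \<open>The Cartan matrix of a simple Lie algebra\<close>

text \<open>Applying T - \<mu>_m to the relation removes the term of index m and multiplies the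
  others by nonzero scalars.\<close>

lemma (in vector_space) eigenvectors_independent:
  assumes lin: "Vector_Spaces.linear scale scale T" and "finite S"
    and eig: "\<And>k. k \<in> S \<Longrightarrow> T (v k) = scale (\<mu> k) (v k)" and nz: "\<And>k. k \<in> S \<Longrightarrow> v k \<noteq> 0"
    and inj: "inj_on \<mu> S" and sum: "(\<Sum>k\<in>S. scale (c k) (v k)) = 0" and k: "k \<in> S"
  shows "c k = 0"
  using \<open>finite S\<close> eig nz inj sum k
proof (induction S arbitrary: c k)
  case (insert m S)
  interpret T: Vector_Spaces.linear scale scale T by (rule lin)
  have "T (\<Sum>k\<in>insert m S. scale (c k) (v k)) = (\<Sum>k\<in>insert m S. scale (c k * \<mu> k) (v k))"
    unfolding T.sum by (intro sum.cong refl) (simp add: T.scale insert.prems(1))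
  then have 1: "(\<Sum>k\<in>insert m S. scale (c k * \<mu> k) (v k)) = 0"
    unfolding insert.prems(4) by simp
  have "(\<Sum>k\<in>insert m S. scale (\<mu> m * c k) (v k)) = scale (\<mu> m) (\<Sum>k\<in>insert m S. scale (c k) (v k))"
    by (simp only: scale_sum_right scale_scale)
  then have 2: "(\<Sum>k\<in>insert m S. scale (\<mu> m * c k) (v k)) = 0"
    unfolding insert.prems(4) by simp
  have "(\<Sum>k\<in>insert m S. scale (c k * \<mu> k - \<mu> m * c k) (v k)) = 0"
    using 1 2 by (simp only: scale_left_diff_distrib sum_subtractf) simp
  then have "(\<Sum>k\<in>S. scale (c k * (\<mu> k - \<mu> m)) (v k)) = 0"
    using insert.hyps by (simp add: algebra_simps)
  then have zero: "c k * (\<mu> k - \<mu> m) = 0" if "k \<in> S" for k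
    using insert.prems(1-3) that by (intro insert.IH) auto
  have S: "c k = 0" if "k \<in> S" for k
  proof -
    have "\<mu> k \<noteq> \<mu> m" using inj_onD[OF insert.prems(3), of k m] insert.hyps(2) that by auto
    then show ?thesis using zero[OF that] by simp
  qed
  then have "scale (c m) (v m) = 0"
    using insert.prems(4) insert.hyps by simp
  then have "c m = 0" using insert.prems(2)[of m] by simp
  then show ?case using S insert.prems(5) by blast
qed simp

section \<open>Weights, root vectors and root strings\<close>

context simple_lie_datum
begin

lemma br_simps:
  "br x (y + z) = br x y + br x z" "br (x + y) z = br x z + br y z"
  "br x (scale c y) = scale c (br x y)" "br (scale c x) y = scale c (br x y)"
  using br_linear_right[of x] br_linear_left[of z] br_linear_left[of y]
  by (simp_all add: Vector_Spaces.linear_iff)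

lemma br_zero: "br x 0 = 0"
  using br_simps(3)[of x 0 0] by simp

lemma br_anticommute: "br x y = - br y x"
proof -
  have "br (x + y) (x + y) = br x y + br y x"
    unfolding br_simps by (simp add: br_self)
  then show ?thesis by (simp add: br_self eq_neg_iff_add_eq_0)
qed

lemma br_uminus: "br x (- y) = - br x y"
  using br_simps(3)[of x "-1" y] by simp

lemma br_br: "br x (br y z) = br (br x y) z + br y (br x z)"
proof -
  have "br x (br y z) = - br y (br z x) - br z (br x y)"
    using jacobi[of x y z] by (simp add: algebra_simps eq_neg_iff_add_eq_0)
  then show ?thesis
    by (simp add: br_anticommute[of z x] br_anticommute[of z "br x y"] br_uminus)
qed

lemma kappa_simps:
  "\<kappa> x (y + z) = \<kappa> x y + \<kappa> x z" "\<kappa> x (scale c y) = c * \<kappa> x y"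
  "\<kappa> (scale c x) y = c * \<kappa> x y" "\<kappa> x y = \<kappa> y x" "\<kappa> (br x y) z = \<kappa> x (br y z)"
proof -
  have lin: "Vector_Spaces.linear scale (*) (\<kappa> x)" and sym: "\<kappa> x y = \<kappa> y x"
    and inv: "\<kappa> (br x y) z = \<kappa> x (br y z)" for x y z
    using form by (auto simp: invariant_form_def)
  show "\<kappa> x y = \<kappa> y x" "\<kappa> (br x y) z = \<kappa> x (br y z)" by (rule sym inv)+
  show "\<kappa> x (y + z) = \<kappa> x y + \<kappa> x z" "\<kappa> x (scale c y) = c * \<kappa> x y"
    using lin[of x] by (simp_all add: Vector_Spaces.linear_iff)
  show "\<kappa> (scale c x) y = c * \<kappa> x y"
    using lin[of y] by (simp add: sym[of _ y] Vector_Spaces.linear_iff)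
qed

lemma kappa_nondegenerate: "(\<And>y. \<kappa> x y = 0) \<Longrightarrow> x = 0"
  using form by (auto simp: invariant_form_def)

text \<open>In contrast to \<open>roots\<close>, \<mu> is not normalized outside H and the zero
  vector has every weight. Weights can then be added and negated as plain functions.\<close>

definition has_weight :: "'g \<Rightarrow> ('g \<Rightarrow> complex) \<Rightarrow> bool" where
  "has_weight x \<mu> \<longleftrightarrow> (\<forall>h\<in>H. br h x = scale (\<mu> h) x)"

lemma subspace_H: "subspace H" and H_abelian: "x \<in> H \<Longrightarrow> y \<in> H \<Longrightarrow> br x y = 0"
  and H_centralizer: "(\<And>h. h \<in> H \<Longrightarrow> br h x = 0) \<Longrightarrow> x \<in> H"
  and weights_span: "span {x. \<exists>\<mu>. has_weight x \<mu>} = UNIV"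
  using cartan unfolding cartan_subalgebra_def has_weight_def by blast+

lemma has_weight_br:
  assumes "has_weight x \<mu>" "has_weight y \<nu>"
  shows "has_weight (br x y) (\<lambda>h. \<mu> h + \<nu> h)"
  using assms unfolding has_weight_def by (simp add: br_br[of _ x y] br_simps scale_left_distrib)

text \<open>Invariance moves \<open>br h\<close> from x to y at the cost of a sign, so (\<mu>(h) +
  \<nu>(h)) \<kappa>(x, y) = 0.\<close>

lemma weights_orthogonal:
  assumes x: "has_weight x \<mu>" and y: "has_weight y \<nu>" and xy: "\<kappa> x y \<noteq> 0" and h: "h \<in> H"
  shows "\<nu> h = - \<mu> h"
proof -
  have "\<mu> h * \<kappa> x y = \<kappa> (br h x) y"
    using x h by (simp add: has_weight_def kappa_simps(3))
  also have "\<dots> = \<kappa> (scale (-1) (br x h)) y"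
    by (simp add: br_anticommute[of h x])
  also have "\<dots> = - (\<nu> h * \<kappa> x y)"
    unfolding kappa_simps(3) kappa_simps(5) using y h by (simp add: has_weight_def kappa_simps(2))
  finally have "(\<nu> h + \<mu> h) * \<kappa> x y = 0" by (simp add: distrib_right)
  then show ?thesis using xy by (simp add: eq_neg_iff_add_eq_0)
qed

lemma kappa_eq_0_on_weights:
  assumes "\<And>y \<nu>. has_weight y \<nu> \<Longrightarrow> \<kappa> x y = 0"
  shows "x = 0"
proof (rule kappa_nondegenerate)
  have "\<kappa> x 0 = 0" using kappa_simps(2)[of x 0 0] by simp
  then have "subspace {y. \<kappa> x y = 0}" by (simp add: subspace_def kappa_simps(1,2))
  then have "span {x. \<exists>\<mu>. has_weight x \<mu>} \<subseteq> {y. \<kappa> x y = 0}"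
    using assms by (intro span_minimal) auto
  then have "UNIV \<subseteq> {y. \<kappa> x y = 0}" by (simp only: weights_span)
  then show "\<kappa> x y = 0" for y by (simp add: subset_iff)
qed

text \<open>A weight vector that is not orthogonal to t in H has weight 0, and so lies in H because
  H is its own centralizer. Orthogonality to H is therefore orthogonality to everything.\<close>

lemma kappa_nondegenerate_H:
  assumes t: "t \<in> H" and zero: "\<And>h. h \<in> H \<Longrightarrow> \<kappa> t h = 0"
  shows "t = 0"
proof (rule kappa_eq_0_on_weights)
  fix y \<nu> assume y: "has_weight y \<nu>"
  show "\<kappa> t y = 0"
  proof (rule ccontr)
    assume "\<kappa> t y \<noteq> 0"
    moreover have "has_weight t (\<lambda>_. 0)" using t by (simp add: has_weight_def H_abelian)
    ultimately have "\<nu> h = - 0" if "h \<in> H" for h by (rule weights_orthogonal[OF _ y _ that, rotated])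
    then have "y \<in> H" using y by (intro H_centralizer) (simp add: has_weight_def)
    then show False using zero[of y] \<open>\<kappa> t y \<noteq> 0\<close> by blast
  qed
qed

text \<open>Nondegeneracy gives a weight vector paired nontrivially with e, necessarily of weight -
  \<beta>. Normalizing \<kappa>(e, f) = 1 makes \<open>br e f\<close> exactly the vector dual to
  \<beta>, and nondegeneracy on H makes that vector unique. In this scaling t acts on e by (\<beta>,
  \<beta>), where a standard triple has 2.\<close>

lemma root_triple:
  assumes "\<beta> \<in> roots H"
  obtains e f t where "e \<noteq> 0" "has_weight e \<beta>" "has_weight f (\<lambda>h. - \<beta> h)" "br e f = t" "t \<in> H"
    "\<forall>h\<in>H. \<kappa> t h = \<beta> h" "dual_vector H \<kappa> \<beta> = t"
proof -
  obtain e where e: "e \<noteq> 0" "has_weight e \<beta>"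
    using assms by (auto simp: roots_def has_weight_def)
  obtain y \<nu> where y: "has_weight y \<nu>" "\<kappa> e y \<noteq> 0"
    using kappa_eq_0_on_weights[of e] e(1) by blast
  have \<nu>: "\<nu> h = - \<beta> h" if "h \<in> H" for h
    using weights_orthogonal[OF e(2) y that] .
  define f where "f = scale (1 / \<kappa> e y) y"
  have f: "has_weight f (\<lambda>h. - \<beta> h)"
    using y(1) \<nu> by (simp add: f_def has_weight_def br_simps scale_left_commute)
  have "\<kappa> e f = 1"
    using y by (simp add: f_def kappa_simps(2))
  have t: "br e f \<in> H"
    using has_weight_br[OF e(2) f] by (intro H_centralizer) (simp add: has_weight_def)
  have th: "\<kappa> (br e f) h = \<beta> h" if "h \<in> H" for h
  proof -
    have "br f h = scale (\<beta> h) f"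
      using f that by (simp add: has_weight_def br_anticommute[of f h])
    then show ?thesis
      by (simp add: kappa_simps(5) kappa_simps(2) \<open>\<kappa> e f = 1\<close>)
  qed
  have dual: "dual_vector H \<kappa> \<beta> = br e f"
    unfolding dual_vector_def
  proof (rule the_equality)
    show "br e f \<in> H \<and> (\<forall>h\<in>H. \<kappa> (br e f) h = \<beta> h)" using t th by simp
    fix s assume s: "s \<in> H \<and> (\<forall>h\<in>H. \<kappa> s h = \<beta> h)"
    have "s - br e f = 0"
    proof (rule kappa_nondegenerate_H)
      show "s - br e f \<in> H" using s t subspace_H by (simp add: subspace_diff)
      fix h assume "h \<in> H"
      then have "\<kappa> h s = \<kappa> h (br e f)"
        using s th by (simp add: kappa_simps(4)[of h])
      then show "\<kappa> (s - br e f) h = 0"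
        using kappa_simps(1)[of h "s - br e f" "br e f"] by (simp add: kappa_simps(4)[of _ h])
    qed
    then show "s = br e f" by simp
  qed
  show thesis by (rule that[OF e f refl t ballI[OF th] dual])
qed

lemma simple_root: "\<alpha> i \<in> roots H"
  and simple_independent: "(\<And>h. h \<in> H \<Longrightarrow> (\<Sum>i\<in>UNIV. c i * \<alpha> i h) = 0) \<Longrightarrow> c i = 0"
  and root_decomposition: "\<beta> \<in> roots H \<Longrightarrow> \<exists>n :: 'i \<Rightarrow> nat.
    (\<forall>h\<in>H. \<beta> h = (\<Sum>i\<in>UNIV. of_nat (n i) * \<alpha> i h)) \<or>
    (\<forall>h\<in>H. \<beta> h = - (\<Sum>i\<in>UNIV. of_nat (n i) * \<alpha> i h))"
  using simple by (auto simp: simple_roots_def)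

text \<open>The coefficients of a root over the simple roots have one sign and are unique by
  independence, whereas \<alpha>_j - \<alpha>_i has the coefficients 1 and -1.\<close>

lemma simple_difference_not_weight:
  assumes "i \<noteq> j" and x: "has_weight x (\<lambda>h. \<alpha> j h - \<alpha> i h)"
  shows "x = 0"
proof (rule ccontr)
  assume "x \<noteq> 0"
  define c :: "'i \<Rightarrow> complex" where "c k = (if k = j then 1 else if k = i then -1 else 0)" for k
  have c: "(\<Sum>k\<in>UNIV. c k * \<alpha> k h) = \<alpha> j h - \<alpha> i h" for h
  proof -
    have "(\<Sum>k\<in>UNIV. c k * \<alpha> k h) = (\<Sum>k\<in>UNIV. (if k = j then \<alpha> k h else 0) - (if k = i then \<alpha> k h else 0))"
      using assms(1) by (intro sum.cong) (auto simp: c_def)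
    then show ?thesis by (simp add: sum_subtractf)
  qed
  have "\<exists>h\<in>H. \<alpha> j h - \<alpha> i h \<noteq> 0"
  proof (rule ccontr)
    assume "\<not> ?thesis"
    then have "(\<Sum>k\<in>UNIV. c k * \<alpha> k h) = 0" if "h \<in> H" for h using that by (simp add: c)
    then have "c j = 0" by (rule simple_independent)
    then show False by (simp add: c_def)
  qed
  \<comment> \<open>Elements of \<open>roots\<close> are extensional functions, hence the
    restriction to H.\<close>
  then have "restrict (\<lambda>h. \<alpha> j h - \<alpha> i h) H \<in> roots H"
    using x \<open>x \<noteq> 0\<close> by (auto simp: roots_def has_weight_def)
  then obtain n :: "'i \<Rightarrow> nat" where "(\<forall>h\<in>H. \<alpha> j h - \<alpha> i h = (\<Sum>k\<in>UNIV. of_nat (n k) * \<alpha> k h)) \<or>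
      (\<forall>h\<in>H. \<alpha> j h - \<alpha> i h = - (\<Sum>k\<in>UNIV. of_nat (n k) * \<alpha> k h))"
    using root_decomposition by fastforce
  then show False
  proof
    assume n: "\<forall>h\<in>H. \<alpha> j h - \<alpha> i h = (\<Sum>k\<in>UNIV. of_nat (n k) * \<alpha> k h)"
    have "c i - of_nat (n i) = 0"
      by (rule simple_independent[of "\<lambda>k. c k - of_nat (n k)"])
        (use n in \<open>simp add: left_diff_distrib sum_subtractf c\<close>)
    moreover have "of_nat (Suc (n i)) = - (c i - of_nat (n i))" using assms(1) by (simp add: c_def)
    ultimately have "of_nat (Suc (n i)) = (0 :: complex)" by (simp only: minus_zero)
    then show False by (simp only: of_nat_eq_0_iff)
  next
    assume n: "\<forall>h\<in>H. \<alpha> j h - \<alpha> i h = - (\<Sum>k\<in>UNIV. of_nat (n k) * \<alpha> k h)"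
    have "c j + of_nat (n j) = 0"
      by (rule simple_independent[of "\<lambda>k. c k + of_nat (n k)"])
        (use n in \<open>simp add: distrib_right sum.distrib c\<close>)
    then have "of_nat (Suc (n j)) = (0 :: complex)" by (simp add: c_def)
    then show False by (simp only: of_nat_eq_0_iff)
  qed
qed

lemma dual_form_nonzero: "\<beta> \<in> roots H \<Longrightarrow> dual_form H \<kappa> \<beta> \<beta> \<noteq> 0"
  using roots_length_ge[of \<beta>] by auto

text \<open>A root vector for \<open>\<alpha>\<^sub>j\<close> is a lowest weight vector for the \<open>sl\<^sub>2\<close>-triple of \<open>\<alpha>\<^sub>i\<close>, since
  \<open>\<alpha>\<^sub>j - \<alpha>\<^sub>i\<close> is not a root. The string through it has finite length \<open>n + 1\<close>, and then \<open>a\<^bsub>ij\<^esub> = -n\<close>.\<close>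

lemma cartan_matrix_off_diagonal:
  assumes "i \<noteq> j" shows "a i j \<le> 0"
proof -
  obtain e f t where e: "e \<noteq> 0" "has_weight e (\<alpha> i)" and f: "has_weight f (\<lambda>h. - \<alpha> i h)"
    and ef: "br e f = t" and t: "t \<in> H" "\<forall>h\<in>H. \<kappa> t h = \<alpha> i h" "dual_vector H \<kappa> (\<alpha> i) = t"
    using root_triple[OF simple_root[of i]] by blast
  obtain v f' t' where v: "v \<noteq> 0" "has_weight v (\<alpha> j)"
    and f': "has_weight f' (\<lambda>h. - \<alpha> j h)" "br v f' = t'"
    and t': "t' \<in> H" "\<forall>h\<in>H. \<kappa> t' h = \<alpha> j h" "dual_vector H \<kappa> (\<alpha> j) = t'"
    using root_triple[OF simple_root[of j]] by blast
  define c s where "c = \<alpha> i t" and "s = \<alpha> j t"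
  have c: "dual_form H \<kappa> (\<alpha> i) (\<alpha> i) = c"
    using t by (simp add: dual_form_def c_def)
  have s: "dual_form H \<kappa> (\<alpha> i) (\<alpha> j) = s"
    using t t' by (simp add: dual_form_def s_def kappa_simps(4)[of t t'])
  have c_nz: "c \<noteq> 0"
    using dual_form_nonzero[OF simple_root[of i]] c by simp
  define V where "V n = ((br e) ^^ n) v" for n
  have V_Suc: "V (Suc n) = br e (V n)" for n
    by (simp add: V_def)
  have weight: "has_weight (V n) (\<lambda>h. \<alpha> j h + of_nat n * \<alpha> i h)" for n
  proof (induction n)
    case (Suc n)
    then show ?case
      using has_weight_br[OF e(2) Suc] by (simp add: V_Suc algebra_simps)
  qed (simp add: V_def v)
  then have tV: "br t (V n) = scale (s + of_nat n * c) (V n)" for n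
    using t(1) by (simp add: has_weight_def s_def c_def)
  have fe: "br (br f e) x = scale (-1) (br t x)" for x
    using br_simps(4)[of "-1" t x] by (simp add: br_anticommute[of f e] ef)
  \<comment> \<open>Each time f passes one of the e it leaves - t. The coefficient is minus the sum
    of the eigenvalues s + k c of t for k = 0, ..., n.\<close>
  have fV: "br f (V (Suc n)) = scale (- (of_nat (Suc n) * (s + of_nat n * c / 2))) (V n)" for n
  proof (induction n)
    case 0
    have "br f v = 0"
      using simple_difference_not_weight[OF assms, of "br f v"] has_weight_br[OF f v(2)] by simp
    then have "br f (V (Suc 0)) = scale (-1) (br t (V 0))"
      by (simp add: V_def br_br[of f e] fe br_zero)
    then show ?case by (simp only: tV scale_scale) simp
  next
    case (Suc n)
    have "br f (V (Suc (Suc n))) = br (br f e) (V (Suc n)) + br e (br f (V (Suc n)))"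
      unfolding V_Suc[of "Suc n"] by (rule br_br)
    also have "br (br f e) (V (Suc n)) = scale (-1) (br t (V (Suc n)))"
      by (rule fe)
    also have "br e (br f (V (Suc n))) = scale (- (of_nat (Suc n) * (s + of_nat n * c / 2))) (V (Suc n))"
      by (simp only: Suc.IH br_simps(3) V_Suc[symmetric])
    finally have "br f (V (Suc (Suc n))) = scale (- 1 * (s + of_nat (Suc n) * c) +
        - (of_nat (Suc n) * (s + of_nat n * c / 2))) (V (Suc n))"
      unfolding scale_left_distrib by (simp only: tV scale_scale)
    also have "- 1 * (s + of_nat (Suc n) * c) + - (of_nat (Suc n) * (s + of_nat n * c / 2)) =
        - (of_nat (Suc (Suc n)) * (s + of_nat (Suc n) * c / 2))"
      by (simp add: field_simps)
    finally show ?case .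
  qed
  \<comment> \<open>Otherwise the V_n would be eigenvectors of \<open>br t\<close> with the pairwise
    distinct eigenvalues s + n c, an infinite independent family.\<close>
  have "\<exists>n. V n = 0"
  proof (rule ccontr)
    assume "\<not> ?thesis"
    then have nz: "V n \<noteq> 0" for n by blast
    have inj_eig: "inj_on (\<lambda>n. s + of_nat n * c) S" for S :: "nat set"
      using c_nz by (auto intro!: inj_onI)
    have inj: "inj V"
    proof (rule injI)
      fix m n assume "V m = V n"
      then have "scale (s + of_nat m * c) (V n) = scale (s + of_nat n * c) (V n)"
        using tV[of m] tV[of n] by metis
      then show "m = n" using nz[of n] c_nz by auto
    qed
    have "independent (range V)"
    proof
      assume "dependent (range V)"
      then obtain S u w where S: "finite S" "S \<subseteq> range V" "w \<in> S" "u w \<noteq> 0"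
        and sum: "(\<Sum>v\<in>S. scale (u v) v) = 0"
        unfolding dependent_explicit by blast
      obtain N where N: "S = V ` N" using S(2) by (meson subset_imageE)
      have injN: "inj_on V N" using inj by (rule inj_on_subset) simp
      have "finite N" using S(1) injN unfolding N by (rule finite_imageD)
      moreover have "(\<Sum>n\<in>N. scale (u (V n)) (V n)) = 0"
        using sum unfolding N by (simp add: sum.reindex[OF injN])
      ultimately have "u (V n) = 0" if "n \<in> N" for n
        using eigenvectors_independent[OF br_linear_right[of t], of N V "\<lambda>n. s + of_nat n * c"
            "\<lambda>n. u (V n)" n] tV nz inj_eig that by blast
      then show False using S(3,4) N by blast
    qed
    moreover obtain B where "finite B" "span B = UNIV" using finite_dimensional by blast
    ultimately have "finite (range V)"
      using independent_span_bound[of B "range V"] by simp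
    then show False using inj finite_imageD infinite_UNIV_nat by blast
  qed
  then obtain n where n: "V n = 0" "\<And>m. m < n \<Longrightarrow> V m \<noteq> 0"
    using exists_least_iff[of "\<lambda>n. V n = 0"] by blast
  have "V 0 \<noteq> 0" using v(1) by (simp add: V_def)
  then have "n \<noteq> 0" using n(1) by metis
  then obtain m where m: "n = Suc m" by (meson not0_implies_Suc)
  \<comment> \<open>V_m is the last nonzero vector of the string, so f applied to V_(m+1) = 0 forces
    its coefficient to vanish. That gives s = - m c / 2 and a_ij = 2 s / c = - m.\<close>
  have "scale (- (of_nat (Suc m) * (s + of_nat m * c / 2))) (V m) = 0"
    using fV[of m] n(1) by (simp add: m br_zero)
  then have "of_nat (Suc m) * (s + of_nat m * c / 2) = 0"
    using n(2)[of m] m by (simp del: of_nat_Suc)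
  then have "s + of_nat m * c / 2 = 0"
    unfolding mult_eq_0_iff of_nat_eq_0_iff by blast
  then have "2 * s / c = - of_nat m"
    using c_nz by (simp add: field_simps eq_neg_iff_add_eq_0)
  then have "(of_int (a i j) :: complex) = of_int (- int m)"
    using cartan_matrix[of i j] by (simp add: c s)
  then show ?thesis
    unfolding of_int_eq_iff by simp
qed

lemma cartan_matrix_diagonal: "a i i = 2"
proof -
  have "(of_int (a i i) :: complex) = of_int 2"
    using cartan_matrix[of i i] dual_form_nonzero[OF simple_root[of i]] by simp
  then show ?thesis unfolding of_int_eq_iff .
qed

text \<open>Both sides are (\<alpha>_i, \<alpha>_j), since d_i is half of (\<alpha>_i,
  \<alpha>_i).\<close>

lemma cartan_matrix_symmetrizable: "int (d i) * a i j = int (d j) * a j i"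
proof -
  have eq: "of_nat (d i) * of_int (a i j) = dual_form H \<kappa> (\<alpha> i) (\<alpha> j)" for i j
  proof -
    have "dual_form H \<kappa> (\<alpha> i) (\<alpha> i) = 2 * of_nat (d i)"
      using half_length[of i] by (simp add: mult.commute)
    then show ?thesis
      using cartan_matrix[of i j] dual_form_nonzero[OF simple_root[of i]] by simp
  qed
  have "dual_form H \<kappa> (\<alpha> i) (\<alpha> j) = dual_form H \<kappa> (\<alpha> j) (\<alpha> i)"
    unfolding dual_form_def by (rule kappa_simps(4))
  then have "(of_int (int (d i) * a i j) :: complex) = of_int (int (d j) * a j i)"
    by (simp add: eq)
  then show ?thesis unfolding of_int_eq_iff .
qed

end

theorem lemma6p4:
  fixes scale :: "complex \<Rightarrow> 'g::ab_group_add \<Rightarrow> 'g"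
    and br :: "'g \<Rightarrow> 'g \<Rightarrow> 'g"
    and H :: "'g set"
    and \<alpha> :: "'i::finite \<Rightarrow> 'g \<Rightarrow> complex"
    and \<kappa> :: "'g \<Rightarrow> 'g \<Rightarrow> complex"
    and a :: "'i \<Rightarrow> 'i \<Rightarrow> int"
    and d :: "'i \<Rightarrow> nat"
    and q :: complex
  assumes "simple_lie_datum scale br H \<alpha> \<kappa> a d"
    and "q \<noteq> 0"
    and "\<forall>i. q ^ (2 * d i) \<noteq> 1"
  shows "(\<forall>(B :: 'b hopf_data) \<pi>. cocentral_morphism (uq a d q) B \<pi> \<longrightarrow>
            (\<forall>x\<in>carrier (uq a d q). \<pi> x = counit (uq a d q) x \<odot>\<^bsub>B\<^esub> \<one>\<^bsub>B\<^esub>)) \<and>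
         is_hopf_cocenter TYPE('b) (uq a d q) trivial_hopf (counit (uq a d q))"
proof -
  interpret L: simple_lie_datum scale br H \<alpha> \<kappa> a d by (rule assms(1))
  interpret Q: quantum_datum a d q
    using assms(2,3) L.cartan_matrix_diagonal L.cartan_matrix_symmetrizable L.cartan_matrix_off_diagonal
    by unfold_locales blast+
  show ?thesis
    using Q.cocentral_eq_counit Q.hopf_cocenter_uq by blast
qed

end
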